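(* Let $A$ be a standard Borel space. For every pure measurable function $f$ defined on an arbitrary product $(X\times Y,\mu\times\nu)$ of two Lebesgue spaces with continuous (atomless) probability measures and taking values in $A$, there exist unique suitable measures $\mu_f$ and $\nu_f$ on $\mathrm{Meas}(A)$ and a unique measurable, pure, tautological function $\mathrm{Can}(f)$ on the space $(\mathrm{Meas}(A)\times\mathrm{Meas}(A),\ \mu_f\times\nu_f)$, with values in $A$, such that $f$ is equivalent to $\mathrm{Can}(f)$. (The function $\mathrm{Can}(f)$ is called the canonical image of $f$.) The measures $\mu_f$ and $\nu_f$ are invariants of the class of equivalent functions: if $f$ and $f_1$ are equivalent pure functions, then $\mu_f=\mu_{f_1}$ and $\nu_f=\nu_{f_1}$.
   Context: All statements about measurable functions and maps are understood mod $0$ (up to null sets). A Lebesgue space means a standard probability space. Equivalence. Measurable functions $f$ on $(X\times Y,\mu\times\nu)$ and $f'$ on $(X'\times Y',\mu'\times\nu')$ with values in $A$ are equivalent if there exist invertible measure-preserving maps $T:(X,\mu)\to(X',\mu')$ and $S:(Y,\nu)\to(Y',\nu')$ such that $f'(Tx,Sy)=f(x,y)$. Pure function. A measurable function $f$ on $(X\times Y,\mu\times\nu)$ is pure if the partition of $X$ into classes of points with equal sections ($x\sim x'$ iff $f(x,\cdot)=f(x',\cdot)$ $\nu$-a.e.) is mod $0$ the partition into points, and likewise the partition of $Y$ given by $y\sim y'$ iff $f(\cdot,y)=f(\cdot,y')$ $\mu$-a.e. is mod $0$ the partition into points. The space $\mathrm{Meas}(A)$. Let $\mathrm{meas}(A)$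 be the simplex of all Borel probability measures on $A$, with the weak topology determined by a countable basis of the $\sigma$-algebra of Borel sets of $A$. Let $S=[0,1]\cup\bigcup_{n=1}^{\infty}\{1+\frac1n\}$. Put $\mathrm{Meas}(A)=\mathrm{meas}(A)\times S$, regarded as the trivial fiber bundle over $\mathrm{meas}(A)$ with fiber $S$, and let $\pi:\mathrm{Meas}(A)\to\mathrm{meas}(A)$ be the natural projection. Suitable measure. A Borel probability measure on $\mathrm{Meas}(A)$ is suitable if it has the following form: its projection to $\mathrm{meas}(A)$ is an arbitrary Borel probability measure on $\mathrm{meas}(A)$, and the conditional measures on the fibers $S$ turn them into general Lebesgue spaces, i.e., the conditional measure restricted to the interval $[0,1]$ is a (possibly zero) multiple of Lebesgue measure, and the masses of the atoms at the points $1+\frac1n$ are nonincreasing in $n$. Tautological function. Let $\kappa,\lambda$ be suitable measures on $\mathrm{Meas}(A)$. A measurable function $F$ on $(\mathrm{Meas}(A)\times\mathrm{Meas}(A),\kappa\times\lambda)$ with values in $A$ is tautological if for $\kappa$-almost every $x$ the distribution of the function $y\mapsto F(x,y)$ (the image of $\lambda$ under this function) is the measure $\pi(x)$ on $A$, and for $\lambda$-almost every $y$ the distribution of the function $x\mapsto F(x,y)$ (the image of $\kappa$) is the measure $\pi(y)$ on $A$.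
   Formalization: Can(f) is proved unique only up to measure-preserving automorphisms of (Meas(A), μ_f) and (Meas(A), ν_f) acting inside the fibres S of π; mod 0 uniqueness is false, e.g. f(x,y)=1[frac(x+y)<1/2], where f(1−x,y) also serves. *)

theory Defs
  imports "HOL-Probability.Probability"
begin

text \<open>
  Only the \<open>\<sigma>\<close>-algebra of \<open>M\<close> matters here: it is the Borel \<open>\<sigma>\<close>-algebra of some Polish
  topology on the carrier.
\<close>

definition standard_borel :: "'a measure \<Rightarrow> bool" where
  "standard_borel M \<longleftrightarrow>
     (\<exists>X. completely_metrizable_space X \<and> separable_space X \<and> topspace X = space M \<and>
          sets M = sigma_sets (topspace X) {U. openin X U})"

text \<open>
  Everything below is invariant mod 0, so a Lebesgue space carries its Borel \<open>\<sigma>\<close>-algebra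
  instead of the completed one; every map that is measurable for the completions agrees almost
  everywhere with a Borel one.
\<close>

definition lebesgue_space :: "'a measure \<Rightarrow> bool" where
  "lebesgue_space M \<longleftrightarrow> prob_space M \<and> standard_borel M"

definition continuous_measure :: "'a measure \<Rightarrow> bool" where
  "continuous_measure M \<longleftrightarrow> (\<forall>x\<in>space M. emeasure M {x} = 0)"

text \<open>Invertibility is meant mod 0: there is a measurable almost everywhere inverse.\<close>

definition invertible_mp :: "'a measure \<Rightarrow> 'b measure \<Rightarrow> ('a \<Rightarrow> 'b) \<Rightarrow> bool" where
  "invertible_mp M N T \<longleftrightarrow>
     T \<in> M \<rightarrow>\<^sub>M N \<and> distr M N T = N \<and>
     (\<exists>R. R \<in> N \<rightarrow>\<^sub>M M \<and> distr N M R = M \<and>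
          (AE x in M. R (T x) = x) \<and> (AE y in N. T (R y) = y))"

definition equivalent_functions ::
  "'x measure \<Rightarrow> 'y measure \<Rightarrow> ('x \<times> 'y \<Rightarrow> 'a) \<Rightarrow>
   'u measure \<Rightarrow> 'v measure \<Rightarrow> ('u \<times> 'v \<Rightarrow> 'a) \<Rightarrow> bool" where
  "equivalent_functions \<mu> \<nu> f \<mu>' \<nu>' f' \<longleftrightarrow>
     (\<exists>T S. invertible_mp \<mu> \<mu>' T \<and> invertible_mp \<nu> \<nu>' S \<and>
            (AE p in \<mu> \<Otimes>\<^sub>M \<nu>. f' (T (fst p), S (snd p)) = f p))"

text \<open>A partition is mod 0 the partition into points iff it separates the points of a conull set.\<close>

definition pure_function :: "'x measure \<Rightarrow> 'y measure \<Rightarrow> ('x \<times> 'y \<Rightarrow> 'a) \<Rightarrow> bool" where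
  "pure_function \<mu> \<nu> f \<longleftrightarrow>
     (\<exists>N\<in>null_sets \<mu>. \<forall>x\<in>space \<mu> - N. \<forall>x'\<in>space \<mu> - N.
        (AE y in \<nu>. f (x, y) = f (x', y)) \<longrightarrow> x = x') \<and>
     (\<exists>N\<in>null_sets \<nu>. \<forall>y\<in>space \<nu> - N. \<forall>y'\<in>space \<nu> - N.
        (AE x in \<mu>. f (x, y) = f (x, y')) \<longrightarrow> y = y')"

definition fibre_set :: "real set" where
  "fibre_set = {0..1} \<union> {1 + 1 / real n | n. 1 \<le> n}"

definition fibre :: "real measure" where
  "fibre = restrict_space borel fibre_set"

text \<open>
  The Borel sets of the weak topology determined by a countable base of \<open>A\<close> are generated by the
  evaluations \<open>m \<mapsto> m(B)\<close>, \<open>B \<in> sets A\<close>, which is the \<open>\<sigma>\<close>-algebra of \<^const>\<open>prob_algebra\<close>; as this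
  topology is second countable, the Borel sets of the product with the fibre are those of the
  product \<open>\<sigma>\<close>-algebra. Below, \<open>\<pi>\<close> is \<^const>\<open>fst\<close>. The measure component of \<open>Meas A\<close> itself is never
  used.
\<close>

definition Meas :: "'a measure \<Rightarrow> ('a measure \<times> real) measure" where
  "Meas A = prob_algebra A \<Otimes>\<^sub>M fibre"

definition suitable_fibre_measure :: "real measure \<Rightarrow> bool" where
  "suitable_fibre_measure k \<longleftrightarrow>
     (\<exists>c::ennreal. \<forall>B\<in>sets borel. B \<subseteq> {0..1} \<longrightarrow> emeasure k B = c * emeasure lborel B) \<and>
     (\<forall>n::nat. 1 \<le> n \<longrightarrow> emeasure k {1 + 1 / real (Suc n)} \<le> emeasure k {1 + 1 / real n})"

text \<open>\<open>K\<close> is the system of conditional measures of \<open>\<kappa>\<close> on the fibres of the projection.\<close>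

definition suitable :: "'a measure \<Rightarrow> ('a measure \<times> real) measure \<Rightarrow> bool" where
  "suitable A \<kappa> \<longleftrightarrow>
     sets \<kappa> = sets (Meas A) \<and> prob_space \<kappa> \<and>
     (\<exists>K. K \<in> prob_algebra A \<rightarrow>\<^sub>M prob_algebra fibre \<and>
          (\<forall>B\<in>sets (Meas A).
             emeasure \<kappa> B = (\<integral>\<^sup>+ m. emeasure (K m) (Pair m -` B) \<partial>distr \<kappa> (prob_algebra A) fst)) \<and>
          (AE m in distr \<kappa> (prob_algebra A) fst. suitable_fibre_measure (K m)))"

definition tautological ::
  "'a measure \<Rightarrow> ('a measure \<times> real) measure \<Rightarrow> ('a measure \<times> real) measure \<Rightarrow>
   (('a measure \<times> real) \<times> ('a measure \<times> real) \<Rightarrow> 'a) \<Rightarrow> bool" where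
  "tautological A \<kappa> \<kappa>' F \<longleftrightarrow>
     (AE x in \<kappa>. distr \<kappa>' A (\<lambda>y. F (x, y)) = fst x) \<and>
     (AE y in \<kappa>'. distr \<kappa> A (\<lambda>x. F (x, y)) = fst y)"

definition canonical_image ::
  "'a measure \<Rightarrow> 'x measure \<Rightarrow> 'y measure \<Rightarrow> ('x \<times> 'y \<Rightarrow> 'a) \<Rightarrow>
   ('a measure \<times> real) measure \<Rightarrow> ('a measure \<times> real) measure \<Rightarrow>
   (('a measure \<times> real) \<times> ('a measure \<times> real) \<Rightarrow> 'a) \<Rightarrow> bool" where
  "canonical_image A \<mu> \<nu> f \<kappa> \<kappa>' F \<longleftrightarrow>
     suitable A \<kappa> \<and> suitable A \<kappa>' \<and>
     F \<in> \<kappa> \<Otimes>\<^sub>M \<kappa>' \<rightarrow>\<^sub>M A \<and> pure_function \<kappa> \<kappa>' F \<and> tautological A \<kappa> \<kappa>' F \<and>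
     equivalent_functions \<mu> \<nu> f \<kappa> \<kappa>' F"

text \<open>
  The sense in which the canonical image is unique: up to automorphisms of the two measure spaces
  that move points only inside the fibres of \<open>\<pi>\<close>. Equality almost everywhere would be too strong.
  For example, let \<open>F\<close> be the indicator of \<open>frac (s + t) < 1/2\<close> on the square of the fibre \<open>[0,1]\<close>
  over the uniform measure on \<open>{0,1}\<close>; then \<open>F (1 - s, t)\<close> is another pure tautological
  function, equivalent to \<open>F\<close>.
\<close>

definition equal_upto_fibres ::
  "('m \<times> 's) measure \<Rightarrow> ('n \<times> 't) measure \<Rightarrow>
   (('m \<times> 's) \<times> ('n \<times> 't) \<Rightarrow> 'a) \<Rightarrow> (('m \<times> 's) \<times> ('n \<times> 't) \<Rightarrow> 'a) \<Rightarrow> bool" where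
  "equal_upto_fibres \<kappa> \<kappa>' F G \<longleftrightarrow>
     (\<exists>T S. invertible_mp \<kappa> \<kappa> T \<and> (AE x in \<kappa>. fst (T x) = fst x) \<and>
            invertible_mp \<kappa>' \<kappa>' S \<and> (AE y in \<kappa>'. fst (S y) = fst y) \<and>
            (AE p in \<kappa> \<Otimes>\<^sub>M \<kappa>'. G (T (fst p), S (snd p)) = F p))"

end

theory Submission
  imports Defs
begin

text \<open>
  For a point \<open>x\<close> let \<open>p x\<close> be the distribution of \<open>f (x, \<cdot>)\<close>. Disintegrate \<open>\<mu>\<close> over \<open>p\<close>. On each
  conditional measure, the normalized distribution function of the continuous part and the rank of
  the atoms give a coordinate in the fibre, measurably in the base point; together with \<open>p\<close> it is an
  isomorphism of \<open>\<mu>\<close> onto a suitable measure. Transporting \<open>f\<close> along the two isomorphisms yields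
  the canonical image, which is tautological by the choice of \<open>p\<close>. Conversely, tautology forces the
  first component of any isomorphism onto a canonical image to be \<open>p\<close>, so two canonical images
  differ by fibre-preserving isomorphisms. These induce isomorphisms of almost all conditional
  measures, and isomorphic suitable fibre measures have the same atoms, hence are equal.
\<close>

subsection \<open>Standard Borel spaces as subsets of the line\<close>

text \<open>Nothing is canonical inside the fibres: the coordinate depends on the order that a
  coding of the Lebesgue space by real numbers happens to induce. Hence \<open>Can\<close> is
  determined only up to fibre automorphisms, while the measures retain just intrinsic data: the law
  of \<open>p\<close> and the atom masses of the conditional measures. The weight of Lebesgue
  measure is then whatever is missing to 1. The difficulty lies in measurability. Conditional
  measures are specified only up to a null set of base points, so coordinates have to be measurable
  jointly in base point and point, and statements about almost all fibres are reduced to countably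
  many, indexed by rational numbers. Invertibility mod 0 requires a measurable inverse;
  disintegration over the values of the map supplies it without any theorem on Borel images of
  injective maps. Equations such as \<open>T (R y) = y\<close> hold between points of
  \<open>Meas A\<close>, so its diagonal has to be measurable; this is where standardness of
  \<open>A\<close> enters.\<close>

lemma countable_family_coding:
  fixes E :: "nat \<Rightarrow> 'x set"
  assumes E [measurable]: "\<And>i. E i \<in> sets X"
  shows "\<exists>(\<phi> :: 'x \<Rightarrow> real) b. \<phi> \<in> borel_measurable X \<and> (\<forall>x. \<phi> x \<in> {0..1}) \<and> (\<forall>i. b i \<in> sets borel) \<and>
    (\<forall>i. \<forall>x\<in>space X. x \<in> E i \<longleftrightarrow> \<phi> x \<in> b i)"
proof -
  \<comment> \<open>The membership pattern of \<open>x\<close> is written in base 3 with digits 0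
    and 1, and \<open>\<phi> i\<close> is the expansion of the pattern from index \<open>i\<close>
    on. In base 3 a tail is at most 1/2, so the leading digit is 1 exactly if the tripled number is
    at least 1; base 2 would have ambiguous expansions.\<close>
  define t :: "nat \<Rightarrow> 'x \<Rightarrow> nat \<Rightarrow> real"
    where "t i x j = indicator (E (i + j)) x * (1/3) ^ Suc j" for i x j
  define \<phi> :: "nat \<Rightarrow> 'x \<Rightarrow> real" where "\<phi> i x = (\<Sum>j. t i x j)" for i x
  \<comment> \<open>The digit shift, defined on all reals: tripling and removing the leading digit
    turns \<open>\<phi> i x\<close> into \<open>\<phi> (Suc i) x\<close>. Thus every digit is a
    Borel function of \<open>\<phi> 0 x\<close> alone.\<close>
  define z :: "nat \<Rightarrow> real \<Rightarrow> real"
    where "z = rec_nat (\<lambda>s. s) (\<lambda>_ g s. 3 * g s - (if 3 * g s \<ge> 1 then 1 else 0))"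
  have z0: "z 0 s = s" and zS: "z (Suc i) s = 3 * z i s - (if 3 * z i s \<ge> 1 then 1 else 0)" for i s
    by (simp_all add: z_def)
  have geo: "(\<lambda>j. (1/3::real) ^ Suc j) sums (1/2)"
    using sums_mult[OF geometric_sums[of "1/3::real"], of "1/3"] by simp
  have le: "t i x j \<le> (1/3) ^ Suc j" "0 \<le> t i x j" for i x j
    by (auto simp: t_def indicator_def)
  have summ: "summable (t i x)" for i x
    by (rule summable_comparison_test'[OF sums_summable[OF geo], of 0])
      (use le[of i x] in \<open>simp add: abs_of_nonneg\<close>)
  have \<phi>le: "\<phi> i x \<le> 1/2" for i x
    unfolding \<phi>_def sums_unique[OF geo] by (rule suminf_le[OF le(1) summ sums_summable[OF geo]])
  have \<phi>ge: "0 \<le> \<phi> i x" for i x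
    unfolding \<phi>_def by (rule suminf_nonneg[OF summ le(2)])
  have step: "3 * \<phi> i x = indicator (E i) x + \<phi> (Suc i) x" for i x
  proof -
    have "\<phi> i x = t i x 0 + (\<Sum>j. t i x (Suc j))"
      unfolding \<phi>_def by (subst suminf_split_head[OF summ]) simp
    also have "(\<lambda>j. t i x (Suc j)) = (\<lambda>j. 1/3 * t (Suc i) x j)"
      by (auto simp: t_def)
    also have "(\<Sum>j. 1/3 * t (Suc i) x j) = 1/3 * \<phi> (Suc i) x"
      unfolding \<phi>_def by (rule suminf_mult[OF summ])
    finally show ?thesis by (simp add: t_def)
  qed
  have z\<phi>: "z i (\<phi> 0 x) = \<phi> i x" for i x
  proof (induction i)
    case (Suc i)
    then show ?case
      using step[of i x] \<phi>le[of "Suc i" x] \<phi>ge[of "Suc i" x] by (auto simp: zS indicator_def split: if_splits)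
  qed (simp add: z0)
  have [measurable]: "z i \<in> borel_measurable borel" for i
  proof (induction i)
    case 0
    show ?case unfolding z0[abs_def] by simp
  next
    case (Suc i)
    note [measurable] = this
    show ?case unfolding zS[abs_def] by measurable
  qed
  show ?thesis
  proof (intro exI[of _ "\<phi> 0"] exI[of _ "\<lambda>i. {s. 3 * z i s \<ge> 1}"] conjI allI ballI)
    show "\<phi> 0 \<in> borel_measurable X"
      unfolding \<phi>_def t_def by measurable
    show "\<phi> 0 x \<in> {0..1}" for x
      using \<phi>le[of 0 x] \<phi>ge[of 0 x] by auto
    show "{s. 3 * z i s \<ge> 1} \<in> sets borel" for i
      by measurable
    show "x \<in> E i \<longleftrightarrow> \<phi> 0 x \<in> {s. 3 * z i s \<ge> 1}" if "x \<in> space X" for i x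
      using step[of i x] \<phi>le[of "Suc i" x] \<phi>ge[of "Suc i" x] by (auto simp: z\<phi> indicator_def split: if_splits)
  qed
qed

text \<open>
  A point of a separable complete metric space is determined by its distances to a dense sequence;
  the sequences of distances arising in this way form a Borel set, described by triangle
  inequalities and the infimum being zero.
\<close>

lemma (in Metric_space) distances_to_dense_sequence:
  fixes a :: "nat \<Rightarrow> 'a" and w :: "nat \<Rightarrow> ennreal"
  assumes "mcomplete" and a: "\<And>j. a j \<in> M"
    and w1: "\<And>j k. w j \<le> w k + ennreal (d (a j) (a k))"
    and w2: "\<And>j k. ennreal (d (a j) (a k)) \<le> w j + w k"
    and w3: "\<And>n. \<exists>j. w j < ennreal (1 / Suc n)"
  shows "\<exists>x\<in>M. \<forall>j. w j = ennreal (d (a j) x)"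
proof -
  \<comment> \<open>\<open>a (c n)\<close> should lie within \<open>1 / Suc n\<close> of the point
    sought. Assumption \<open>w2\<close> makes these points a Cauchy sequence, and its limit is the
    point.\<close>
  obtain c where c: "\<And>n. w (c n) < ennreal (1 / Suc n)"
    using w3 by metis
  have fin: "w j < \<top>" for j
    using w1[of j "c 0"] c[of 0] by (metis ennreal_add_eq_top ennreal_less_top less_top neq_top_trans not_less_iff_gr_or_eq order_less_imp_le top_greatest infinity_ennreal_def)
  define v where "v j = enn2real (w j)" for j
  have wv: "w j = ennreal (v j)" for j
    using fin[of j] by (simp add: v_def less_top)
  have v0: "0 \<le> v j" for j by (simp add: v_def)
  have v1: "v j \<le> v k + d (a j) (a k)" for j k
    using w1[of j k] v0 by (simp add: wv ennreal_plus[symmetric] del: ennreal_plus)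
  have v2: "d (a j) (a k) \<le> v j + v k" for j k
    using w2[of j k] v0 by (simp add: wv ennreal_plus[symmetric] del: ennreal_plus)
  have vc: "v (c n) < 1 / Suc n" for n
    using c[of n] v0 by (simp add: wv ennreal_less_iff)
  have "MCauchy (\<lambda>n. a (c n))"
    unfolding MCauchy_def
  proof (intro conjI allI impI)
    fix \<epsilon> :: real assume "\<epsilon> > 0"
    then obtain N where N: "1 / Suc N < \<epsilon> / 2"
      using nat_approx_posE[of "\<epsilon>/2"] by auto
    have *: "1 / Suc n \<le> 1 / Suc N" if "N \<le> n" for n
      using that by (simp add: frac_le)
    show "\<exists>N. \<forall>n n'. N \<le> n \<longrightarrow> N \<le> n' \<longrightarrow> d (a (c n)) (a (c n')) < \<epsilon>"
    proof (intro exI[of _ N] allI impI)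
      fix n n' assume "N \<le> n" "N \<le> n'"
      then show "d (a (c n)) (a (c n')) < \<epsilon>"
        using v2[of "c n" "c n'"] vc[of n] vc[of n'] *[of n] *[of n'] N by linarith
    qed
  qed (use a in auto)
  then obtain x where x: "limitin mtopology (\<lambda>n. a (c n)) x sequentially"
    using \<open>mcomplete\<close> unfolding mcomplete_def by blast
  then have xM: "x \<in> M" using limitin_mspace by blast
  have d0: "(\<lambda>n. d (a (c n)) x) \<longlonglongrightarrow> 0"
    using x unfolding limitin_metric tendsto_iff
    by (auto simp: dist_real_def elim!: allE eventually_mono)
  have "v j = d (a j) x" for j
  proof -
    \<comment> \<open>\<open>v1\<close> and \<open>v2\<close> say that \<open>v j\<close> differs
      from the distance between \<open>a j\<close> and \<open>a (c n)\<close> by at most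
      \<open>v (c n)\<close>; passing from \<open>a (c n)\<close> to \<open>x\<close> costs one more
      distance that tends to 0.\<close>
    have "\<bar>v j - d (a j) x\<bar> \<le> 1 / Suc n + d (a (c n)) x" for n
      using v1[of j "c n"] v2[of j "c n"] vc[of n] triangle[OF a[of j] a[of "c n"] xM]
        triangle[OF a[of j] xM a[of "c n"]] commute[of x "a (c n)"] by linarith
    moreover have "(\<lambda>n. 1 / real (Suc n) + d (a (c n)) x) \<longlonglongrightarrow> 0 + 0"
      by (intro tendsto_add d0 LIMSEQ_Suc lim_1_over_n)
    ultimately have "\<bar>v j - d (a j) x\<bar> \<le> 0 + 0"
      by (intro LIMSEQ_le_const) auto
    then show ?thesis by simp
  qed
  then show ?thesis using xM by (auto simp: wv)
qed

text \<open>The code of a point records which balls of rational radius around a dense sequence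
  contain it. \<open>R\<close> is a Borel left inverse defined on the whole line, so it is never
  necessary to know that the range of \<open>\<phi>\<close> is a Borel set.\<close>

lemma standard_borel_coding:
  fixes X :: "'x measure"
  assumes "standard_borel X" "space X \<noteq> {}"
  obtains \<phi> :: "'x \<Rightarrow> real" and R :: "real \<Rightarrow> 'x"
  where "\<phi> \<in> X \<rightarrow>\<^sub>M borel" "\<And>x. \<phi> x \<in> {0..1}" "R \<in> borel \<rightarrow>\<^sub>M X" "\<And>x. x \<in> space X \<Longrightarrow> R (\<phi> x) = x"
proof -
  obtain \<T> where \<T>: "completely_metrizable_space \<T>" "separable_space \<T>" "topspace \<T> = space X"
      "sets X = sigma_sets (topspace \<T>) {U. openin \<T> U}"
    using assms(1) unfolding standard_borel_def by blast
  obtain M d where "Metric_space M d" and compl: "Metric_space.mcomplete M d"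
    and top: "\<T> = Metric_space.mtopology M d"
    using \<T>(1) unfolding completely_metrizable_space_def by blast
  interpret Metric_space M d by fact
  have M: "space X = M" using \<T>(3) by (simp add: top)
  have sets_X: "sets X = sigma_sets M {U. openin mtopology U}"
    using \<T>(4) by (simp add: top)
  obtain D where D: "countable D" "D \<subseteq> M" "mtopology closure_of D = M"
    using \<T>(2) unfolding separable_space_def top by auto
  have "D \<noteq> {}" using D(3) assms(2) M by auto
  define a where "a = from_nat_into D"
  have a: "a j \<in> M" for j
    using from_nat_into[OF \<open>D \<noteq> {}\<close>] D(2) by (auto simp: a_def)
  have dense: "\<exists>j. d (a j) x < r" if xr: "x \<in> M" "r > 0" for x r
  proof -
    have "x \<in> mtopology closure_of D" using D(3) xr by simp
    then obtain y where "y \<in> D" "y \<in> mball x r"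
      using xr unfolding metric_closure_of by blast
    moreover obtain j where "y = a j"
      using \<open>y \<in> D\<close> D(1) unfolding a_def by (metis from_nat_into_surj)
    ultimately show ?thesis using commute by (auto simp: in_mball)
  qed
  define q where "q = from_nat_into (\<rat> :: real set)"
  have qdense: "\<exists>i. u < q i \<and> q i < v" if "u < v" for u v
    using Rats_dense_in_real[OF that] countable_rat from_nat_into_surj[of "\<rat>::real set"]
    unfolding q_def by metis
  define E where "E p = mball (a (fst (prod_decode p))) (q (snd (prod_decode p)))" for p
  have E: "E p \<in> sets X" for p
    unfolding sets_X E_def by (intro sigma_sets.Basic) auto
  obtain \<phi> :: "'x \<Rightarrow> real" and b where \<phi>: "\<phi> \<in> borel_measurable X" "\<And>x. \<phi> x \<in> {0..1}"
    and b [measurable]: "\<And>i. b i \<in> sets borel"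
    and b\<phi>: "\<And>i x. x \<in> space X \<Longrightarrow> x \<in> E i \<longleftrightarrow> \<phi> x \<in> b i"
    using countable_family_coding[of E X, OF E] by blast
  \<comment> \<open>Reads a distance off the code: the infimum of the radii whose ball is marked in
    \<open>z\<close>. On genuine codes this is \<open>d (a j) x\<close>; on other reals it may be
    anything, including the top element.\<close>
  define w :: "nat \<Rightarrow> real \<Rightarrow> ennreal"
    where "w j z = (INF i. if z \<in> b (prod_encode (j, i)) then ennreal (q i) else \<top>)" for j z
  have w_meas [measurable]: "w j \<in> borel_measurable borel" for j
    unfolding w_def by measurable
  have w\<phi>: "w j (\<phi> x) = ennreal (d (a j) x)" if "x \<in> M" for j x
  proof -
    have iff: "\<phi> x \<in> b (prod_encode (j, i)) \<longleftrightarrow> d (a j) x < q i" for i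
      using b\<phi>[of x "prod_encode (j, i)"] that a by (auto simp: E_def M in_mball)
    show ?thesis
    proof (rule antisym)
      show "w j (\<phi> x) \<le> ennreal (d (a j) x)"
      proof (rule ennreal_le_epsilon)
        fix e :: real assume "e > 0"
        then obtain i where i: "d (a j) x < q i" "q i < d (a j) x + e"
          using qdense[of "d (a j) x" "d (a j) x + e"] by auto
        then have "w j (\<phi> x) \<le> ennreal (q i)"
          unfolding w_def iff by (intro INF_lower2[of i]) auto
        also have "\<dots> \<le> ennreal (d (a j) x + e)" using i by (intro ennreal_leI) simp
        finally show "w j (\<phi> x) \<le> ennreal (d (a j) x) + ennreal e"
          using \<open>e > 0\<close> nonneg by simp
      qed
      show "ennreal (d (a j) x) \<le> w j (\<phi> x)"
        unfolding w_def iff by (intro INF_greatest) (auto intro!: ennreal_leI)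
    qed
  qed
  \<comment> \<open>The premises of \<open>distances_to_dense_sequence\<close>. They are countably
    many Borel conditions on \<open>z\<close>, and they hold on all genuine codes; elsewhere
    \<open>R\<close> takes the default value \<open>x0\<close>.\<close>
  define P where "P z \<longleftrightarrow> (\<forall>j k. w j z \<le> w k z + ennreal (d (a j) (a k))) \<and>
    (\<forall>j k. ennreal (d (a j) (a k)) \<le> w j z + w k z) \<and>
    (\<forall>n::nat. \<exists>j. w j z < ennreal (1 / Suc n))" for z
  have P_meas [measurable]: "Measurable.pred borel P"
    unfolding P_def by measurable
  have P: "\<exists>x\<in>M. \<forall>j. w j z = ennreal (d (a j) x)" if "P z" for z
    using that compl a unfolding P_def by (intro distances_to_dense_sequence) auto
  have uniq: "x = y" if xy: "x \<in> M" "y \<in> M" "\<And>j. d (a j) x = d (a j) y" for x y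
  proof (rule ccontr)
    assume "x \<noteq> y"
    then have "0 < d x y" using xy by simp
    then obtain j where "d (a j) x < d x y / 2" using dense[OF xy(1), of "d x y / 2"] by auto
    then show False using triangle[OF xy(1) a[of j] xy(2)] xy(3)[of j] commute[of x "a j"] by linarith
  qed
  obtain x0 where x0: "x0 \<in> M" using assms(2) M by auto
  define R where "R z = (if P z then THE x. x \<in> M \<and> (\<forall>j. w j z = ennreal (d (a j) x)) else x0)" for z
  have R: "R z \<in> M \<and> (\<forall>j. w j z = ennreal (d (a j) (R z)))" if "P z" for z
  proof -
    have ex1: "\<exists>!x. x \<in> M \<and> (\<forall>j. w j z = ennreal (d (a j) x))"
    proof (rule ex_ex1I)
      show "\<exists>x. x \<in> M \<and> (\<forall>j. w j z = ennreal (d (a j) x))" using P[OF that] by blast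
      fix x y assume "x \<in> M \<and> (\<forall>j. w j z = ennreal (d (a j) x))" "y \<in> M \<and> (\<forall>j. w j z = ennreal (d (a j) y))"
      then have "ennreal (d (a j) x) = ennreal (d (a j) y)" for j by metis
      then show "x = y"
        using \<open>x \<in> M \<and> _\<close> \<open>y \<in> M \<and> _\<close> by (intro uniq) (simp_all add: ennreal_inj)
    qed
    have Rz: "R z = (THE x. x \<in> M \<and> (\<forall>j. w j z = ennreal (d (a j) x)))"
      using that by (simp only: R_def if_True)
    show ?thesis unfolding Rz by (rule theI'[OF ex1])
  qed
  show ?thesis
  proof (rule that[OF \<phi>])
    show "R (\<phi> x) = x" if "x \<in> space X" for x
    proof -
      have x: "x \<in> M" using that M by simp
      have P\<phi>: "P (\<phi> x)"
        unfolding P_def w\<phi>[OF x]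
      proof (intro conjI allI)
        fix j k
        show "ennreal (d (a j) x) \<le> ennreal (d (a k) x) + ennreal (d (a j) (a k))"
          using triangle[OF a[of j] a[of k] x] by (simp add: ennreal_plus[symmetric] add.commute del: ennreal_plus)
        show "ennreal (d (a j) (a k)) \<le> ennreal (d (a j) x) + ennreal (d (a k) x)"
          using triangle[OF a[of j] x a[of k]] commute[of x "a k"]
          by (simp add: ennreal_plus[symmetric] del: ennreal_plus)
      next
        fix n :: nat
        show "\<exists>j. ennreal (d (a j) x) < ennreal (1 / Suc n)"
          using dense[OF x, of "1 / Suc n"] by (simp add: ennreal_less_iff)
      qed
      show ?thesis
      proof (rule uniq)
        show "R (\<phi> x) \<in> M" "x \<in> M" using R[OF P\<phi>] x by simp_all
        have "ennreal (d (a j) (R (\<phi> x))) = ennreal (d (a j) x)" for j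
          using R[OF P\<phi>] w\<phi>[OF x] by metis
        then show "d (a j) (R (\<phi> x)) = d (a j) x" for j
          by (simp add: ennreal_inj)
      qed
    qed
    have RM: "R z \<in> M" for z
    proof (cases "P z")
      case True
      then show ?thesis using R by blast
    next
      case False
      then show ?thesis using x0 by (simp add: R_def)
    qed
    show "R \<in> borel \<rightarrow>\<^sub>M X"
    proof (rule measurable_sigma_sets[OF sets_X])
      show "R \<in> space borel \<rightarrow> M" using RM by auto
      show "{U. openin mtopology U} \<subseteq> Pow M" using openin_subset[of mtopology] by auto
      fix U assume "U \<in> {U. openin mtopology U}"
      then have U: "U \<subseteq> M" "\<And>x. x \<in> U \<Longrightarrow> \<exists>r>0. mball x r \<subseteq> U"
        unfolding mem_Collect_eq openin_mtopology by auto
      \<comment> \<open>Whether a ball lies inside \<open>U\<close> does not depend on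
        \<open>z\<close>, so the right side is a countable union of Borel conditions on the
        functions \<open>w j\<close>. The radius bounds both the ball and the distance of
        \<open>R z\<close> to its centre.\<close>
      have iff: "R z \<in> U \<longleftrightarrow> (if P z then \<exists>j n. mball (a j) (1 / real (Suc n)) \<subseteq> U \<and> w j z < ennreal (1 / real (Suc n))
          else x0 \<in> U)" for z
      proof (cases "P z")
        case True
        have wR: "w j z = ennreal (d (a j) (R z))" for j using R[OF True] by simp
        have "\<exists>j n. mball (a j) (1 / real (Suc n)) \<subseteq> U \<and> d (a j) (R z) < 1 / real (Suc n)" if RU: "R z \<in> U"
        proof -
          obtain r where r: "r > 0" "mball (R z) r \<subseteq> U" using U(2)[OF RU] by auto
          obtain n where n: "1 / real (Suc n) < r / 2" using nat_approx_posE[of "r/2"] r by auto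
          obtain j where j: "d (a j) (R z) < 1 / real (Suc n)"
            using dense[OF RM[of z], of "1 / real (Suc n)"] by auto
          have "mball (a j) (1 / real (Suc n)) \<subseteq> mball (R z) r"
          proof
            fix y assume "y \<in> mball (a j) (1 / real (Suc n))"
            then show "y \<in> mball (R z) r"
              using triangle[OF RM[of z] a[of j], of y] j n RM[of z] commute[of "R z" "a j"] by (auto simp: in_mball)
          qed
          then show ?thesis using r j by blast
        qed
        moreover have "R z \<in> U" if "mball (a j) (1 / real (Suc n)) \<subseteq> U" "d (a j) (R z) < 1 / real (Suc n)" for j n
          using that RM[of z] a[of j] by (auto simp: in_mball)
        ultimately show ?thesis using True by (auto simp: wR ennreal_less_iff)
      qed (simp add: R_def)
      have "R -` U \<inter> space borel = {z \<in> space borel. if P z then \<exists>j n. mball (a j) (1 / real (Suc n)) \<subseteq> U \<and>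
          w j z < ennreal (1 / real (Suc n)) else x0 \<in> U}"
        unfolding set_eq_iff Int_iff vimage_eq mem_Collect_eq iff by (intro allI conj_commute)
      also have "\<dots> \<in> sets borel" by measurable
      finally show "R -` U \<inter> space borel \<in> sets borel" .
    qed
  qed
qed

subsection \<open>Disintegration\<close>

text \<open>The clause on conditional measures in \<open>suitable\<close>, freed from
  \<open>Meas\<close>: the same notion then covers kernels on the line, before coordinates are
  introduced, and kernels on \<open>fibre\<close> afterwards.\<close>

definition disintegration ::
    "'m measure \<Rightarrow> 's measure \<Rightarrow> ('m \<times> 's) measure \<Rightarrow> ('m \<Rightarrow> 's measure) \<Rightarrow> bool" where
  "disintegration B N \<kappa> K \<longleftrightarrow> K \<in> B \<rightarrow>\<^sub>M prob_algebra N \<and>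
     (\<forall>E\<in>sets (B \<Otimes>\<^sub>M N).
        emeasure \<kappa> E = (\<integral>\<^sup>+ m. emeasure (K m) (Pair m -` E) \<partial>distr \<kappa> B fst))"

lemma kernel_prob_space:
  "K \<in> B \<rightarrow>\<^sub>M prob_algebra N \<Longrightarrow> m \<in> space B \<Longrightarrow> prob_space (K m)"
  by (drule (1) measurable_space) (simp add: space_prob_algebra)

lemma kernel_sets:
  "K \<in> B \<rightarrow>\<^sub>M prob_algebra N \<Longrightarrow> m \<in> space B \<Longrightarrow> sets (K m) = sets N"
  by (drule (1) measurable_space) (simp add: space_prob_algebra)

lemma kernel_space:
  "K \<in> B \<rightarrow>\<^sub>M prob_algebra N \<Longrightarrow> m \<in> space B \<Longrightarrow> space (K m) = space N"
  by (intro sets_eq_imp_space_eq kernel_sets)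

lemma measurable_kernel_nn_integral:
  assumes "K \<in> B \<rightarrow>\<^sub>M prob_algebra N" "(\<lambda>(m, x). h m x) \<in> borel_measurable (B \<Otimes>\<^sub>M N)"
  shows "(\<lambda>m. \<integral>\<^sup>+ x. h m x \<partial>K m) \<in> borel_measurable B"
  by (rule nn_integral_measurable_subprob_algebra2[OF assms(2) measurable_prob_algebraD[OF assms(1)]])

lemma measurable_kernel_section:
  assumes K: "K \<in> B \<rightarrow>\<^sub>M prob_algebra N" and E: "E \<in> sets (B \<Otimes>\<^sub>M N)"
  shows "(\<lambda>m. emeasure (K m) (Pair m -` E)) \<in> borel_measurable B"
proof (rule emeasure_measurable_subprob_algebra2[OF _ measurable_prob_algebraD[OF K]])
  have "Sigma (space B) (\<lambda>m. Pair m -` E) = E"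
    using sets.sets_into_space[OF E] by (auto simp: space_pair_measure)
  then show "Sigma (space B) (\<lambda>m. Pair m -` E) \<in> sets (B \<Otimes>\<^sub>M N)" using E by simp
qed

lemma measurable_kernel_emeasure:
  "K \<in> B \<rightarrow>\<^sub>M prob_algebra N \<Longrightarrow> D \<in> sets N \<Longrightarrow> (\<lambda>m. emeasure (K m) D) \<in> borel_measurable B"
  by (intro measurable_emeasure_kernel measurable_prob_algebraD)

text \<open>The right side of the disintegration formula is itself a measure: the marginal composed
  with the kernel \<open>L\<close> that places \<open>K m\<close> on the slice over
  \<open>m\<close>. Rectangles form an intersection-stable generator, so agreement there
  suffices.\<close>

lemma disintegrationI_rectangles:
  fixes B :: "'m measure" and N :: "'s measure"
  assumes "prob_space \<kappa>" and sets: "sets \<kappa> = sets (B \<Otimes>\<^sub>M N)" and K: "K \<in> B \<rightarrow>\<^sub>M prob_algebra N"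
    and rect: "\<And>C D. C \<in> sets B \<Longrightarrow> D \<in> sets N \<Longrightarrow>
      emeasure \<kappa> (C \<times> D) = (\<integral>\<^sup>+ m. emeasure (K m) D * indicator C m \<partial>distr \<kappa> B fst)"
  shows "disintegration B N \<kappa> K"
proof -
  interpret prob_space \<kappa> by fact
  define M where "M = distr \<kappa> B fst"
  have [measurable]: "fst \<in> \<kappa> \<rightarrow>\<^sub>M B"
    using measurable_cong_sets[OF sets refl] measurable_fst by blast
  have sM [simp]: "sets M = sets B" "space M = space B" by (simp_all add: M_def)
  interpret M: prob_space M unfolding M_def by (intro prob_space_distr) measurable
  define L where "L m = distr (K m) (B \<Otimes>\<^sub>M N) (Pair m)" for m
  have L: "L \<in> B \<rightarrow>\<^sub>M prob_algebra (B \<Otimes>\<^sub>M N)"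
    unfolding L_def using K by measurable
  have LE: "emeasure (L m) E = emeasure (K m) (Pair m -` E)" if "m \<in> space B" "E \<in> sets (B \<Otimes>\<^sub>M N)" for m E
  proof -
    have m: "Pair m \<in> K m \<rightarrow>\<^sub>M B \<Otimes>\<^sub>M N"
      using that kernel_sets[OF K] by (simp cong: measurable_cong_sets)
    have "Pair m -` E \<inter> space (K m) = Pair m -` E"
      using sets.sets_into_space[OF that(2)] kernel_space[OF K that(1)] by (auto simp: space_pair_measure)
    then show ?thesis using that unfolding L_def by (subst emeasure_distr[OF m]) auto
  qed
  have J: "emeasure (M \<bind> L) E = (\<integral>\<^sup>+ m. emeasure (K m) (Pair m -` E) \<partial>M)" if "E \<in> sets (B \<Otimes>\<^sub>M N)" for E
    using L that by (subst emeasure_bind[where N="B \<Otimes>\<^sub>M N"])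
      (auto simp: M.not_empty[simplified] LE measurable_prob_algebraD cong: measurable_cong_sets intro!: nn_integral_cong)
  have "\<kappa> = M \<bind> L"
  proof (rule measure_eqI_generator_eq[OF Int_stable_pair_measure_generator, of B N _ _ _ "\<lambda>_. space B \<times> space N"])
    show "{a \<times> b |a b. a \<in> sets B \<and> b \<in> sets N} \<subseteq> Pow (space B \<times> space N)"
      by (rule pair_measure_closed)
    show "sets \<kappa> = sigma_sets (space B \<times> space N) {a \<times> b |a b. a \<in> sets B \<and> b \<in> sets N}"
      using sets sets_pair_measure by simp
    have "sets (M \<bind> L) = sets (B \<Otimes>\<^sub>M N)"
      using sets_bind[of M L "B \<Otimes>\<^sub>M N"] kernel_sets[OF L] M.not_empty by auto
    then show "sets (M \<bind> L) = sigma_sets (space B \<times> space N) {a \<times> b |a b. a \<in> sets B \<and> b \<in> sets N}"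
      using sets_pair_measure by simp
    fix X assume "X \<in> {a \<times> b |a b. a \<in> sets B \<and> b \<in> sets N}"
    then obtain C D where X: "X = C \<times> D" "C \<in> sets B" "D \<in> sets N" by auto
    have "emeasure (M \<bind> L) X = (\<integral>\<^sup>+ m. emeasure (K m) D * indicator C m \<partial>M)"
      unfolding X(1) by (subst J) (use X in \<open>auto intro!: nn_integral_cong simp: indicator_def\<close>)
    then show "emeasure \<kappa> X = emeasure (M \<bind> L) X"
      using rect[OF X(2,3)] X by (simp add: M_def)
  qed auto
  then show ?thesis
    unfolding disintegration_def M_def[symmetric] using J K by auto
qed

text \<open>The computation behind the quantile construction: a uniform variable lies below a
  prescribed tail value with exactly that probability.\<close>

lemma emeasure_uniform_atMost:
  fixes h :: ennreal
  assumes "h \<le> 1"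
  shows "emeasure (uniform_measure lborel {0<..<1}) {u. ennreal u \<le> h} = h"
proof -
  obtain r where r: "h = ennreal r" "0 \<le> r" "r \<le> 1"
    using assms by (cases h) (auto simp: top_unique)
  have "{0<..<1} \<inter> {u. ennreal u \<le> h} = (if r = 1 then {0<..<1} else {0<..r})"
    using r by (auto simp: ennreal_le_iff)
  moreover have "{u. ennreal u \<le> h} \<in> sets borel" by measurable
  ultimately show ?thesis
    using r by (simp add: emeasure_uniform_measure divide_ennreal_def one_ennreal_def[symmetric])
qed

lemma rational_decseq_above:
  fixes x :: real
  shows "\<exists>q::nat \<Rightarrow> real. decseq q \<and> range q \<subseteq> \<rat> \<and> (\<forall>n. x < q n) \<and> q \<longlonglongrightarrow> x \<and>
    (x \<in> {0..<1} \<longrightarrow> range q \<subseteq> {0..1})"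
proof -
  define q :: "nat \<Rightarrow> real" where "q n = (of_int \<lfloor>x * 2 ^ n\<rfloor> + 1) / 2 ^ n" for n
  have gt: "x < q n" for n
    unfolding q_def by (simp add: field_simps) linarith
  have le: "q n \<le> x + 1 / 2 ^ n" for n
    unfolding q_def by (simp add: field_simps)
  have "q (Suc n) \<le> q n" for n
  proof -
    have "\<lfloor>x * 2 ^ Suc n\<rfloor> \<le> 2 * \<lfloor>x * 2 ^ n\<rfloor> + 1" by (simp add: floor_le_iff) linarith
    then have "real_of_int \<lfloor>x * 2 ^ Suc n\<rfloor> \<le> 2 * of_int \<lfloor>x * 2 ^ n\<rfloor> + 1" by linarith
    then have "(of_int \<lfloor>x * 2 ^ Suc n\<rfloor> + 1) / 2 ^ Suc n \<le> (2 * (of_int \<lfloor>x * 2 ^ n\<rfloor> + 1)) / (2 ^ Suc n :: real)"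
      by (intro divide_right_mono) auto
    also have "\<dots> = q n" unfolding q_def power_Suc by (rule mult_divide_mult_cancel_left) simp
    finally show ?thesis unfolding q_def .
  qed
  then have "decseq q" by (simp add: decseq_SucI)
  moreover have "q n \<le> 1" if "x < 1" for n
  proof -
    have "\<lfloor>x * 2 ^ n\<rfloor> + 1 \<le> 2 ^ n" using that by (simp add: floor_less_iff flip: zless_imp_add1_zle zle_add1_eq_le)
    then have "real_of_int (\<lfloor>x * 2 ^ n\<rfloor> + 1) \<le> real_of_int (2 ^ n)" by (rule of_int_le_iff[THEN iffD2])
    then show ?thesis unfolding q_def by simp
  qed
  moreover have "q \<longlonglongrightarrow> x"
  proof (rule tendsto_sandwich[of "\<lambda>_. x" q _ "\<lambda>n. x + (1/2) ^ n"])
    show "(\<lambda>n. x + (1/2) ^ n) \<longlonglongrightarrow> x"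
      using tendsto_add[OF tendsto_const LIMSEQ_power_zero[of "1/2::real"], of x] by simp
  qed (use gt le in \<open>auto simp: less_imp_le power_divide\<close>)
  moreover have "q n \<in> \<rat>" for n
    by (simp add: q_def)
  moreover have "0 \<le> q n" if "0 \<le> x" for n
    using gt[of n] that by simp
  ultimately show ?thesis using gt by (intro exI[of _ q]) auto
qed

text \<open>An open half-line is an increasing union of half-lines with rational ends. Identities of
  kernels known only almost everywhere can thus be tested on countably many sets.\<close>

lemma measure_eqI_rational:
  fixes M N :: "real measure"
  assumes sets: "sets M = sets borel" "sets N = sets borel" and "finite_measure M"
    and eq: "\<And>q. q \<in> \<rat> \<Longrightarrow> emeasure M {q<..} = emeasure N {q<..}"
  shows "M = N"
proof (rule measure_eqI_lessThan[OF sets])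
  interpret finite_measure M by fact
  show "emeasure M {x<..} < \<infinity>" for x
    unfolding infinity_ennreal_def less_top[symmetric] using emeasure_finite by simp
  show "emeasure M {x<..} = emeasure N {x<..}" for x
  proof -
    obtain q where q: "decseq q" "range q \<subseteq> \<rat>" "\<And>n::nat. x < q n" "q \<longlonglongrightarrow> x"
      using rational_decseq_above[of x] by auto
    have "x < y \<longleftrightarrow> (\<exists>n. q n < y)" for y
    proof
      assume "x < y"
      then show "\<exists>n. q n < y"
        using order_tendstoD(2)[OF q(4), of y] by (auto simp: eventually_sequentially)
    next
      assume "\<exists>n. q n < y"
      then show "x < y" using q(3) less_trans by blast
    qed
    then have U: "{x<..} = (\<Union>n. {q n<..})" by auto
    have inc: "incseq (\<lambda>n. {q n<..})"
    proof (rule incseq_SucI)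
      show "{q n<..} \<subseteq> {q (Suc n)<..}" for n using decseqD[OF q(1), of n "Suc n"] by auto
    qed
    have "emeasure L {x<..} = (SUP n. emeasure L {q n<..})" if "sets L = sets borel" for L
    proof -
      have "range (\<lambda>n. {q n<..}) \<subseteq> sets L"
        unfolding that by (intro image_subsetI) simp
      from SUP_emeasure_incseq[OF this inc] show ?thesis unfolding U by simp
    qed
    moreover have "emeasure M {q n<..} = emeasure N {q n<..}" for n
      using q(2) by (intro eq) auto
    ultimately show ?thesis using sets by simp
  qed
qed

text \<open>
  The conditional measure of \<open>{q<..}\<close> is a Radon-Nikodym derivative \<open>h q\<close>, for rational \<open>q\<close>. The
  kernel is the image of the uniform measure under the quantile function built from the \<open>h q\<close>,
  which makes sense on the exceptional null set as well.
\<close>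

lemma disintegration_exists:
  fixes B :: "'m measure" and \<kappa> :: "('m \<times> real) measure"
  assumes "prob_space \<kappa>" and sets: "sets \<kappa> = sets (B \<Otimes>\<^sub>M borel)"
    and unit: "AE p in \<kappa>. snd p \<in> {0..1}"
  shows "\<exists>K. disintegration B borel \<kappa> K"
proof -
  interpret prob_space \<kappa> by fact
  define M where "M = distr \<kappa> B fst"
  have fst_m [measurable]: "fst \<in> \<kappa> \<rightarrow>\<^sub>M B" and snd_m [measurable]: "snd \<in> \<kappa> \<rightarrow>\<^sub>M borel"
    using measurable_cong_sets[OF sets refl] measurable_fst measurable_snd by blast+
  have sM [measurable_cong, simp]: "sets M = sets B" and sM' [simp]: "space M = space B" by (simp_all add: M_def)
  interpret M: prob_space M unfolding M_def by (intro prob_space_distr) measurable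
  have sp: "space \<kappa> = space B \<times> UNIV"
    using sets_eq_imp_space_eq[OF sets] by (simp add: space_pair_measure)
  have rs [simp, measurable]: "C \<times> D \<in> sets \<kappa>" if "C \<in> sets B" "D \<in> sets borel" for C D
    using that by (simp add: sets)
  define Q where "Q = (\<rat> \<inter> {0..1} :: real set)"
  have Q: "countable Q" "Q \<noteq> {}" "Q \<subseteq> {0..1}"
    using countable_rat by (auto simp: Q_def intro!: exI[of _ 0])
  have "\<exists>h \<in> borel_measurable M. \<forall>C\<in>sets B. emeasure \<kappa> (C \<times> {q<..}) = (\<integral>\<^sup>+ m. h m * indicator C m \<partial>M)" for q :: real
  proof -
    define N where "N = distr (density \<kappa> (indicator (space B \<times> {q<..}))) B fst"
    have NC: "emeasure N C = emeasure \<kappa> (C \<times> {q<..})" if [measurable]: "C \<in> sets B" for C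
    proof -
      have "emeasure N C = emeasure (density \<kappa> (indicator (space B \<times> {q<..}))) (fst -` C \<inter> space \<kappa>)"
        unfolding N_def by (subst emeasure_distr) auto
      also have "\<dots> = emeasure \<kappa> ((space B \<times> {q<..}) \<inter> (fst -` C \<inter> space \<kappa>))"
      proof -
        have "fst -` C \<inter> space \<kappa> \<in> sets \<kappa>" by measurable
        then show ?thesis by (subst emeasure_density) (auto simp: indicator_inter_arith[symmetric] simp flip: nn_integral_indicator)
      qed
      also have "(space B \<times> {q<..}) \<inter> (fst -` C \<inter> space \<kappa>) = C \<times> {q<..}"
        using sets.sets_into_space[OF that] by (auto simp: sp)
      finally show ?thesis .
    qed
    have sN: "sets N = sets M" by (simp add: N_def)
    have "absolutely_continuous M N"
      unfolding absolutely_continuous_def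
    proof
      fix C assume C: "C \<in> null_sets M"
      then have [measurable]: "C \<in> sets B" by auto
      have "emeasure \<kappa> (C \<times> {q<..}) \<le> emeasure \<kappa> (fst -` C \<inter> space \<kappa>)"
        using sets.sets_into_space[of C B] by (intro emeasure_mono) (auto simp: sp)
      also have "\<dots> = emeasure M C" unfolding M_def by (subst emeasure_distr) auto
      also have "\<dots> = 0" using C by auto
      finally show "C \<in> null_sets N" using sN by (intro null_setsI) (auto simp: NC)
    qed
    from M.Radon_Nikodym[OF this sN] obtain h where h: "h \<in> borel_measurable M" "density M h = N" by auto
    have "emeasure \<kappa> (C \<times> {q<..}) = (\<integral>\<^sup>+ m. h m * indicator C m \<partial>M)" if "C \<in> sets B" for C
      using NC[OF that] h that by (subst emeasure_density[symmetric]) auto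
    then show ?thesis using h by auto
  qed
  then obtain h where h_meas: "\<And>q::real. h q \<in> borel_measurable M"
    and h: "\<And>q C. C \<in> sets B \<Longrightarrow> emeasure \<kappa> (C \<times> {q<..}) = (\<integral>\<^sup>+ m. h q m * indicator C m \<partial>M)"
    by metis
  have h_meas' [measurable]: "h q \<in> borel_measurable B" for q using h_meas[of q] by (simp cong: measurable_cong_sets)
  \<comment> \<open>The inequality of integrals is tested on the set \<open>C\<close> where the
    pointwise inequality fails; finiteness of the integral of \<open>g\<close> permits the
    subtraction there.\<close>
  have mono_AE: "AE m in M. f m \<le> g m"
    if [measurable]: "f \<in> borel_measurable M" "g \<in> borel_measurable M"
      and *: "\<And>C. C \<in> sets B \<Longrightarrow> (\<integral>\<^sup>+ m. f m * indicator C m \<partial>M) \<le> (\<integral>\<^sup>+ m. g m * indicator C m \<partial>M)"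
      and fin: "(\<integral>\<^sup>+ m. g m \<partial>M) < \<top>" for f g :: "'m \<Rightarrow> ennreal"
  proof -
    define C where "C = {m \<in> space M. g m < f m}"
    have C [measurable]: "C \<in> sets M" unfolding C_def by measurable
    have "(\<integral>\<^sup>+ m. (f m - g m) * indicator C m \<partial>M) =
      (\<integral>\<^sup>+ m. f m * indicator C m - g m * indicator C m \<partial>M)"
      by (intro nn_integral_cong) (auto simp: indicator_def)
    also have "\<dots> = (\<integral>\<^sup>+ m. f m * indicator C m \<partial>M) - (\<integral>\<^sup>+ m. g m * indicator C m \<partial>M)"
    proof (rule nn_integral_diff)
      have "(\<integral>\<^sup>+ m. g m * indicator C m \<partial>M) \<le> (\<integral>\<^sup>+ m. g m \<partial>M)"
        by (intro nn_integral_mono) (auto simp: indicator_def)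
      then show "(\<integral>\<^sup>+ m. g m * indicator C m \<partial>M) \<noteq> \<infinity>" using fin by auto
      show "AE m in M. g m * indicator C m \<le> f m * indicator C m"
        by (intro AE_I2) (auto simp: C_def indicator_def)
    qed auto
    also have "\<dots> = 0"
    proof -
      have "(\<integral>\<^sup>+ m. g m * indicator C m \<partial>M) \<le> (\<integral>\<^sup>+ m. g m \<partial>M)"
        by (intro nn_integral_mono) (auto simp: indicator_def)
      then show ?thesis
        using *[of C] C fin by (intro diff_eq_0_ennreal) (auto intro: le_less_trans order_trans)
    qed
    finally have "AE m in M. (f m - g m) * indicator C m = 0"
      by (subst (asm) nn_integral_0_iff_AE) auto
    then show ?thesis
      using AE_space
    proof eventually_elim
      case (elim m)
      then show ?case
        by (auto simp: C_def indicator_def diff_eq_0_iff_ennreal not_less split: if_splits)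
    qed
  qed
  have h_mono: "AE m in M. h q' m \<le> h q m" if "q \<le> q'" for q q'
  proof (rule mono_AE)
    fix C assume "C \<in> sets B"
    then show "(\<integral>\<^sup>+ m. h q' m * indicator C m \<partial>M) \<le> (\<integral>\<^sup>+ m. h q m * indicator C m \<partial>M)"
      unfolding h[OF \<open>C \<in> sets B\<close>, symmetric] using that by (intro emeasure_mono) auto
  next
    have "(\<integral>\<^sup>+ m. h q m \<partial>M) = (\<integral>\<^sup>+ m. h q m * indicator (space B) m \<partial>M)"
      by (intro nn_integral_cong) auto
    also have "\<dots> \<le> 1" by (subst h[symmetric]) (auto simp: emeasure_le_1)
    finally show "(\<integral>\<^sup>+ m. h q m \<partial>M) < \<top>" by (auto simp: less_top[symmetric] top_unique)
  qed (fact h_meas)+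
  have h_le1: "AE m in M. h q m \<le> 1" for q
  proof (rule mono_AE)
    fix C assume [measurable]: "C \<in> sets B"
    have "emeasure \<kappa> (C \<times> {q<..}) \<le> emeasure \<kappa> (fst -` C \<inter> space \<kappa>)"
      using sets.sets_into_space[of C B] by (intro emeasure_mono) (auto simp: sp)
    also have "\<dots> = emeasure M C" unfolding M_def by (subst emeasure_distr) auto
    finally show "(\<integral>\<^sup>+ m. h q m * indicator C m \<partial>M) \<le> (\<integral>\<^sup>+ m. 1 * indicator C m \<partial>M)"
      unfolding h[OF \<open>C \<in> sets B\<close>, symmetric] by simp
  qed (use M.emeasure_space_1 in \<open>auto simp: h_meas\<close>)
  have good: "AE m in M. (\<forall>q\<in>Q. h q m \<le> 1) \<and> (\<forall>q\<in>Q. \<forall>q'\<in>Q. q \<le> q' \<longrightarrow> h q' m \<le> h q m)"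
    using h_mono h_le1 by (auto simp: AE_ball_countable[OF Q(1)] AE_conj_iff)
  \<comment> \<open>The quantile function: \<open>r m u > x\<close> means that
    \<open>u \<le> h q m\<close> for some threshold \<open>q > x\<close>. The default 0 keeps all
    values within the unit interval, so \<open>r m\<close> is a legitimate function even for those
    \<open>m\<close> at which the derivatives are not monotone.\<close>
  define r where "r m u = (SUP q\<in>Q. if ennreal u \<le> h q m then q else 0)" for m and u :: real
  have bdd: "bdd_above ((\<lambda>q. if ennreal u \<le> h q m then q else 0) ` Q)" for m u
    using Q(3) by (intro bdd_aboveI[of _ 1]) auto
  have r_gt: "x < r m u \<longleftrightarrow> (\<exists>q\<in>Q. ennreal u \<le> h q m \<and> x < q)" if "0 \<le> x" for x m u
    unfolding r_def less_cSUP_iff[OF Q(2) bdd] using that by (auto split: if_splits)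
  have r_nonneg: "0 \<le> r m u" for m u
    unfolding r_def using Q by (intro cSUP_upper2[OF bdd]) (auto simp: Q_def)
  have r_meas [measurable]: "(\<lambda>(m, u). r m u) \<in> borel_measurable (B \<Otimes>\<^sub>M borel)"
    unfolding r_def split_beta'
    by (rule borel_measurable_cSUP[OF Q(1)]) (use Q(2) bdd in \<open>auto simp: split_beta'\<close>)
  define U where "U = uniform_measure lborel {0<..<1::real}"
  interpret U: prob_space U unfolding U_def by (intro prob_space_uniform_measure) auto
  have sU [measurable_cong, simp]: "sets U = sets borel" by (simp add: U_def)
  define K where "K m = distr U borel (r m)" for m
  have K: "K \<in> B \<rightarrow>\<^sub>M prob_algebra borel"
    unfolding K_def
  proof (rule measurable_distr_prob_space2)
    show "(\<lambda>m. U) \<in> B \<rightarrow>\<^sub>M prob_algebra borel"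
      using U.prob_space_axioms by (intro measurable_const) (simp add: space_prob_algebra)
  qed measurable
  have r_meas1: "r m \<in> borel_measurable borel" if "m \<in> space B" for m
    using measurable_compose_Pair1[OF that r_meas] by simp
  have K_gt: "emeasure (K m) {x<..} = emeasure U {u. x < r m u}" if "m \<in> space B" for m x
    unfolding K_def using r_meas1[OF that] 
    by (subst emeasure_distr) (auto intro!: arg_cong[of _ _ "emeasure U"] simp: sets_eq_imp_space_eq[OF sU])
  have key: "emeasure \<kappa> (C \<times> {x<..}) = (\<integral>\<^sup>+ m. emeasure (K m) {x<..} * indicator C m \<partial>M)"
    if C [measurable]: "C \<in> sets B" for C x
  proof -
    consider "x < 0" | "1 \<le> x" | "0 \<le> x" "x < 1" by linarith
    then show ?thesis
    proof cases
      case 1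
      have "emeasure \<kappa> (C \<times> {x<..}) = emeasure \<kappa> (fst -` C \<inter> space \<kappa>)"
        using unit sets.sets_into_space[OF C] 1
        by (intro emeasure_eq_AE) (auto elim!: eventually_mono simp: sp)
      also have "\<dots> = emeasure M C" unfolding M_def by (subst emeasure_distr) auto
      also have "\<dots> = (\<integral>\<^sup>+ m. emeasure (K m) {x<..} * indicator C m \<partial>M)"
      proof -
        have "emeasure (K m) {x<..} = 1" if "m \<in> space B" for m
        proof -
          have "{u. x < r m u} = space U"
            using r_nonneg[of m] 1 by (auto simp: sets_eq_imp_space_eq[OF sU] intro: less_le_trans)
          then show ?thesis using K_gt[OF that] U.emeasure_space_1 by simp
        qed
        then have "(\<integral>\<^sup>+ m. emeasure (K m) {x<..} * indicator C m \<partial>M) = (\<integral>\<^sup>+ m. indicator C m \<partial>M)"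
          by (intro nn_integral_cong) auto
        then show ?thesis by simp
      qed
      finally show ?thesis .
    next
      case 2
      have "emeasure \<kappa> (C \<times> {x<..}) = emeasure \<kappa> {}"
      proof (rule emeasure_eq_AE)
        show "AE p in \<kappa>. p \<in> C \<times> {x<..} \<longleftrightarrow> p \<in> {}"
          using unit by eventually_elim (use 2 in auto)
      qed auto
      moreover have "emeasure (K m) {x<..} = 0" if "m \<in> space B" for m
      proof -
        have "{u. x < r m u} = {}" using r_gt[of x m] 2 Q(3) by auto
        then show ?thesis using K_gt[OF that] by simp
      qed
      then have "(\<integral>\<^sup>+ m. emeasure (K m) {x<..} * indicator C m \<partial>M) = (\<integral>\<^sup>+ m. 0 \<partial>M)"
        by (intro nn_integral_cong) auto
      ultimately show ?thesis by simp
    next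
      case 3
      \<comment> \<open>The thresholds have to approach \<open>x\<close> strictly from above, so
        that the half-lines \<open>{q n<..}\<close> increase to \<open>{x<..}\<close>. The
        derivatives \<open>h (q n)\<close> then increase almost everywhere and monotone convergence
        applies; the same limit computes the kernel.\<close>
      obtain q where q: "decseq q" "range q \<subseteq> Q" "\<And>n. x < q n" "q \<longlonglongrightarrow> x"
        using rational_decseq_above[of x] 3 unfolding Q_def by auto
      have "C \<times> {x<..} = (\<Union>n. C \<times> {q n<..})"
      proof -
        have "\<exists>n. q n < y" if "x < y" for y
          using order_tendstoD(2)[OF q(4) that] by (auto simp: eventually_sequentially)
        then show ?thesis using q(3) by (force intro: less_trans)
      qed
      then have "emeasure \<kappa> (C \<times> {x<..}) = (SUP n. emeasure \<kappa> (C \<times> {q n<..}))"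
        using q(1) by (subst SUP_emeasure_incseq) (auto simp: incseq_def decseq_def intro: le_less_trans)
      also have "\<dots> = (SUP n. \<integral>\<^sup>+ m. h (q n) m * indicator C m \<partial>M)"
        using h[OF C] by simp
      also have "\<dots> = (\<integral>\<^sup>+ m. (SUP n. h (q n) m * indicator C m) \<partial>M)"
      proof (rule nn_integral_monotone_convergence_SUP_AE[symmetric])
        show "AE m in M. h (q n) m * indicator C m \<le> h (q (Suc n)) m * indicator C m" for n
          using h_mono[of "q (Suc n)" "q n"] decseqD[OF q(1), of n "Suc n"]
          by (auto elim!: eventually_mono simp: indicator_def)
      qed measurable
      also have "\<dots> = (\<integral>\<^sup>+ m. emeasure (K m) {x<..} * indicator C m \<partial>M)"
      proof (rule nn_integral_cong_AE, use good AE_space in eventually_elim)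
        case (elim m)
        have "{u. x < r m u} = (\<Union>n. {u. ennreal u \<le> h (q n) m})"
        proof (intro equalityI subsetI)
          fix u assume "u \<in> {u. x < r m u}"
          then obtain q' where q': "q' \<in> Q" "ennreal u \<le> h q' m" "x < q'"
            using r_gt 3 by auto
          obtain n where "q n < q'"
            using order_tendstoD(2)[OF q(4) q'(3)] by (auto simp: eventually_sequentially)
          moreover have "q n \<in> Q" using q(2) by auto
          ultimately have "h q' m \<le> h (q n) m" using elim q'(1) less_imp_le by blast
          then show "u \<in> (\<Union>n. {u. ennreal u \<le> h (q n) m})" using q' by (auto intro: order_trans)
        qed (use q r_gt 3 in auto)
        then have "emeasure (K m) {x<..} = emeasure U (\<Union>n. {u. ennreal u \<le> h (q n) m})"
          using K_gt elim by simp
        also have "\<dots> = (SUP n. emeasure U {u. ennreal u \<le> h (q n) m})"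
        proof (rule SUP_emeasure_incseq[symmetric])
          show "range (\<lambda>n. {u. ennreal u \<le> h (q n) m}) \<subseteq> sets U" by auto
          show "incseq (\<lambda>n. {u. ennreal u \<le> h (q n) m})"
          proof (rule incseq_SucI)
            fix n
            have "h (q n) m \<le> h (q (Suc n)) m"
            proof -
              have "q n \<in> Q" "q (Suc n) \<in> Q" using q(2) by auto
              then show ?thesis using elim decseqD[OF q(1), of n "Suc n"] by simp
            qed
            then show "{u. ennreal u \<le> h (q n) m} \<subseteq> {u. ennreal u \<le> h (q (Suc n)) m}"
              by (auto intro: order_trans)
          qed
        qed
        also have "\<dots> = (SUP n. h (q n) m)"
          using elim q(2) unfolding U_def by (intro SUP_cong refl emeasure_uniform_atMost) auto
        finally show ?case by (auto simp: indicator_def)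
      qed
      finally show ?thesis .
    qed
  qed
  have "disintegration B borel \<kappa> K"
  proof (rule disintegrationI_rectangles[OF \<open>prob_space \<kappa>\<close> sets K])
    fix C and D :: "real set" assume C [measurable]: "C \<in> sets B" and D: "D \<in> sets borel"
    \<comment> \<open>For fixed \<open>C\<close> both sides of the rectangle formula are measures in
      \<open>D\<close>. They agree on half-lines by \<open>key\<close>, hence on all Borel
      sets.\<close>
    define \<alpha> where "\<alpha> = distr (density \<kappa> (indicator (C \<times> UNIV))) borel snd"
    define \<beta> where "\<beta> = density M (indicator C) \<bind> K"
    have \<alpha>: "emeasure \<alpha> D = emeasure \<kappa> (C \<times> D)" if [measurable]: "D \<in> sets borel" for D
    proof -
      have "emeasure \<alpha> D = emeasure (density \<kappa> (indicator (C \<times> UNIV))) (snd -` D \<inter> space \<kappa>)"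
        unfolding \<alpha>_def by (subst emeasure_distr) auto
      also have "\<dots> = emeasure \<kappa> ((C \<times> UNIV) \<inter> (snd -` D \<inter> space \<kappa>))"
      proof -
        have "snd -` D \<inter> space \<kappa> \<in> sets \<kappa>" by measurable
        then show ?thesis by (subst emeasure_density) (auto simp: indicator_inter_arith[symmetric] simp flip: nn_integral_indicator)
      qed
      also have "(C \<times> UNIV) \<inter> (snd -` D \<inter> space \<kappa>) = C \<times> D"
        using sets.sets_into_space[OF C] by (auto simp: sp)
      finally show ?thesis .
    qed
    have \<beta>: "emeasure \<beta> D = (\<integral>\<^sup>+ m. emeasure (K m) D * indicator C m \<partial>M)" if "D \<in> sets borel" for D
    proof -
      have "emeasure \<beta> D = (\<integral>\<^sup>+ m. emeasure (K m) D \<partial>density M (indicator C))"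
        unfolding \<beta>_def using K M.not_empty that
        by (subst emeasure_bind[where N=borel]) (auto simp: measurable_prob_algebraD cong: measurable_cong_sets)
      also have "\<dots> = (\<integral>\<^sup>+ m. indicator C m * emeasure (K m) D \<partial>M)"
        using measurable_kernel_emeasure[OF K that] by (subst nn_integral_density) (auto cong: measurable_cong_sets)
      finally show ?thesis by (simp add: mult.commute)
    qed
    have "\<alpha> = \<beta>"
    proof (rule measure_eqI_lessThan)
      show "sets \<alpha> = sets borel" by (simp add: \<alpha>_def)
      show "sets \<beta> = sets borel"
        using sets_bind[of "density M (indicator C)" K borel] kernel_sets[OF K] M.not_empty by (auto simp: \<beta>_def)
      show "emeasure \<alpha> {x<..} = emeasure \<beta> {x<..}" for x
        using key[OF C, of x] by (simp add: \<alpha> \<beta>)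
      show "emeasure \<alpha> {x<..} < \<infinity>" for x
        by (simp add: \<alpha> less_top[symmetric])
    qed
    then show "emeasure \<kappa> (C \<times> D) = (\<integral>\<^sup>+ m. emeasure (K m) D * indicator C m \<partial>distr \<kappa> B fst)"
      using \<alpha>[OF D] \<beta>[OF D] by (simp add: M_def)
  qed
  then show ?thesis by auto
qed

subsection \<open>Invertible maps\<close>

lemma disintegration_fst_measurable:
  "sets \<kappa> = sets (B \<Otimes>\<^sub>M N) \<Longrightarrow> fst \<in> \<kappa> \<rightarrow>\<^sub>M B"
  using measurable_cong_sets[of \<kappa> "B \<Otimes>\<^sub>M N" B B] measurable_fst by blast

text \<open>The measure of the exceptional set is the integral of the measures of its sections, and
  a nonnegative integral vanishes exactly if the integrand vanishes almost everywhere. Measurability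
  of \<open>P\<close> is what makes the passage from sections back to \<open>\<kappa>\<close>
  legitimate.\<close>

lemma disintegration_AE_iff:
  assumes d: "disintegration B N \<kappa> K" and sets: "sets \<kappa> = sets (B \<Otimes>\<^sub>M N)"
    and P: "{p \<in> space (B \<Otimes>\<^sub>M N). P p} \<in> sets (B \<Otimes>\<^sub>M N)"
  shows "(AE p in \<kappa>. P p) \<longleftrightarrow> (AE m in distr \<kappa> B fst. AE x in K m. P (m, x))"
proof -
  have K: "K \<in> B \<rightarrow>\<^sub>M prob_algebra N" using d by (simp add: disintegration_def)
  note sp = sets_eq_imp_space_eq[OF sets]
  define E where "E = {p \<in> space (B \<Otimes>\<^sub>M N). \<not> P p}"
  have E: "E \<in> sets (B \<Otimes>\<^sub>M N)"
  proof -
    have "E = space (B \<Otimes>\<^sub>M N) - {p \<in> space (B \<Otimes>\<^sub>M N). P p}" by (auto simp: E_def)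
    then show ?thesis using P by simp
  qed
  have "(AE p in \<kappa>. P p) \<longleftrightarrow> emeasure \<kappa> E = 0"
    using E sets sp by (subst AE_iff_measurable[of E]) (auto simp: E_def)
  also have "\<dots> \<longleftrightarrow> (\<integral>\<^sup>+ m. emeasure (K m) (Pair m -` E) \<partial>distr \<kappa> B fst) = 0"
    using d E by (simp add: disintegration_def)
  also have "\<dots> \<longleftrightarrow> (AE m in distr \<kappa> B fst. emeasure (K m) (Pair m -` E) = 0)"
    using measurable_kernel_section[OF K E] by (subst nn_integral_0_iff_AE) auto
  also have "\<dots> \<longleftrightarrow> (AE m in distr \<kappa> B fst. AE x in K m. P (m, x))"
  proof (intro AE_cong)
    fix m assume "m \<in> space (distr \<kappa> B fst)"
    then have m: "m \<in> space B" by simp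
    have "{x \<in> space (K m). \<not> P (m, x)} = Pair m -` E"
      using m kernel_space[OF K m] by (auto simp: E_def space_pair_measure)
    moreover have "Pair m -` E \<in> sets (K m)"
      using sets_Pair1[OF E] kernel_sets[OF K m] by simp
    ultimately show "emeasure (K m) (Pair m -` E) = 0 \<longleftrightarrow> (AE x in K m. P (m, x))"
      by (subst AE_iff_measurable[of "Pair m -` E"]) auto
  qed
  finally show ?thesis .
qed

text \<open>The passage to sections works for arbitrary \<open>P\<close>, since the exceptional set
  can be enclosed in a measurable null set.\<close>

lemma disintegration_AE:
  assumes d: "disintegration B N \<kappa> K" and sets: "sets \<kappa> = sets (B \<Otimes>\<^sub>M N)"
    and P: "AE p in \<kappa>. P p"
  shows "AE m in distr \<kappa> B fst. AE x in K m. P (m, x)"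
proof -
  obtain E where E: "{p \<in> space \<kappa>. \<not> P p} \<subseteq> E" "E \<in> sets \<kappa>" "emeasure \<kappa> E = 0"
    using P by (auto elim: AE_E)
  note sp = sets_eq_imp_space_eq[OF sets]
  have K: "K \<in> B \<rightarrow>\<^sub>M prob_algebra N" using d by (simp add: disintegration_def)
  have "{p \<in> space (B \<Otimes>\<^sub>M N). p \<notin> E} = space (B \<Otimes>\<^sub>M N) - E" by auto
  then have "{p \<in> space (B \<Otimes>\<^sub>M N). p \<notin> E} \<in> sets (B \<Otimes>\<^sub>M N)" using E(2) sets by auto
  moreover have "AE p in \<kappa>. p \<notin> E" using E(2,3) by (intro AE_not_in) auto
  ultimately have "AE m in distr \<kappa> B fst. AE x in K m. (m, x) \<notin> E"
    using disintegration_AE_iff[OF d sets, of "\<lambda>p. p \<notin> E"] by simp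
  then show ?thesis
    using AE_space
  proof eventually_elim
    case (elim m)
    then have m: "m \<in> space B" by simp
    from elim(1) AE_space show ?case
    proof eventually_elim
      case (elim x)
      then show ?case using E(1) m kernel_space[OF K m] by (auto simp: sp space_pair_measure)
    qed
  qed
qed

text \<open>
  Disintegrating the graph of \<open>T\<close> over its values gives point masses, because \<open>T\<close> is injective on
  a conull set; the inverse of \<open>T\<close> reads off their barycentres.
\<close>

lemma invertible_mp_inj_on:
  fixes \<mu> :: "real measure" and Y :: "'y measure"
  assumes "prob_space \<mu>" and sets [measurable_cong]: "sets \<mu> = sets borel" and unit: "AE x in \<mu>. x \<in> {0..1}"
    and T [measurable]: "T \<in> borel \<rightarrow>\<^sub>M Y"
    and diag: "{p \<in> space (Y \<Otimes>\<^sub>M Y). fst p = snd p} \<in> sets (Y \<Otimes>\<^sub>M Y)"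
    and X0 [measurable]: "X0 \<in> sets borel" "AE x in \<mu>. x \<in> X0" and inj: "inj_on T X0"
  shows "invertible_mp \<mu> (distr \<mu> Y T) T"
proof -
  interpret prob_space \<mu> by fact
  \<comment> \<open>\<open>Y\<close> is an abstract space, so the set where two maps into it agree
    is measurable only as a preimage of the diagonal.\<close>
  have Y_eq: "{x \<in> space M. g x = h x} \<in> sets M"
    if "g \<in> M \<rightarrow>\<^sub>M Y" "h \<in> M \<rightarrow>\<^sub>M Y" for M :: "'z measure" and g h
  proof -
    have "(\<lambda>x. (g x, h x)) \<in> M \<rightarrow>\<^sub>M Y \<Otimes>\<^sub>M Y" using that by measurable
    from measurable_sets[OF this diag]
    have "(\<lambda>x. (g x, h x)) -` {p \<in> space (Y \<Otimes>\<^sub>M Y). fst p = snd p} \<inter> space M \<in> sets M" .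
    also have "(\<lambda>x. (g x, h x)) -` {p \<in> space (Y \<Otimes>\<^sub>M Y). fst p = snd p} \<inter> space M = {x \<in> space M. g x = h x}"
      using that by (auto simp: space_pair_measure dest: measurable_space)
    finally show ?thesis .
  qed
  have Y_eq' [measurable]: "Measurable.pred M (\<lambda>x. g x = h x)"
    if "g \<in> M \<rightarrow>\<^sub>M Y" "h \<in> M \<rightarrow>\<^sub>M Y" for M :: "'z measure" and g h
    using Y_eq[OF that] by (simp add: pred_def)
  define J where "J = distr \<mu> (Y \<Otimes>\<^sub>M borel) (\<lambda>x. (T x, x))"
  have J: "prob_space J" unfolding J_def by (rule prob_space_distr) measurable
  have sJ: "sets J = sets (Y \<Otimes>\<^sub>M borel)" by (simp add: J_def)
  have fstJ: "distr J Y fst = distr \<mu> Y T"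
    unfolding J_def by (subst distr_distr) (auto simp: comp_def cong: distr_cong)
  have "AE p in J. snd p \<in> {0..1}"
    unfolding J_def using unit by (subst AE_distr_iff) auto
  then obtain K where d: "disintegration Y borel J K"
    using disintegration_exists[OF J sJ] by auto
  have K: "K \<in> Y \<rightarrow>\<^sub>M prob_algebra borel" using d by (simp add: disintegration_def)
  have "AE p in J. fst p = T (snd p) \<and> snd p \<in> X0 \<and> snd p \<in> {0..1}"
  proof (unfold J_def, subst AE_distr_iff)
    show "{p \<in> space (Y \<Otimes>\<^sub>M borel). fst p = T (snd p) \<and> snd p \<in> X0 \<and> snd p \<in> {0..1}} \<in> sets (Y \<Otimes>\<^sub>M borel)"
      using Y_eq'[of fst "Y \<Otimes>\<^sub>M borel" "\<lambda>p. T (snd p)"] by measurable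
  qed (use unit X0(2) in \<open>auto simp: AE_conj_iff\<close>)
  from disintegration_AE[OF d sJ this]
  have AE1: "AE y in distr \<mu> Y T. AE x in K y. y = T x \<and> x \<in> X0 \<and> x \<in> {0..1}"
    unfolding fstJ fst_conv snd_conv .
  \<comment> \<open>The barycentre. Almost all kernels are concentrated on the unit interval, so the
    truncation of negative numbers by \<open>ennreal\<close> does no harm, and a point mass at
    \<open>x0\<close> returns \<open>x0\<close>.\<close>
  define R where "R y = enn2real (\<integral>\<^sup>+ x. ennreal x \<partial>K y)" for y
  have R [measurable]: "R \<in> Y \<rightarrow>\<^sub>M borel"
    unfolding R_def by (intro borel_measurable_enn2real measurable_kernel_nn_integral[OF K]) measurable
  have AE2: "AE y in distr \<mu> Y T. AE x in K y. R y = x"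
    using AE1 AE_space
  proof eventually_elim
    case (elim y)
    then have y: "y \<in> space Y" by simp
    interpret Ky: prob_space "K y" using kernel_prob_space[OF K y] .
    obtain x0 where x0: "y = T x0" "x0 \<in> X0" "x0 \<in> {0..1}"
      using eventually_happens'[OF Ky.ae_filter_bot elim(1)] by blast
    have eq: "AE x in K y. x = x0"
      using elim(1) by (rule eventually_mono) (use inj x0 in \<open>auto dest: inj_onD\<close>)
    then have "(\<integral>\<^sup>+ x. ennreal x \<partial>K y) = (\<integral>\<^sup>+ x. ennreal x0 \<partial>K y)"
      by (intro nn_integral_cong_AE) (auto elim: eventually_mono)
    then have "R y = x0" using x0 Ky.emeasure_space_1 by (simp add: R_def)
    then show ?case using eq by (auto elim: eventually_mono)
  qed
  have "AE p in J. R (fst p) = snd p"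
    using disintegration_AE_iff[OF d sJ, of "\<lambda>p. R (fst p) = snd p"] AE2 unfolding fstJ by simp
  then have RT: "AE x in \<mu>. R (T x) = x"
    unfolding J_def by (subst (asm) AE_distr_iff) auto
  have TR: "AE y in distr \<mu> Y T. T (R y) = y"
  proof (subst AE_distr_iff)
    show "{x \<in> space Y. T (R x) = x} \<in> sets Y" by (rule Y_eq) measurable
    show "AE x in \<mu>. T (R (T x)) = T x" using RT by (auto elim!: eventually_mono)
  qed simp
  have "distr (distr \<mu> Y T) \<mu> R = distr \<mu> \<mu> (\<lambda>x. x)"
  proof (subst distr_distr)
    show "distr \<mu> \<mu> (R \<circ> T) = distr \<mu> \<mu> (\<lambda>x. x)"
      using RT by (intro distr_cong_AE) (auto simp: comp_def)
  qed auto
  then have "distr (distr \<mu> Y T) \<mu> R = \<mu>" by simp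
  then show ?thesis
    unfolding invertible_mp_def using RT TR by (intro conjI exI[of _ R] distr_cong) auto
qed

lemma invertible_mp_sym:
  assumes "invertible_mp M N T"
  obtains R where "invertible_mp N M R" "AE x in M. R (T x) = x" "AE y in N. T (R y) = y"
  using assms unfolding invertible_mp_def by blast

lemma invertible_mp_measurable: "invertible_mp M N T \<Longrightarrow> T \<in> M \<rightarrow>\<^sub>M N"
  by (simp add: invertible_mp_def)

lemma invertible_mp_distr: "invertible_mp M N T \<Longrightarrow> distr M N T = N"
  by (simp add: invertible_mp_def)

lemma invertible_mp_AE:
  assumes "invertible_mp M N T" "AE y in N. P y"
  shows "AE x in M. P (T x)"
proof (rule AE_distrD[OF invertible_mp_measurable[OF assms(1)]])
  show "AE y in distr M N T. P y"
    unfolding invertible_mp_distr[OF assms(1)] by (rule assms(2))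
qed

lemma invertible_mp_trans:
  assumes S: "invertible_mp M N S" and T: "invertible_mp N L T"
  shows "invertible_mp M L (\<lambda>x. T (S x))"
proof -
  obtain S' where S': "invertible_mp N M S'" "AE x in M. S' (S x) = x" "AE y in N. S (S' y) = y"
    using S by (rule invertible_mp_sym)
  obtain T' where T': "invertible_mp L N T'" "AE x in N. T' (T x) = x" "AE y in L. T (T' y) = y"
    using T by (rule invertible_mp_sym)
  have distr_comp: "distr M L (\<lambda>x. g (f x)) = L" if "invertible_mp M N f" "invertible_mp N L g"
    for M :: "'p measure" and N :: "'q measure" and L :: "'r measure" and f g
  proof -
    have "distr M L (\<lambda>x. g (f x)) = distr (distr M N f) L g"
      using that by (subst distr_distr) (auto simp: invertible_mp_def comp_def)
    then show ?thesis using that by (simp add: invertible_mp_def)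
  qed
  show ?thesis
    unfolding invertible_mp_def
  proof (intro conjI exI[of _ "\<lambda>x. S' (T' x)"])
    show "(\<lambda>x. T (S x)) \<in> M \<rightarrow>\<^sub>M L" "(\<lambda>x. S' (T' x)) \<in> L \<rightarrow>\<^sub>M M"
      using invertible_mp_measurable[OF S] invertible_mp_measurable[OF T]
        invertible_mp_measurable[OF S'(1)] invertible_mp_measurable[OF T'(1)] by measurable
    show "distr M L (\<lambda>x. T (S x)) = L" "distr L M (\<lambda>x. S' (T' x)) = M"
      using distr_comp S T S'(1) T'(1) by blast+
    show "AE x in M. S' (T' (T (S x))) = x"
      using S'(2) invertible_mp_AE[OF S T'(2)] by eventually_elim simp
    show "AE y in L. T (S (S' (T' y))) = y"
      using T'(3) invertible_mp_AE[OF T'(1) S'(3)] by eventually_elim simp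
  qed
qed

subsection \<open>Fibre coordinates\<close>

definition atom_mass :: "real measure \<Rightarrow> real \<Rightarrow> ennreal" where
  "atom_mass q x = emeasure q {x}"

definition atomless_part :: "real measure \<Rightarrow> real set" where
  "atomless_part q = {x. atom_mass q x = 0}"

text \<open>Initial segments of a linear order on the atoms: heavier atoms come first, and ties are
  broken by position on the line. The segment contains \<open>x\<close> itself, so ranks start at 1,
  the first index of the atoms in \<open>fibre_set\<close>.\<close>

definition atoms_upto :: "real measure \<Rightarrow> real \<Rightarrow> real set" where
  "atoms_upto q x = {y. atom_mass q x < atom_mass q y \<or> atom_mass q y = atom_mass q x \<and> y \<le> x}"

text \<open>
  On atoms, integrating the inverse mass counts the elements of \<^const>\<open>atoms_upto\<close>; written in this
  way the rank is visibly measurable in \<open>q\<close>.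
\<close>

definition atom_rank :: "real measure \<Rightarrow> real \<Rightarrow> real" where
  "atom_rank q x = enn2real (\<integral>\<^sup>+ y. inverse (atom_mass q y) * indicator (atoms_upto q x) y \<partial>q)"

text \<open>Normalisation spreads the continuous part over the whole unit interval, whatever its
  mass. If that mass is 0, division yields 0, which still lies in the fibre, and the points
  concerned form a null set.\<close>

definition fibre_coordinate :: "real measure \<Rightarrow> real \<Rightarrow> real" where
  "fibre_coordinate q x =
     (if atom_mass q x = 0 then measure q (atomless_part q \<inter> {..x}) / measure q (atomless_part q)
      else 1 + 1 / atom_rank q x)"

text \<open>The graph of \<open>g\<close> is a measurable set whose section over \<open>p\<close> is
  the singleton at \<open>g p\<close>, so measurability of kernel sections applies.\<close>

lemma measurable_atom_mass [measurable (raw)]: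
  assumes "f \<in> M \<rightarrow>\<^sub>M prob_algebra borel" "g \<in> borel_measurable M"
  shows "(\<lambda>p. atom_mass (f p) (g p)) \<in> borel_measurable M"
proof -
  have "{p \<in> space (M \<Otimes>\<^sub>M borel). snd p = g (fst p)} \<in> sets (M \<Otimes>\<^sub>M borel)"
    using assms(2) by measurable
  from measurable_kernel_section[OF assms(1) this]
  have "(\<lambda>p. emeasure (f p) (Pair p -` {p \<in> space (M \<Otimes>\<^sub>M borel). snd p = g (fst p)})) \<in> borel_measurable M" .
  moreover have "Pair p -` {p \<in> space (M \<Otimes>\<^sub>M borel). snd p = g (fst p)} = {g p}" if "p \<in> space M" for p
    using that by (auto simp: space_pair_measure)
  ultimately show ?thesis
    unfolding atom_mass_def by (simp cong: measurable_cong)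
qed

lemma measurable_measure_kernel_Collect:
  assumes K: "f \<in> M \<rightarrow>\<^sub>M prob_algebra borel" and P: "Measurable.pred (M \<Otimes>\<^sub>M borel) (\<lambda>(p, y). P p (y::real))"
  shows "(\<lambda>p. measure (f p) {y. P p y}) \<in> borel_measurable M"
proof -
  have "{p \<in> space (M \<Otimes>\<^sub>M borel). case p of (p, y) \<Rightarrow> P p y} \<in> sets (M \<Otimes>\<^sub>M borel)"
    using P by (simp add: pred_def)
  from measurable_kernel_section[OF K this]
  have "(\<lambda>p. emeasure (f p) (Pair p -` {p \<in> space (M \<Otimes>\<^sub>M borel). case p of (p, y) \<Rightarrow> P p y})) \<in> borel_measurable M" .
  moreover have "Pair p -` {p \<in> space (M \<Otimes>\<^sub>M borel). case p of (p, y) \<Rightarrow> P p y} = {y. P p y}" if "p \<in> space M" for p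
    using that by (auto simp: space_pair_measure)
  ultimately show ?thesis
    unfolding measure_def by (simp cong: measurable_cong)
qed

lemma measurable_atom_rank [measurable (raw)]:
  assumes f [measurable]: "f \<in> M \<rightarrow>\<^sub>M prob_algebra borel" and g [measurable]: "g \<in> borel_measurable M"
  shows "(\<lambda>p. atom_rank (f p) (g p)) \<in> borel_measurable M"
  unfolding atom_rank_def atoms_upto_def
proof (intro borel_measurable_enn2real measurable_kernel_nn_integral[OF f])
  have eq: "(\<lambda>(p, y). inverse (atom_mass (f p) y) * indicator {y. atom_mass (f p) (g p) < atom_mass (f p) y \<or>
        atom_mass (f p) y = atom_mass (f p) (g p) \<and> y \<le> g p} y) =
      (\<lambda>(p, y). if atom_mass (f p) (g p) < atom_mass (f p) y \<or>
        atom_mass (f p) y = atom_mass (f p) (g p) \<and> y \<le> g p then inverse (atom_mass (f p) y) else (0::ennreal))"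
    by (auto simp: fun_eq_iff indicator_def)
  show "(\<lambda>(p, y). inverse (atom_mass (f p) y) * indicator {y. atom_mass (f p) (g p) < atom_mass (f p) y \<or>
        atom_mass (f p) y = atom_mass (f p) (g p) \<and> y \<le> g p} y :: ennreal) \<in> borel_measurable (M \<Otimes>\<^sub>M borel)"
    unfolding eq split_beta' by measurable
qed

lemma measurable_fibre_coordinate_borel [measurable (raw)]:
  assumes f [measurable]: "f \<in> M \<rightarrow>\<^sub>M prob_algebra borel" and g [measurable]: "g \<in> borel_measurable M"
  shows "(\<lambda>p. fibre_coordinate (f p) (g p)) \<in> borel_measurable M"
proof -
  have eq: "atomless_part q \<inter> {..x} = {y. atom_mass q y = 0 \<and> y \<le> x}" for q x
    by (auto simp: atomless_part_def)
  have [measurable]: "(\<lambda>p. measure (f p) (atomless_part (f p) \<inter> {..g p})) \<in> borel_measurable M"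
    unfolding eq by (rule measurable_measure_kernel_Collect[OF f]) (simp add: split_beta')
  have [measurable]: "(\<lambda>p. measure (f p) (atomless_part (f p))) \<in> borel_measurable M"
    unfolding atomless_part_def by (rule measurable_measure_kernel_Collect[OF f]) (simp add: split_beta')
  show ?thesis unfolding fibre_coordinate_def by measurable
qed

text \<open>The probability integral transform. Without atoms the distribution function is
  continuous, so it attains every value strictly between 0 and 1, and its sublevel set at
  \<open>h\<close> has measure \<open>h\<close>.\<close>

lemma (in real_distribution) cdf_transform_uniform:
  assumes atomless: "\<And>x. measure M {x} = 0"
  shows "distr M borel (cdf M) = uniform_measure lborel {0..1}"
proof (rule cdf_unique)
  have cont: "isCont (cdf M) x" for x
    using atomless isCont_cdf by simp
  have meas [measurable]: "cdf M \<in> borel_measurable borel"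
    using cont by (intro borel_measurable_continuous_onI) (simp add: continuous_on_eq_continuous_at)
  have "random_variable borel (cdf M)"
    unfolding measurable_cong_sets[OF events_eq_borel refl] by (rule meas)
  then interpret D: real_distribution "distr M borel (cdf M)"
    by (rule real_distribution_distr)
  show "real_distribution (distr M borel (cdf M))" by (rule D.real_distribution_axioms)
  have "prob_space (uniform_measure lborel {0..1::real})"
    by (rule prob_space_uniform_measure) auto
  then show "real_distribution (uniform_measure lborel {0..1})"
    by (simp add: real_distribution_def real_distribution_axioms_def)
  have value_attained: "\<exists>x. cdf M x = h" if "0 < h" "h < 1" for h
  proof -
    have "eventually (\<lambda>x. cdf M x > h) at_top" "eventually (\<lambda>x. cdf M x < h) at_bot"
      using order_tendstoD(1)[OF cdf_lim_at_top_prob that(2)] order_tendstoD(2)[OF cdf_lim_at_bot that(1)] by auto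
    then obtain a b where ab: "cdf M a < h" "h < cdf M b"
      by (metis eventually_happens' trivial_limit_at_top_linorder trivial_limit_at_bot_linorder)
    then have "a \<le> b" using cdf_nondecreasing[of b a] by linarith
    then show ?thesis
      using IVT'[of "cdf M" a h b] ab cont by (auto simp: continuous_at_imp_continuous_on less_imp_le)
  qed
  have level: "measure M {x. cdf M x \<le> h} = h" if h: "0 \<le> h" "h < 1" for h
  proof (rule antisym)
    show "measure M {x. cdf M x \<le> h} \<le> h"
    proof (rule field_le_epsilon)
      fix e :: real assume "e > 0"
      \<comment> \<open>The sublevel set at \<open>h\<close> may extend to the right of a given
        point with value \<open>h\<close>, along a plateau; a point with a slightly larger value
        lies beyond it. The second bound keeps \<open>h'\<close> below 1, where values are known to
        be attained.\<close>
      define h' where "h' = min (h + e) ((1 + h) / 2)"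
      have h': "h < h'" "h' < 1" "h' \<le> h + e" using h \<open>e > 0\<close> by (auto simp: h'_def min_def)
      obtain x where x: "cdf M x = h'" using value_attained[of h'] h' h by auto
      have "{y. cdf M y \<le> h} \<subseteq> {..x}"
      proof
        fix y assume "y \<in> {y. cdf M y \<le> h}"
        then show "y \<in> {..x}" using cdf_nondecreasing[of x y] x h' by (cases "y \<le> x") auto
      qed
      then have "measure M {y. cdf M y \<le> h} \<le> measure M {..x}"
        by (intro finite_measure_mono) auto
      also have "\<dots> = h'" using x by (simp add: cdf_def)
      finally show "measure M {x. cdf M x \<le> h} \<le> h + e" using h' by simp
    qed
    show "h \<le> measure M {x. cdf M x \<le> h}"
    proof (cases "h = 0")
      case False
      then obtain x where x: "cdf M x = h" using value_attained[of h] h by auto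
      have "{..x} \<subseteq> {y. cdf M y \<le> h}" using cdf_nondecreasing[of _ x] x by auto
      then have "measure M {..x} \<le> measure M {y. cdf M y \<le> h}"
        by (intro finite_measure_mono) (auto simp: pred_def)
      then show ?thesis using x by (simp add: cdf_def)
    qed simp
  qed
  show "cdf (distr M borel (cdf M)) = cdf (uniform_measure lborel {0..1})"
  proof
    fix h
    have "cdf (distr M borel (cdf M)) h = measure M {x. cdf M x \<le> h}"
      unfolding cdf_def[of "distr M borel (cdf M)"] by (subst measure_distr) (auto simp: vimage_def)
    moreover have "cdf (uniform_measure lborel {0..1}) h = (if h < 0 then 0 else if h < 1 then h else 1)"
    proof -
      have "{0..1} \<inter> {..h} = (if h < 0 then {} else if h < 1 then {0..h} else {0..1::real})" by auto
      then show ?thesis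
        unfolding cdf_def by (subst measure_uniform_measure) auto
    qed
    moreover have "measure M {x. cdf M x \<le> h} = 0" if "h < 0"
    proof -
      have "{x. cdf M x \<le> h} = {}" using that cdf_nonneg by (auto simp: not_le intro: less_le_trans)
      then show ?thesis by simp
    qed
    moreover have "measure M {x. cdf M x \<le> h} = 1" if "1 \<le> h"
    proof -
      have "{x. cdf M x \<le> h} = space M" using that cdf_bounded_prob by (auto intro: order_trans)
      then show ?thesis using prob_space by simp
    qed
    ultimately show "cdf (distr M borel (cdf M)) h = cdf (uniform_measure lborel {0..1}) h"
      using level[of h] by auto
  qed
qed

section \<open>Atoms, ranks and coordinates for a single distribution on the line\<close>

context real_distribution
begin

lemma M_prob_algebra: "M \<in> space (prob_algebra borel)"
  using prob_space_axioms by (simp add: space_prob_algebra)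

lemma atom_mass_measurable [measurable]: "atom_mass M \<in> borel_measurable borel"
  using measurable_atom_mass[OF measurable_const[OF M_prob_algebra, of borel] measurable_ident_sets[OF refl]] by simp

lemma atomless_part_measurable [measurable]: "atomless_part M \<in> sets borel"
  unfolding atomless_part_def by measurable

lemma fibre_coordinate_measurable [measurable]: "fibre_coordinate M \<in> borel_measurable borel"
  using measurable_fibre_coordinate_borel[OF measurable_const[OF M_prob_algebra, of borel] measurable_ident_sets[OF refl]] by simp

lemma finite_heavy_atoms:
  assumes "0 < t"
  shows "finite {y. t \<le> atom_mass M y}"
proof (rule ccontr)
  assume inf: "infinite {y. t \<le> atom_mass M y}"
  obtain s where s: "0 < s" "ennreal s \<le> t"
    using assms by (cases t) (auto intro: that[of 1] simp: ennreal_less_iff)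
  obtain n :: nat where n: "1 / s < n" using reals_Archimedean2 by blast
  obtain F where F: "F \<subseteq> {y. t \<le> atom_mass M y}" "finite F" "card F = n"
    using infinite_arbitrarily_large[OF inf, of n] by auto
  have "ennreal (n * s) = (\<Sum>y\<in>F. ennreal s)"
    using F s by (simp add: ennreal_mult ennreal_of_nat_eq_real_of_nat)
  also have "\<dots> \<le> (\<Sum>y\<in>F. emeasure M {y})"
    using F s unfolding atom_mass_def by (intro sum_mono) (auto intro: order_trans)
  also have "\<dots> = emeasure M F"
    using F by (intro emeasure_eq_sum_singleton[symmetric]) auto
  also have "\<dots> \<le> ennreal 1" using emeasure_le_1 by simp
  finally have "n * s \<le> 1" using s by (subst (asm) ennreal_le_iff) auto
  then show False using n s by (simp add: field_simps)
qed

lemma atoms_upto_finite: "atom_mass M x \<noteq> 0 \<Longrightarrow> finite (atoms_upto M x)"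
  by (rule finite_subset[OF _ finite_heavy_atoms[of "atom_mass M x"]])
    (auto simp: atoms_upto_def zero_less_iff_neq_zero)

lemma atom_rank_eq_card:
  assumes "atom_mass M x \<noteq> 0"
  shows "atom_rank M x = card (atoms_upto M x)"
proof -
  have "(\<integral>\<^sup>+ y. inverse (atom_mass M y) * indicator (atoms_upto M x) y \<partial>M) =
      (\<Sum>y\<in>atoms_upto M x. inverse (atom_mass M y) * emeasure M {y})"
    by (rule nn_integral_indicator_finite[OF atoms_upto_finite[OF assms]]) simp
  also have "\<dots> = (\<Sum>y\<in>atoms_upto M x. 1)"
  proof (rule sum.cong[OF refl])
    fix y assume "y \<in> atoms_upto M x"
    then have "atom_mass M y \<noteq> 0" using assms by (auto simp: atoms_upto_def)
    moreover have "atom_mass M y < \<top>"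
      by (simp add: atom_mass_def less_top[symmetric])
    ultimately show "inverse (atom_mass M y) * emeasure M {y} = 1"
      using ennreal_divide_self[of "atom_mass M y"] by (simp add: atom_mass_def divide_ennreal_def mult.commute)
  qed
  finally show ?thesis unfolding atom_rank_def by simp
qed

lemma atoms_upto_refl: "x \<in> atoms_upto M x"
  by (simp add: atoms_upto_def)

lemma atoms_upto_less:
  assumes "atom_mass M x' \<noteq> 0" "x \<in> atoms_upto M x'" "x \<noteq> x'"
  shows "card (atoms_upto M x) < card (atoms_upto M x')"
proof (rule psubset_card_mono[OF atoms_upto_finite[OF assms(1)]])
  have "x' \<notin> atoms_upto M x" "atoms_upto M x \<subseteq> atoms_upto M x'"
    using assms(2,3) by (auto simp: atoms_upto_def)
  then show "atoms_upto M x \<subset> atoms_upto M x'" using atoms_upto_refl[of x'] by blast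
qed

lemma atoms_upto_total: "x \<in> atoms_upto M y \<or> y \<in> atoms_upto M x"
  by (auto simp: atoms_upto_def)

lemma atom_rank_inj:
  assumes "atom_mass M x \<noteq> 0" "atom_mass M x' \<noteq> 0" "atom_rank M x = atom_rank M x'"
  shows "x = x'"
  using assms atoms_upto_less[of x' x] atoms_upto_less[of x x'] atoms_upto_total[of x x']
  by (auto simp: atom_rank_eq_card)

text \<open>Ranks leave no gaps: removing \<open>x\<close> from its initial segment leaves the
  initial segment of the last remaining atom. This is the source of the monotonicity of the masses
  at the points \<open>1 + 1 / n\<close>.\<close>

lemma atom_rank_pred:
  assumes x: "atom_mass M x \<noteq> 0" and n: "atom_rank M x = Suc n" "1 \<le> n"
  shows "\<exists>x'. atom_mass M x \<le> atom_mass M x' \<and> atom_rank M x' = n"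
proof -
  define I where "I = atoms_upto M x - {x}"
  have I: "finite I" "card I = n"
    using n atoms_upto_refl[of x] by (auto simp: I_def atom_rank_eq_card[OF x] atoms_upto_finite[OF x])
  have nz: "atom_mass M y \<noteq> 0" "atom_mass M x \<le> atom_mass M y" if "y \<in> I" for y
    using that x by (auto simp: I_def atoms_upto_def)
  have "I \<noteq> {}" using I n by auto
  \<comment> \<open>\<open>x'\<close> is the last element of the remaining segment, found by
    maximising the size of its own segment.\<close>
  then obtain x' where x': "x' \<in> I" "\<And>y. y \<in> I \<Longrightarrow> card (atoms_upto M y) \<le> card (atoms_upto M x')"
  proof -
    let ?g = "\<lambda>y. card (atoms_upto M y)"
    have "Max (?g ` I) \<in> ?g ` I" using I(1) \<open>I \<noteq> {}\<close> by (intro Max_in) auto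
    then obtain x' where "x' \<in> I" "Max (?g ` I) = ?g x'" by auto
    moreover have "?g y \<le> Max (?g ` I)" if "y \<in> I" for y using I(1) that by (intro Max_ge) auto
    ultimately show thesis using that by metis
  qed
  have "atoms_upto M x' = I"
  proof
    show "atoms_upto M x' \<subseteq> I" using x'(1) by (auto simp: I_def atoms_upto_def)
    show "I \<subseteq> atoms_upto M x'"
    proof
      fix y assume y: "y \<in> I"
      show "y \<in> atoms_upto M x'"
        using atoms_upto_total[of y x'] atoms_upto_less[OF nz(1)[OF y], of x'] x'(2)[OF y] atoms_upto_refl by force
    qed
  qed
  then have "atom_rank M x' = n" using I atom_rank_eq_card[OF nz(1)[OF x'(1)]] by simp
  then show ?thesis using nz x'(1) by blast
qed

lemma fibre_coordinate_atomless:
  assumes "atom_mass M x = 0"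
  shows "fibre_coordinate M x \<in> {0..1}"
proof -
  have "prob (atomless_part M \<inter> {..x}) \<le> prob (atomless_part M)"
    by (intro finite_measure_mono) auto
  then have "prob (atomless_part M \<inter> {..x}) / prob (atomless_part M) \<le> 1"
    using zero_less_measure_iff[of M "atomless_part M"] by (auto simp: divide_le_eq_1)
  then show ?thesis using assms by (simp add: fibre_coordinate_def)
qed

lemma fibre_coordinate_atom:
  assumes "atom_mass M x \<noteq> 0"
  shows "\<exists>n\<ge>1. atom_rank M x = real n \<and> fibre_coordinate M x = 1 + 1 / real n"
proof -
  have "card (atoms_upto M x) \<ge> 1"
    using atoms_upto_refl[of x] atoms_upto_finite[OF assms] by (simp add: Suc_le_eq card_gt_0_iff) blast
  then show ?thesis using assms by (auto simp: fibre_coordinate_def atom_rank_eq_card)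
qed

lemma fibre_coordinate_in_fibre_set: "fibre_coordinate M x \<in> fibre_set"
proof (cases "atom_mass M x = 0")
  case True
  then show ?thesis using fibre_coordinate_atomless[of x] by (simp add: fibre_set_def)
next
  case False
  then show ?thesis using fibre_coordinate_atom[of x] by (auto simp: fibre_set_def)
qed

lemma fibre_coordinate_eq_atom_iff:
  assumes "1 \<le> n"
  shows "fibre_coordinate M x = 1 + 1 / real n \<longleftrightarrow> atom_mass M x \<noteq> 0 \<and> atom_rank M x = real n"
proof (cases "atom_mass M x = 0")
  case True
  have "1 < 1 + 1 / real n" using assms by simp
  then show ?thesis using True fibre_coordinate_atomless[OF True] by auto
next
  case False
  then show ?thesis using fibre_coordinate_atom[OF False] assms by auto
qed

text \<open>Conditioned on its atomless part, \<open>M\<close> becomes an atomless distribution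
  \<open>P\<close> whose distribution function is exactly the coordinate of the non-atoms, so
  \<open>cdf_transform_uniform\<close> applies to it.\<close>

lemma emeasure_fibre_coordinate_atomless:
  assumes [measurable]: "D \<in> sets borel"
  shows "emeasure M {x. atom_mass M x = 0 \<and> fibre_coordinate M x \<in> D} =
    emeasure M (atomless_part M) * emeasure lborel (D \<inter> {0..1})"
proof (cases "emeasure M (atomless_part M) = 0")
  case True
  have "emeasure M {x. atom_mass M x = 0 \<and> fibre_coordinate M x \<in> D} \<le> emeasure M (atomless_part M)"
    by (intro emeasure_mono) (auto simp: atomless_part_def)
  then show ?thesis using True by simp
next
  case False
  define P where "P = uniform_measure M (atomless_part M)"
  have "prob_space P"
    unfolding P_def using False by (intro prob_space_uniform_measure) auto
  then interpret P: real_distribution P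
    by (simp add: real_distribution_def real_distribution_axioms_def P_def)
  have "measure P {x} = 0" for x
  proof -
    have "atomless_part M \<inter> {x} = (if x \<in> atomless_part M then {x} else {})" by auto
    then have "emeasure M (atomless_part M \<inter> {x}) = 0"
      by (simp add: atomless_part_def atom_mass_def)
    then show ?thesis unfolding P_def measure_def by simp
  qed
  then have U: "distr P borel (cdf P) = uniform_measure lborel {0..1}"
    by (rule P.cdf_transform_uniform)
  have cdf: "cdf P x = measure M (atomless_part M \<inter> {..x}) / measure M (atomless_part M)" for x
    unfolding cdf_def P_def using False by (subst measure_uniform_measure) auto
  have [measurable]: "cdf P \<in> borel_measurable borel"
    using P.cdf_nondecreasing by (intro borel_measurable_mono) (simp add: mono_def)
  have "emeasure M {x. atom_mass M x = 0 \<and> fibre_coordinate M x \<in> D} = emeasure M (atomless_part M \<inter> cdf P -` D)"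
    by (rule arg_cong[of _ _ "emeasure M"]) (auto simp: atomless_part_def fibre_coordinate_def cdf)
  also have "\<dots> = emeasure M (atomless_part M) * emeasure P (cdf P -` D)"
  proof -
    have D: "cdf P -` D \<in> sets M"
      using measurable_sets[of "cdf P" borel borel D] by simp
    have "emeasure P (cdf P -` D) = emeasure M (atomless_part M \<inter> cdf P -` D) / emeasure M (atomless_part M)"
      using emeasure_uniform_measure[OF _ D, of "atomless_part M"] by (simp flip: P_def)
    then show ?thesis
      using False mult_divide_eq_ennreal[of "emeasure M (atomless_part M)" "emeasure M (atomless_part M \<inter> cdf P -` D)"]
      by (simp add: ennreal_times_divide mult.commute)
  qed
  also have "emeasure P (cdf P -` D) = emeasure (distr P borel (cdf P)) D"
    by (subst emeasure_distr) auto
  also have "\<dots> = emeasure lborel (D \<inter> {0..1})"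
    unfolding U by (subst emeasure_uniform_measure) (auto simp: Int_commute divide_ennreal_def)
  finally show ?thesis .
qed

text \<open>The multiple of Lebesgue measure is the mass of the atomless part. The mass at
  \<open>1 + 1 / n\<close> is that of the unique atom of rank \<open>n\<close>, if there is one, and
  \<open>atom_rank_pred\<close> supplies a predecessor at least as heavy for an atom of rank
  \<open>n + 1\<close>.\<close>

lemma suitable_fibre_coordinate:
  "suitable_fibre_measure (distr M fibre (fibre_coordinate M))"
proof -
  have t [measurable]: "fibre_coordinate M \<in> M \<rightarrow>\<^sub>M fibre"
    unfolding fibre_def using fibre_coordinate_in_fibre_set
    by (intro measurable_restrict_space2) auto
  have e: "emeasure (distr M fibre (fibre_coordinate M)) D = emeasure M {x. fibre_coordinate M x \<in> D}"
    if "D \<in> sets borel" "D \<subseteq> fibre_set" for D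
  proof -
    have "D \<in> sets fibre"
      using that unfolding fibre_def sets_restrict_space by auto
    then show ?thesis by (subst emeasure_distr) (auto simp: vimage_def)
  qed
  have at: "1 + 1 / real n \<in> fibre_set" if "1 \<le> n" for n
    using that by (auto simp: fibre_set_def)
  show ?thesis
    unfolding suitable_fibre_measure_def
  proof (intro conjI exI[of _ "emeasure M (atomless_part M)"] ballI allI impI)
    fix D :: "real set" assume D: "D \<in> sets borel" "D \<subseteq> {0..1}"
    have "{x. fibre_coordinate M x \<in> D} = {x. atom_mass M x = 0 \<and> fibre_coordinate M x \<in> D}"
    proof -
      have "atom_mass M x = 0" if "fibre_coordinate M x \<in> D" for x
      proof (rule ccontr)
        assume "atom_mass M x \<noteq> 0"
        then obtain n where "n \<ge> 1" "fibre_coordinate M x = 1 + 1 / real n"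
          using fibre_coordinate_atom by blast
        moreover have "1 < 1 + 1 / real n" using \<open>n \<ge> 1\<close> by simp
        ultimately show False using that D(2) by auto
      qed
      then show ?thesis by auto
    qed
    moreover have "D \<inter> {0..1} = D" "D \<subseteq> fibre_set" using D(2) by (auto simp: fibre_set_def)
    ultimately show "emeasure (distr M fibre (fibre_coordinate M)) D = emeasure M (atomless_part M) * emeasure lborel D"
      using e[OF D(1)] emeasure_fibre_coordinate_atomless[OF D(1)] by simp
  next
    fix n :: nat assume n: "1 \<le> n"
    have S: "emeasure (distr M fibre (fibre_coordinate M)) {1 + 1 / real k} =
        emeasure M {x. atom_mass M x \<noteq> 0 \<and> atom_rank M x = real k}" if "1 \<le> k" for k
      using at[OF that] fibre_coordinate_eq_atom_iff[OF that] by (subst e) auto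
    show "emeasure (distr M fibre (fibre_coordinate M)) {1 + 1 / real (Suc n)} \<le>
        emeasure (distr M fibre (fibre_coordinate M)) {1 + 1 / real n}"
    proof (cases "{x. atom_mass M x \<noteq> 0 \<and> atom_rank M x = real (Suc n)} = {}")
      case True
      have "emeasure (distr M fibre (fibre_coordinate M)) {1 + 1 / real (Suc n)} = 0"
        using S[of "Suc n"] unfolding True by simp
      then show ?thesis by (simp del: of_nat_Suc)
    next
      case False
      then obtain x where x: "atom_mass M x \<noteq> 0" "atom_rank M x = real (Suc n)" by blast
      obtain x' where x': "atom_mass M x \<le> atom_mass M x'" "atom_rank M x' = real n"
        using atom_rank_pred[OF x n] by blast
      have single: "{z. atom_mass M z \<noteq> 0 \<and> atom_rank M z = atom_rank M y} = {y}" if "atom_mass M y \<noteq> 0" for y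
        using atom_rank_inj that by auto
      have "atom_mass M x' \<noteq> 0" using x(1) x'(1) by auto
      then have "{z. atom_mass M z \<noteq> 0 \<and> atom_rank M z = real n} = {x'}"
        using single[of x'] x' by simp
      moreover have "{z. atom_mass M z \<noteq> 0 \<and> atom_rank M z = real (Suc n)} = {x}"
        using single[of x] x by simp
      ultimately show ?thesis
        using S[of n] S[of "Suc n"] n x' by (simp add: atom_mass_def)
    qed
  qed
qed

text \<open>
  The coordinate is injective apart from the plateaus of the distribution function, and each
  plateau that is not a single point contains a rational number to the right of its other points.
\<close>

lemma AE_fibre_coordinate_no_plateau:
  "AE x in M. atom_mass M x = 0 \<longrightarrow> (\<forall>r\<in>\<rat>. x < r \<longrightarrow>
     measure M (atomless_part M \<inter> {..x}) \<noteq> measure M (atomless_part M \<inter> {..r}))"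
proof -
  have "AE x in M. atom_mass M x = 0 \<longrightarrow> x < r \<longrightarrow>
      measure M (atomless_part M \<inter> {..x}) \<noteq> measure M (atomless_part M \<inter> {..r})" for r
  proof -
    \<comment> \<open>\<open>v\<close> is the common coordinate of all points of a plateau ending at
      \<open>r\<close>. A single value is Lebesgue null, so the atomless points that take it form a
      null set.\<close>
    define v where "v = measure M (atomless_part M \<inter> {..r}) / measure M (atomless_part M)"
    have "emeasure M {x. atom_mass M x = 0 \<and> fibre_coordinate M x \<in> {v}} =
        emeasure M (atomless_part M) * emeasure lborel ({v} \<inter> {0..1})"
      by (rule emeasure_fibre_coordinate_atomless) simp
    also have "emeasure lborel ({v} \<inter> {0..1}) \<le> emeasure lborel {v}"
      by (intro emeasure_mono) auto
    finally have "emeasure M {x. atom_mass M x = 0 \<and> fibre_coordinate M x \<in> {v}} = 0"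
      by (simp add: mult_left_mono)
    moreover have "{x. atom_mass M x = 0 \<and> fibre_coordinate M x \<in> {v}} \<in> sets M" by simp
    ultimately have "AE x in M. \<not> (atom_mass M x = 0 \<and> fibre_coordinate M x \<in> {v})"
      using AE_not_in[OF null_setsI, of M "{x. atom_mass M x = 0 \<and> fibre_coordinate M x \<in> {v}}"] by simp
    then show ?thesis
      by (rule eventually_mono) (auto simp: fibre_coordinate_def v_def)
  qed
  then have "AE x in M. \<forall>r\<in>\<rat>. atom_mass M x = 0 \<longrightarrow> x < r \<longrightarrow>
      measure M (atomless_part M \<inter> {..x}) \<noteq> measure M (atomless_part M \<inter> {..r})"
    by (subst AE_ball_countable[OF countable_rat]) blast
  then show ?thesis by (rule eventually_mono) blast
qed

lemma fibre_coordinate_inj: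
  assumes eq: "fibre_coordinate M x = fibre_coordinate M x'"
    and x: "atom_mass M x = 0 \<Longrightarrow> \<forall>r\<in>\<rat>. x < r \<longrightarrow>
      measure M (atomless_part M \<inter> {..x}) \<noteq> measure M (atomless_part M \<inter> {..r})"
    and x': "atom_mass M x' = 0 \<Longrightarrow> \<forall>r\<in>\<rat>. x' < r \<longrightarrow>
      measure M (atomless_part M \<inter> {..x'}) \<noteq> measure M (atomless_part M \<inter> {..r})"
  shows "x = x'"
proof -
  have no_mix: False if yz: "atom_mass M y = 0" "atom_mass M z \<noteq> 0" "fibre_coordinate M y = fibre_coordinate M z" for y z
  proof -
    obtain n where n: "n \<ge> 1" "fibre_coordinate M z = 1 + 1 / real n"
      using fibre_coordinate_atom[OF yz(2)] by blast
    then have "1 < fibre_coordinate M z" by simp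
    then show False using fibre_coordinate_atomless[OF yz(1)] yz(3) by simp
  qed
  have atomless: False if "atom_mass M y = 0" "atom_mass M z = 0" "fibre_coordinate M y = fibre_coordinate M z" "y < z"
    and plateau: "\<forall>r\<in>\<rat>. y < r \<longrightarrow> measure M (atomless_part M \<inter> {..y}) \<noteq> measure M (atomless_part M \<inter> {..r})" for y z
  proof -
    obtain r where r: "r \<in> \<rat>" "y < r" "r < z" using Rats_dense_in_real[OF \<open>y < z\<close>] by blast
    have mono: "measure M (atomless_part M \<inter> {..a}) \<le> measure M (atomless_part M \<inter> {..b})" if "a \<le> b" for a b
      using that by (intro finite_measure_mono) auto
    \<comment> \<open>If the atomless part is null, equal coordinates carry no information because
      of the division by zero, but then both measures vanish anyway.\<close>
    have "measure M (atomless_part M \<inter> {..y}) = measure M (atomless_part M \<inter> {..z})"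
    proof (cases "measure M (atomless_part M) = 0")
      case True
      have "measure M (atomless_part M \<inter> {..a}) = 0" for a
        using True finite_measure_mono[of "atomless_part M \<inter> {..a}" "atomless_part M"] measure_nonneg[of M]
        by (simp add: antisym)
      then show ?thesis by simp
    next
      case False
      then show ?thesis using that(1-3) by (simp add: fibre_coordinate_def)
    qed
    then have "measure M (atomless_part M \<inter> {..y}) = measure M (atomless_part M \<inter> {..r})"
      using mono[of y r] mono[of r z] r by simp
    then show False using plateau r by blast
  qed
  show ?thesis
  proof (cases "atom_mass M x = 0"; cases "atom_mass M x' = 0")
    assume *: "atom_mass M x = 0" "atom_mass M x' = 0"
    then show ?thesis
      using atomless[of x x'] atomless[of x' x] eq x x' by (cases x x' rule: linorder_cases) auto
  next
    assume *: "atom_mass M x \<noteq> 0" "atom_mass M x' \<noteq> 0"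
    then show ?thesis
      using fibre_coordinate_atom[of x] fibre_coordinate_atom[of x'] eq atom_rank_inj[of x x'] by auto
  qed (use no_mix[of x x'] no_mix[of x' x] eq in auto)
qed

end

section \<open>Coordinates depending measurably on the base point\<close>

lemma kernel_real_distribution:
  assumes "Q \<in> B \<rightarrow>\<^sub>M prob_algebra borel" "m \<in> space B"
  shows "real_distribution (Q m)"
  using kernel_prob_space[OF assms] kernel_sets[OF assms]
  by (simp add: real_distribution_def real_distribution_axioms_def)

lemma measurable_fibre_coordinate:
  assumes [measurable]: "Q \<in> B \<rightarrow>\<^sub>M prob_algebra borel"
  shows "(\<lambda>(m, x). fibre_coordinate (Q m) x) \<in> B \<Otimes>\<^sub>M borel \<rightarrow>\<^sub>M fibre"
  unfolding fibre_def split_beta'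
proof (rule measurable_restrict_space2)
  show "(\<lambda>p. fibre_coordinate (Q (fst p)) (snd p)) \<in> borel_measurable (B \<Otimes>\<^sub>M borel)" by measurable
  show "(\<lambda>p. fibre_coordinate (Q (fst p)) (snd p)) \<in> space (B \<Otimes>\<^sub>M borel) \<rightarrow> fibre_set"
    using real_distribution.fibre_coordinate_in_fibre_set[OF kernel_real_distribution[OF assms]]
    by (auto simp: space_pair_measure)
qed

text \<open>The points off the plateaus, gathered over all base points at once. Only rational
  plateau ends are quantified over, which keeps the set jointly measurable; its property of being
  conull can therefore be transferred to the joint measure.\<close>

lemma fibre_coordinate_injectivity_set:
  assumes [measurable]: "Q \<in> B \<rightarrow>\<^sub>M prob_algebra borel"
  shows "\<exists>X0\<in>sets (B \<Otimes>\<^sub>M borel). \<forall>m\<in>space B. (AE x in Q m. (m, x) \<in> X0) \<and>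
    (\<forall>x x'. (m, x) \<in> X0 \<longrightarrow> (m, x') \<in> X0 \<longrightarrow> fibre_coordinate (Q m) x = fibre_coordinate (Q m) x' \<longrightarrow> x = x')"
proof -
  define X0 where "X0 = {p \<in> space (B \<Otimes>\<^sub>M borel). atom_mass (Q (fst p)) (snd p) = 0 \<longrightarrow> (\<forall>r\<in>\<rat>. snd p < r \<longrightarrow>
      measure (Q (fst p)) (atomless_part (Q (fst p)) \<inter> {..snd p}) \<noteq>
      measure (Q (fst p)) (atomless_part (Q (fst p)) \<inter> {..r}))}"
  have eq: "atomless_part q \<inter> {..x} = {y. atom_mass q y = 0 \<and> y \<le> x}" for q x
    by (auto simp: atomless_part_def)
  have [measurable]: "(\<lambda>p. measure (Q (fst p)) (atomless_part (Q (fst p)) \<inter> {..g p})) \<in> borel_measurable (B \<Otimes>\<^sub>M borel)"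
    if [measurable]: "g \<in> borel_measurable (B \<Otimes>\<^sub>M borel)" for g :: "'a \<times> real \<Rightarrow> real"
    unfolding eq by (rule measurable_measure_kernel_Collect) (simp_all add: split_beta')
  have "X0 \<in> sets (B \<Otimes>\<^sub>M borel)"
    unfolding X0_def by (intro sets.sets_Collect_imp sets.sets_Collect_countable_All'[OF _ countable_rat]) measurable
  moreover have "(AE x in Q m. (m, x) \<in> X0) \<and>
    (\<forall>x x'. (m, x) \<in> X0 \<longrightarrow> (m, x') \<in> X0 \<longrightarrow> fibre_coordinate (Q m) x = fibre_coordinate (Q m) x' \<longrightarrow> x = x')"
    if m: "m \<in> space B" for m
  proof -
    interpret real_distribution "Q m" by (rule kernel_real_distribution[OF assms m])
    have X0: "(m, x) \<in> X0 \<longleftrightarrow> (atom_mass (Q m) x = 0 \<longrightarrow> (\<forall>r\<in>\<rat>. x < r \<longrightarrow>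
      measure (Q m) (atomless_part (Q m) \<inter> {..x}) \<noteq> measure (Q m) (atomless_part (Q m) \<inter> {..r})))" for x
      using m by (simp add: X0_def space_pair_measure)
    show ?thesis
      unfolding X0 using AE_fibre_coordinate_no_plateau fibre_coordinate_inj by blast
  qed
  ultimately show ?thesis by blast
qed

subsection \<open>Uniqueness of suitable measures\<close>

lemma space_fibre: "space fibre = fibre_set"
  by (simp add: fibre_def space_restrict_space)

lemma fibre_set_measurable [measurable]: "fibre_set \<in> sets borel"
proof -
  have "{1 + 1 / real n |n. 1 \<le> n} = (\<lambda>n. 1 + 1 / real n) ` {1..}" by auto
  then have "countable {1 + 1 / real n |n. 1 \<le> n}" by simp
  then have "{1 + 1 / real n |n. 1 \<le> n} \<in> sets borel" by (rule sets.countable[rotated]) auto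
  then show ?thesis unfolding fibre_set_def by (intro sets.Un) auto
qed

lemma sets_fibre: "D \<in> sets fibre \<longleftrightarrow> D \<in> sets borel \<and> D \<subseteq> fibre_set"
  unfolding fibre_def by (subst sets_restrict_space_iff) auto

lemma atom_in_fibre: "1 \<le> n \<Longrightarrow> {1 + 1 / real n} \<in> sets fibre"
  by (auto simp: sets_fibre fibre_set_def)

lemma id_fibre_borel: "(\<lambda>x. x) \<in> fibre \<rightarrow>\<^sub>M borel"
  unfolding fibre_def by (rule measurable_restrict_space1) simp

text \<open>A singleton in the unit interval has Lebesgue measure 0, and one outside the fibre is
  not measurable, hence has \<open>emeasure\<close> 0 by convention.\<close>

lemma suitable_fibre_singleton:
  assumes "suitable_fibre_measure k" and sets: "sets k = sets fibre" and pos: "emeasure k {s} \<noteq> 0"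
  shows "s \<in> (\<lambda>n. 1 + 1 / real n) ` {1..}"
proof (rule ccontr)
  assume *: "s \<notin> (\<lambda>n. 1 + 1 / real n) ` {1..}"
  have "{s} \<in> sets k" using pos emeasure_notin_sets by blast
  then have "s \<in> {0..1}" using * by (auto simp: sets sets_fibre fibre_set_def)
  moreover obtain c where "\<And>B. B \<in> sets borel \<Longrightarrow> B \<subseteq> {0..1} \<Longrightarrow> emeasure k B = c * emeasure lborel B"
    using assms(1) unfolding suitable_fibre_measure_def by blast
  ultimately have "emeasure k {s} = c * emeasure lborel {s}" by simp
  then have "emeasure k {s} = 0" by simp
  then show False using pos by simp
qed

lemma suitable_fibre_atoms_antimono:
  assumes "suitable_fibre_measure k" "1 \<le> m" "m \<le> n"
  shows "emeasure k {1 + 1 / real n} \<le> emeasure k {1 + 1 / real m}"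
  using assms(3)
proof (induction n rule: dec_induct)
  case (step n)
  then have "emeasure k {1 + 1 / real (Suc n)} \<le> emeasure k {1 + 1 / real n}"
    using assms(1,2) unfolding suitable_fibre_measure_def by (metis order_trans)
  then show ?case using step.IH by (rule order_trans)
qed simp

text \<open>
  An isomorphism maps the atoms of mass at least \<open>t\<close> injectively to atoms of mass at least \<open>t\<close>, and
  the number of the latter determines the nonincreasing sequence of masses.
\<close>

lemma suitable_fibre_atoms_le:
  assumes k: "suitable_fibre_measure k" "sets k = sets fibre"
    and k': "suitable_fibre_measure k'" "sets k' = sets fibre"
    and u: "u \<in> k \<rightarrow>\<^sub>M k'" "distr k k' u = k'" and inv: "AE s in k. r (u s) = s"
    and n: "1 \<le> n"
  shows "emeasure k {1 + 1 / real n} \<le> emeasure k' {1 + 1 / real n}"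
proof (rule ccontr)
  define pt :: "nat \<Rightarrow> real" where "pt n = 1 + 1 / real n" for n
  define t where "t = emeasure k {pt n}"
  assume "\<not> ?thesis"
  then have lt: "emeasure k' {pt n} < t" by (simp add: t_def pt_def)
  then have t0: "0 < t" by (rule le_less_trans[rotated]) simp
  have pt_inj: "inj_on pt A" for A
    by (auto simp: inj_on_def pt_def)
  have big: "t \<le> emeasure k {pt m}" if "m \<in> {1..n}" for m
    using suitable_fibre_atoms_antimono[OF k(1), of m n] that by (simp add: t_def pt_def)
  \<comment> \<open>The left inverse is only known almost everywhere, but a point of positive mass
    cannot lie in an exceptional null set.\<close>
  have ru: "r (u (pt m)) = pt m" if m: "m \<in> {1..n}" for m
  proof (rule ccontr)
    assume ne: "r (u (pt m)) \<noteq> pt m"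
    have mem: "{pt m} \<in> sets k" using m k(2) by (simp add: pt_def atom_in_fibre)
    then have "pt m \<in> space k" using sets.sets_into_space by blast
    obtain N where N: "{s \<in> space k. r (u s) \<noteq> s} \<subseteq> N" "emeasure k N = 0" "N \<in> sets k"
      using inv by (rule AE_E)
    have "emeasure k {pt m} \<le> emeasure k N"
      using N ne \<open>pt m \<in> space k\<close> by (intro emeasure_mono) auto
    then show False using big[OF m] t0 N(2) by simp
  qed
  \<comment> \<open>The image carries mass at least \<open>t\<close>, so it is one of the points
    \<open>pt j\<close>; since all masses from index \<open>n\<close> on are below \<open>t\<close>,
    its index is below \<open>n\<close>. Injectivity would thus squeeze \<open>n\<close> points into
    \<open>n - 1\<close> places.\<close>
  have "u (pt m) \<in> pt ` {1..<n}" if m: "m \<in> {1..n}" for m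
  proof -
    have mem: "{pt m} \<in> sets k" using m k(2) by (simp add: pt_def atom_in_fibre)
    have mem': "pt m \<in> space k" using sets.sets_into_space[OF mem] by blast
    have "u (pt m) \<in> fibre_set"
      using measurable_space[OF u(1) mem'] sets_eq_imp_space_eq[OF k'(2)] by (simp add: space_fibre)
    then have "{u (pt m)} \<in> sets k'" using k'(2) by (simp add: sets_fibre)
    then have "emeasure k' {u (pt m)} = emeasure k (u -` {u (pt m)} \<inter> space k)"
      by (subst u(2)[symmetric], subst emeasure_distr[OF u(1)]) auto
    also have "\<dots> \<ge> emeasure k {pt m}"
      using mem' measurable_sets[OF u(1) \<open>{u (pt m)} \<in> sets k'\<close>] by (intro emeasure_mono) auto
    finally have ge: "t \<le> emeasure k' {u (pt m)}" using big[OF m] by (rule order_trans[rotated])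
    then have "emeasure k' {u (pt m)} \<noteq> 0" using t0 by auto
    then obtain j where j: "1 \<le> j" "u (pt m) = pt j"
      using suitable_fibre_singleton[OF k'] by (auto simp: pt_def)
    have "j < n"
    proof (rule ccontr)
      assume "\<not> j < n"
      then have "emeasure k' {pt j} \<le> emeasure k' {pt n}"
        using suitable_fibre_atoms_antimono[OF k'(1) n, of j] by (simp add: pt_def)
      then show False using ge lt j by simp
    qed
    then show ?thesis using j by auto
  qed
  then have sub: "(u \<circ> pt) ` {1..n} \<subseteq> pt ` {1..<n}" by auto
  have "inj_on (u \<circ> pt) {1..n}"
    by (rule inj_on_inverseI[of _ "inv_into {1..n} pt \<circ> r"])
      (use ru inv_into_f_f[OF pt_inj, of _ "{1..n}"] in simp)
  then have "card {1..n} = card ((u \<circ> pt) ` {1..n})" by (rule card_image[symmetric])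
  also have "\<dots> \<le> card (pt ` {1..<n})" using sub by (intro card_mono) auto
  also have "\<dots> \<le> card {1..<n}" by (rule card_image_le) simp
  finally show False using n by simp
qed

text \<open>Only the Lebesgue multiple remains to be determined; as the total mass is 1, it is the
  complement of the total atom mass.\<close>

lemma suitable_fibre_measure_eqI:
  assumes k: "suitable_fibre_measure k" "sets k = sets fibre" "prob_space k"
    and k': "suitable_fibre_measure k'" "sets k' = sets fibre" "prob_space k'"
    and eq: "\<And>n. 1 \<le> n \<Longrightarrow> emeasure k {1 + 1 / real n} = emeasure k' {1 + 1 / real n}"
  shows "k = k'"
proof -
  define S where "S = (\<lambda>n. 1 + 1 / real n) ` {1..}"
  have S: "countable S" "fibre_set = {0..1} \<union> S" "{0..1} \<inter> S = {}"
    by (auto simp: S_def fibre_set_def)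
  have SD: "D \<in> sets fibre" if "D \<subseteq> S" for D
  proof -
    have "D \<in> sets borel" using countable_subset[OF that S(1)] by (rule sets.countable[rotated]) auto
    then show ?thesis using that S(2) by (auto simp: sets_fibre)
  qed
  have atoms: "emeasure l D = (\<integral>\<^sup>+ s. emeasure l {s} \<partial>count_space D)" if "D \<subseteq> S" "sets l = sets fibre" for l D
  proof (rule emeasure_countable_singleton)
    show "{x} \<in> sets l" if "x \<in> D" for x using SD[of "{x}"] that \<open>D \<subseteq> S\<close> \<open>sets l = _\<close> by auto
    show "countable D" using countable_subset[OF \<open>D \<subseteq> S\<close> S(1)] .
  qed
  have eqS: "emeasure k D = emeasure k' D" if "D \<subseteq> S" for D
    unfolding atoms[OF that k(2)] atoms[OF that k'(2)]
    using eq that by (intro nn_integral_cong) (auto simp: S_def)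
  have unit: "{0..1} \<in> sets fibre" by (auto simp: sets_fibre fibre_set_def)
  have split: "emeasure l D = emeasure l (D \<inter> {0..1}) + emeasure l (D \<inter> S)"
    if "D \<in> sets fibre" "sets l = sets fibre" for l D
  proof -
    have "D = (D \<inter> {0..1}) \<union> (D \<inter> S)" using that S(2) by (auto simp: sets_fibre)
    moreover have "D \<inter> {0..1} \<in> sets l" "D \<inter> S \<in> sets l" using that unit SD[of "D \<inter> S"] by auto
    ultimately show ?thesis using plus_emeasure[of "D \<inter> {0..1}" l "D \<inter> S"] S(3) by (metis Int_assoc Int_commute Int_empty_right)
  qed
  obtain c where c: "\<And>B. B \<in> sets borel \<Longrightarrow> B \<subseteq> {0..1} \<Longrightarrow> emeasure k B = c * emeasure lborel B"
    using k(1) unfolding suitable_fibre_measure_def by blast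
  obtain c' where c': "\<And>B. B \<in> sets borel \<Longrightarrow> B \<subseteq> {0..1} \<Longrightarrow> emeasure k' B = c' * emeasure lborel B"
    using k'(1) unfolding suitable_fibre_measure_def by blast
  have "c = c'"
  proof -
    have "emeasure l {0..1} = 1 - emeasure l S" if "prob_space l" "sets l = sets fibre" for l
    proof -
      interpret prob_space l by fact
      have "fibre_set \<in> sets fibre" by (simp add: sets_fibre)
      have "fibre_set \<inter> {0..1} = {0..1}" "fibre_set \<inter> S = S" using S(2) by auto
      with split[OF \<open>fibre_set \<in> sets fibre\<close> that(2)]
      have "emeasure l {0..1} + emeasure l S = emeasure l fibre_set"
        by simp
      also have "\<dots> = 1" using emeasure_space_1 sets_eq_imp_space_eq[OF that(2)] by (simp add: space_fibre)
      finally show ?thesis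
        by (metis emeasure_finite ennreal_add_diff_cancel_right infinity_ennreal_def)
    qed
    then have "emeasure k {0..1} = emeasure k' {0..1}" using k k' eqS[of S] by simp
    then show ?thesis by (simp add: c c')
  qed
  show ?thesis
  proof (rule measure_eqI)
    fix D assume "D \<in> sets k"
    then have D: "D \<in> sets fibre" using k(2) by simp
    then have "D \<inter> {0..1} \<in> sets borel" by (auto simp: sets_fibre)
    then have "emeasure k (D \<inter> {0..1}) = emeasure k' (D \<inter> {0..1})"
      using c[of "D \<inter> {0..1}"] c'[of "D \<inter> {0..1}"] \<open>c = c'\<close> by simp
    then show "emeasure k D = emeasure k' D"
      unfolding split[OF D k(2)] split[OF D k'(2)] using eqS[of "D \<inter> S"] by simp
  qed (simp add: k(2) k'(2))
qed

text \<open>For a fixed fibre set \<open>D\<close> the assumption says that two functions of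
  \<open>m\<close> have the same integrals over all base sets, so they agree almost everywhere. With
  \<open>D\<close> running over rational half-lines the exceptional sets are countably many, and
  these half-lines determine a finite measure.\<close>

lemma fibre_kernel_AE_eq:
  fixes B :: "'m measure"
  assumes "prob_space M" and sM: "sets M = sets B"
    and K: "K \<in> B \<rightarrow>\<^sub>M prob_algebra fibre" and K': "K' \<in> B \<rightarrow>\<^sub>M prob_algebra fibre"
    and eq: "\<And>C D. C \<in> sets B \<Longrightarrow> D \<in> sets fibre \<Longrightarrow>
      (\<integral>\<^sup>+ m. emeasure (K m) D * indicator C m \<partial>M) = (\<integral>\<^sup>+ m. emeasure (K' m) D * indicator C m \<partial>M)"
  shows "AE m in M. K m = K' m"
proof -
  interpret prob_space M by fact
  have spM: "space M = space B" using sM by (rule sets_eq_imp_space_eq)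
  have mem: "fibre_set \<inter> {q<..} \<in> sets fibre" for q by (simp add: sets_fibre)
  have "AE m in M. emeasure (K m) (fibre_set \<inter> {q<..}) = emeasure (K' m) (fibre_set \<inter> {q<..})" for q
    using measurable_kernel_emeasure[OF K mem] measurable_kernel_emeasure[OF K' mem] eq[OF _ mem] sM
    by (intro density_unique_finite_measure) (auto cong: measurable_cong_sets)
  then have "AE m in M. \<forall>q\<in>\<rat>. emeasure (K m) (fibre_set \<inter> {q<..}) = emeasure (K' m) (fibre_set \<inter> {q<..})"
    by (subst AE_ball_countable[OF countable_rat]) blast
  then show ?thesis
    using AE_space
  proof eventually_elim
    case (elim m)
    then have m: "m \<in> space B" using spM by simp
    have e: "emeasure (distr (L m) borel (\<lambda>x. x)) D = emeasure (L m) (fibre_set \<inter> D)"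
      if L: "L \<in> B \<rightarrow>\<^sub>M prob_algebra fibre" and "D \<in> sets borel" for L D
      using that kernel_sets[OF L m] kernel_space[OF L m]
      by (subst emeasure_distr) (auto simp: space_fibre Int_commute id_fibre_borel cong: measurable_cong_sets)
    have "distr (K m) borel (\<lambda>x. x) = distr (K' m) borel (\<lambda>x. x)"
    proof (rule measure_eqI_rational)
      show "finite_measure (distr (K m) borel (\<lambda>x. x))"
        using kernel_prob_space[OF K m] kernel_sets[OF K m]
        by (intro prob_space.finite_measure prob_space.prob_space_distr) (auto simp: id_fibre_borel cong: measurable_cong_sets)
    qed (use elim e[OF K] e[OF K'] in auto)
    then have "emeasure (K m) (fibre_set \<inter> D) = emeasure (K' m) (fibre_set \<inter> D)" if "D \<in> sets borel" for D
      using e[OF K that] e[OF K' that] by simp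
    then have "emeasure (K m) D = emeasure (K' m) D" if "D \<in> sets fibre" for D
      using that by (metis Int_absorb1 sets_fibre)
    then show ?case
      using kernel_sets[OF K m] kernel_sets[OF K' m] by (intro measure_eqI) auto
  qed
qed

lemma suitable_iff_disintegration:
  "suitable A \<kappa> \<longleftrightarrow> sets \<kappa> = sets (Meas A) \<and> prob_space \<kappa> \<and>
     (\<exists>K. disintegration (prob_algebra A) fibre \<kappa> K \<and>
       (AE m in distr \<kappa> (prob_algebra A) fst. suitable_fibre_measure (K m)))"
  by (auto simp: suitable_def disintegration_def Meas_def)

text \<open>Uniqueness of conditional measures: the images of the kernels \<open>K m\<close> under
  the fibre component of \<open>U\<close> give the same rectangle integrals as \<open>K'\<close>,
  because \<open>U\<close> carries \<open>\<kappa>\<close> to \<open>\<kappa>'\<close> and keeps the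
  base point.\<close>

lemma fibred_map_kernels:
  fixes B :: "'m measure"
  assumes sets: "sets \<kappa> = sets (B \<Otimes>\<^sub>M fibre)" "sets \<kappa>' = sets (B \<Otimes>\<^sub>M fibre)"
    and prob: "prob_space \<kappa>"
    and K: "disintegration B fibre \<kappa> K" and K': "disintegration B fibre \<kappa>' K'"
    and U: "invertible_mp \<kappa> \<kappa>' U" and fib: "AE x in \<kappa>. fst (U x) = fst x"
  shows "distr \<kappa>' B fst = distr \<kappa> B fst"
    and "AE m in distr \<kappa> B fst. distr (K m) fibre (\<lambda>s. snd (U (m, s))) = K' m"
proof -
  interpret prob_space \<kappa> by fact
  define M where "M = distr \<kappa> B fst"
  note [measurable_cong] = sets
  have U_meas [measurable]: "U \<in> \<kappa> \<rightarrow>\<^sub>M \<kappa>'" using invertible_mp_measurable[OF U] .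
  have U_meas' [measurable]: "U \<in> B \<Otimes>\<^sub>M fibre \<rightarrow>\<^sub>M B \<Otimes>\<^sub>M fibre"
    using U_meas measurable_cong_sets[OF sets] by simp
  have [measurable]: "fst \<in> \<kappa> \<rightarrow>\<^sub>M B" "fst \<in> \<kappa>' \<rightarrow>\<^sub>M B"
    using disintegration_fst_measurable sets by auto
  have KK: "K \<in> B \<rightarrow>\<^sub>M prob_algebra fibre" "K' \<in> B \<rightarrow>\<^sub>M prob_algebra fibre"
    using K K' by (auto simp: disintegration_def)
  have "distr \<kappa>' B fst = distr (distr \<kappa> \<kappa>' U) B fst"
    using invertible_mp_distr[OF U] by simp
  also have "\<dots> = distr \<kappa> B (fst \<circ> U)" by (subst distr_distr) auto
  also have "\<dots> = M"
    unfolding M_def using fib by (intro distr_cong_AE) auto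
  finally show M': "distr \<kappa>' B fst = distr \<kappa> B fst" by (simp add: M_def)
  have L: "(\<lambda>m. distr (K m) fibre (\<lambda>s. snd (U (m, s)))) \<in> B \<rightarrow>\<^sub>M prob_algebra fibre"
  proof (rule measurable_distr_prob_space2[OF KK(1)])
    show "(\<lambda>(m, s). snd (U (m, s))) \<in> B \<Otimes>\<^sub>M fibre \<rightarrow>\<^sub>M fibre"
      unfolding split_beta' by simp
  qed
  show "AE m in distr \<kappa> B fst. distr (K m) fibre (\<lambda>s. snd (U (m, s))) = K' m"
  proof (rule fibre_kernel_AE_eq[OF _ _ L KK(2)])
    show "prob_space (distr \<kappa> B fst)" by (rule prob_space_distr) simp
    fix C :: "'m set" and D assume C [measurable]: "C \<in> sets B" and D [measurable]: "D \<in> sets fibre"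
    define E where "E = {p \<in> space (B \<Otimes>\<^sub>M fibre). fst p \<in> C \<and> snd (U p) \<in> D}"
    have E [measurable]: "E \<in> sets (B \<Otimes>\<^sub>M fibre)" unfolding E_def by measurable
    have spU: "snd (U (m, s)) \<in> fibre_set" if "m \<in> space B" "s \<in> fibre_set" for m s
      using measurable_space[OF U_meas', of "(m, s)"] that by (auto simp: space_pair_measure space_fibre)
    have "(\<integral>\<^sup>+ m. emeasure (distr (K m) fibre (\<lambda>s. snd (U (m, s)))) D * indicator C m \<partial>distr \<kappa> B fst) =
        (\<integral>\<^sup>+ m. emeasure (K m) (Pair m -` E) \<partial>distr \<kappa> B fst)"
    proof (rule nn_integral_cong)
      fix m assume "m \<in> space (distr \<kappa> B fst)"
      then have m: "m \<in> space B" by simp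
      have meas: "(\<lambda>s. snd (U (m, s))) \<in> K m \<rightarrow>\<^sub>M fibre"
        using m kernel_sets[OF KK(1) m] by (simp cong: measurable_cong_sets)
      show "emeasure (distr (K m) fibre (\<lambda>s. snd (U (m, s)))) D * indicator C m = emeasure (K m) (Pair m -` E)"
      proof (cases "m \<in> C")
        case True
        then have "Pair m -` E = (\<lambda>s. snd (U (m, s))) -` D \<inter> space (K m)"
          using m kernel_space[OF KK(1) m] by (auto simp: E_def space_pair_measure)
        then show ?thesis using True by (simp add: emeasure_distr[OF meas D])
      next
        case False
        then have "Pair m -` E = {}" by (auto simp: E_def)
        then show ?thesis using False by simp
      qed
    qed
    also have "\<dots> = emeasure \<kappa> E"
      using K E by (simp add: disintegration_def)
    \<comment> \<open>The left set tests the base point of \<open>p\<close>, the right one that of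
      \<open>U p\<close>; the two agree almost everywhere.\<close>
    also have "\<dots> = emeasure \<kappa> (U -` (C \<times> D) \<inter> space \<kappa>)"
    proof (rule emeasure_eq_AE)
      have CD: "C \<times> D \<in> sets \<kappa>'" by (simp add: sets)
      show "E \<in> sets \<kappa>" "U -` (C \<times> D) \<inter> space \<kappa> \<in> sets \<kappa>"
        using E sets measurable_sets[OF U_meas CD] by auto
      show "AE p in \<kappa>. p \<in> E \<longleftrightarrow> p \<in> U -` (C \<times> D) \<inter> space \<kappa>"
        using fib AE_space
      proof eventually_elim
        case (elim p)
        then show ?case
          using sets_eq_imp_space_eq[OF sets(1)] by (auto simp: E_def mem_Times_iff)
      qed
    qed
    also have "\<dots> = emeasure \<kappa>' (C \<times> D)"
      by (subst invertible_mp_distr[OF U, symmetric], subst emeasure_distr) (auto simp: sets)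
    also have "\<dots> = (\<integral>\<^sup>+ m. emeasure (K' m) (Pair m -` (C \<times> D)) \<partial>distr \<kappa> B fst)"
      using K' M' by (simp add: disintegration_def)
    also have "\<dots> = (\<integral>\<^sup>+ m. emeasure (K' m) D * indicator C m \<partial>distr \<kappa> B fst)"
      by (intro nn_integral_cong) (auto simp: indicator_def)
    finally show "(\<integral>\<^sup>+ m. emeasure (distr (K m) fibre (\<lambda>s. snd (U (m, s)))) D * indicator C m \<partial>distr \<kappa> B fst) =
      (\<integral>\<^sup>+ m. emeasure (K' m) D * indicator C m \<partial>distr \<kappa> B fst)" .
  qed simp
qed

text \<open>On almost every fibre, the fibre component of \<open>U\<close> maps \<open>K m\<close>
  onto \<open>K' m\<close> and has a left inverse almost everywhere, which is the situation of
  \<open>suitable_fibre_atoms_le\<close>.\<close>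

lemma fibred_isomorphism_atoms_le:
  fixes B :: "'m measure"
  assumes sets: "sets \<kappa> = sets (B \<Otimes>\<^sub>M fibre)" "sets \<kappa>' = sets (B \<Otimes>\<^sub>M fibre)"
    and prob: "prob_space \<kappa>"
    and K: "disintegration B fibre \<kappa> K" "AE m in distr \<kappa> B fst. suitable_fibre_measure (K m)"
    and K': "disintegration B fibre \<kappa>' K'" "AE m in distr \<kappa>' B fst. suitable_fibre_measure (K' m)"
    and U: "invertible_mp \<kappa> \<kappa>' U" and fib: "AE x in \<kappa>. fst (U x) = fst x"
  shows "AE m in distr \<kappa> B fst. \<forall>n\<ge>1. emeasure (K m) {1 + 1 / real n} \<le> emeasure (K' m) {1 + 1 / real n}"
proof -
  note kernels = fibred_map_kernels[OF sets prob K(1) K'(1) U fib]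
  obtain R where R: "AE x in \<kappa>. R (U x) = x" using invertible_mp_sym[OF U] by metis
  have KK: "K \<in> B \<rightarrow>\<^sub>M prob_algebra fibre" "K' \<in> B \<rightarrow>\<^sub>M prob_algebra fibre"
    using K K' by (auto simp: disintegration_def)
  have U_meas' [measurable]: "U \<in> B \<Otimes>\<^sub>M fibre \<rightarrow>\<^sub>M B \<Otimes>\<^sub>M fibre"
    using invertible_mp_measurable[OF U] measurable_cong_sets[OF sets] by simp
  \<comment> \<open>Replacing the base point of \<open>U x\<close> by that of \<open>x\<close> turns
    the global inverse into an inverse within each fibre.\<close>
  have "AE x in \<kappa>. R (fst x, snd (U x)) = x"
    using R fib by eventually_elim (metis prod.collapse)
  from disintegration_AE[OF K(1) sets(1) this]
  have "AE m in distr \<kappa> B fst. AE s in K m. R (m, snd (U (m, s))) = (m, s)" by simp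
  moreover have "AE m in distr \<kappa> B fst. suitable_fibre_measure (K' m)"
    using K'(2) unfolding kernels(1) .
  ultimately show ?thesis
    using kernels(2) K(2) AE_space
  proof eventually_elim
    case (elim m)
    then have m: "m \<in> space B" by simp
    note sK = kernel_sets[OF KK(1) m] kernel_sets[OF KK(2) m]
    have u: "(\<lambda>s. snd (U (m, s))) \<in> K m \<rightarrow>\<^sub>M K' m"
      using m sK by (simp cong: measurable_cong_sets)
    have "distr (K m) (K' m) (\<lambda>s. snd (U (m, s))) = K' m"
      using elim(3) distr_cong[of "K m" "K m" "K' m" fibre "\<lambda>s. snd (U (m, s))"] sK by simp
    moreover have "AE s in K m. snd (R (m, snd (U (m, s)))) = s"
      using elim(1) by eventually_elim simp
    ultimately show ?case
      using suitable_fibre_atoms_le[OF elim(4) sK(1) elim(2) sK(2) u, of "\<lambda>s. snd (R (m, s))"] by blast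
  qed
qed

text \<open>The inequality of atom masses is applied to the isomorphism and to its inverse, so
  almost all conditional measures coincide; the base marginals are equal as well, since base points
  are preserved.\<close>

lemma suitable_fibred_isomorphism_eq:
  assumes \<kappa>: "suitable A \<kappa>" and \<kappa>': "suitable A \<kappa>'"
    and U: "invertible_mp \<kappa> \<kappa>' U" and fib: "AE x in \<kappa>. fst (U x) = fst x"
  shows "\<kappa> = \<kappa>'"
proof -
  define B where "B = prob_algebra A"
  have sets: "sets \<kappa> = sets (B \<Otimes>\<^sub>M fibre)" "sets \<kappa>' = sets (B \<Otimes>\<^sub>M fibre)"
    and prob: "prob_space \<kappa>" "prob_space \<kappa>'"
    using \<kappa> \<kappa>' by (auto simp: suitable_iff_disintegration B_def Meas_def)
  obtain K where K: "disintegration B fibre \<kappa> K" "AE m in distr \<kappa> B fst. suitable_fibre_measure (K m)"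
    using \<kappa> unfolding suitable_iff_disintegration B_def by blast
  obtain K' where K': "disintegration B fibre \<kappa>' K'" "AE m in distr \<kappa>' B fst. suitable_fibre_measure (K' m)"
    using \<kappa>' unfolding suitable_iff_disintegration B_def by blast
  have KK: "K \<in> B \<rightarrow>\<^sub>M prob_algebra fibre" "K' \<in> B \<rightarrow>\<^sub>M prob_algebra fibre"
    using K K' by (auto simp: disintegration_def)
  note kernels = fibred_map_kernels[OF sets prob(1) K(1) K'(1) U fib]
  obtain R where R: "invertible_mp \<kappa>' \<kappa> R" "AE y in \<kappa>'. U (R y) = y"
    using invertible_mp_sym[OF U] by metis
  have fibR: "AE y in \<kappa>'. fst (R y) = fst y"
    using R(2) invertible_mp_AE[OF R(1) fib] by eventually_elim simp
  have "AE m in distr \<kappa> B fst. \<forall>n\<ge>1. emeasure (K' m) {1 + 1 / real n} \<le> emeasure (K m) {1 + 1 / real n}"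
    using fibred_isomorphism_atoms_le[OF sets(2,1) prob(2) K' K R(1) fibR] unfolding kernels(1) .
  then have "AE m in distr \<kappa> B fst. K m = K' m"
    using fibred_isomorphism_atoms_le[OF sets prob(1) K K' U fib] K(2) K'(2)[unfolded kernels(1)] AE_space
  proof eventually_elim
    case (elim m)
    then have m: "m \<in> space B" by simp
    show ?case
      using elim(1-4) kernel_sets[OF KK(1) m] kernel_sets[OF KK(2) m]
        kernel_prob_space[OF KK(1) m] kernel_prob_space[OF KK(2) m]
      by (intro suitable_fibre_measure_eqI) (auto intro: antisym)
  qed
  then have eq: "AE m in distr \<kappa> B fst. emeasure (K m) (Pair m -` E) = emeasure (K' m) (Pair m -` E)" for E
    by eventually_elim simp
  show ?thesis
  proof (rule measure_eqI)
    fix E assume "E \<in> sets \<kappa>"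
    then show "emeasure \<kappa> E = emeasure \<kappa>' E"
      using K(1) K'(1) sets nn_integral_cong_AE[OF eq, of E] unfolding disintegration_def kernels(1) by simp
  qed (simp add: sets)
qed

subsection \<open>Canonical images\<close>

lemma distr_left_inverse:
  assumes [measurable]: "f \<in> M \<rightarrow>\<^sub>M N" "g \<in> N \<rightarrow>\<^sub>M M" and inv: "AE x in M. g (f x) = x"
  shows "distr (distr M N f) M g = M"
proof -
  have "distr (distr M N f) M g = distr M M (g \<circ> f)" by (rule distr_distr) measurable
  also have "\<dots> = distr M M (\<lambda>x. x)"
    using inv by (intro distr_cong_AE) (auto simp: comp_def)
  finally show ?thesis by simp
qed

section \<open>Measurability of the diagonals\<close>

lemma countable_intersection_measurable:
  assumes "\<And>q. q \<in> \<rat> \<Longrightarrow> {p \<in> space M. P (q::real) p} \<in> sets M"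
  shows "{p \<in> space M. \<forall>q\<in>\<rat>. P q p} \<in> sets M"
  by (rule sets.sets_Collect_countable_All'[OF assms countable_rat])

text \<open>After coding \<open>A\<close> by real numbers, a measure on \<open>A\<close> is
  determined by its values on the preimages of rational half-lines. Equality of two measures is
  therefore a countable conjunction of measurable conditions.\<close>

lemma prob_algebra_diagonal_measurable:
  assumes "standard_borel A"
  shows "{p \<in> space (prob_algebra A \<Otimes>\<^sub>M prob_algebra A). fst p = snd p} \<in> sets (prob_algebra A \<Otimes>\<^sub>M prob_algebra A)"
proof (cases "space A = {}")
  case True
  \<comment> \<open>The coding needs a point of \<open>A\<close>; over an empty space there are no
    probability measures, so the diagonal is empty too.\<close>
  have "space (prob_algebra A) = {}"
  proof -
    have False if "sets m = sets A" "prob_space m" for m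
      using prob_space.not_empty[OF that(2)] sets_eq_imp_space_eq[OF that(1)] True by simp
    then show ?thesis by (auto simp: space_prob_algebra)
  qed
  then have "space (prob_algebra A \<Otimes>\<^sub>M prob_algebra A) = {}"
    by (simp add: space_pair_measure)
  then show ?thesis by simp
next
  case False
  obtain \<phi> :: "'a \<Rightarrow> real" and R where \<phi>: "\<phi> \<in> A \<rightarrow>\<^sub>M borel" "R \<in> borel \<rightarrow>\<^sub>M A" "\<And>x. x \<in> space A \<Longrightarrow> R (\<phi> x) = x"
    using standard_borel_coding[OF assms False] by metis
  define E where "E q = \<phi> -` {q<..} \<inter> space A" for q
  have E [measurable]: "E q \<in> sets A" for q
    unfolding E_def using \<phi>(1) by measurable
  have "m = m' \<longleftrightarrow> (\<forall>q\<in>\<rat>. measure m (E q) = measure m' (E q))"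
    if m: "m \<in> space (prob_algebra A)" and m': "m' \<in> space (prob_algebra A)" for m m'
  proof
    assume eq: "\<forall>q\<in>\<rat>. measure m (E q) = measure m' (E q)"
    interpret m: prob_space m using m by (simp add: space_prob_algebra)
    interpret m': prob_space m' using m' by (simp add: space_prob_algebra)
    have sm: "sets m = sets A" "sets m' = sets A" using m m' by (simp_all add: space_prob_algebra)
    note spm = sets_eq_imp_space_eq[OF sm(1)] sets_eq_imp_space_eq[OF sm(2)]
    have \<phi>m: "\<phi> \<in> m \<rightarrow>\<^sub>M borel" "\<phi> \<in> m' \<rightarrow>\<^sub>M borel"
      using \<phi>(1) measurable_cong_sets[OF sm(1) refl] measurable_cong_sets[OF sm(2) refl] by auto
    have "distr m borel \<phi> = distr m' borel \<phi>"
    proof (rule measure_eqI_rational)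
      show "finite_measure (distr m borel \<phi>)"
        by (rule prob_space.finite_measure) (rule m.prob_space_distr[OF \<phi>m(1)])
      show "emeasure (distr m borel \<phi>) {q<..} = emeasure (distr m' borel \<phi>) {q<..}" if "q \<in> \<rat>" for q
        using eq that by (simp add: emeasure_distr \<phi>m spm E_def[symmetric] m.emeasure_eq_measure m'.emeasure_eq_measure)
    qed simp_all
    then have "distr (distr m borel \<phi>) A R = distr (distr m' borel \<phi>) A R" by simp
    moreover have "distr (distr l borel \<phi>) A R = l" if "sets l = sets A" "\<phi> \<in> l \<rightarrow>\<^sub>M borel" for l
    proof -
      have "distr (distr l borel \<phi>) A R = distr (distr l borel \<phi>) l R"
        using that(1) by (intro distr_cong) auto
      also have "\<dots> = l"
      proof (rule distr_left_inverse[OF that(2)])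
        show "R \<in> borel \<rightarrow>\<^sub>M l" using \<phi>(2) measurable_cong_sets[OF refl that(1)] by blast
        show "AE x in l. R (\<phi> x) = x" using \<phi>(3) sets_eq_imp_space_eq[OF that(1)] by (intro AE_I2) simp
      qed
      finally show ?thesis .
    qed
    ultimately show "m = m'" using sm \<phi>m by metis
  qed simp
  then have "{p \<in> space (prob_algebra A \<Otimes>\<^sub>M prob_algebra A). fst p = snd p} =
      {p \<in> space (prob_algebra A \<Otimes>\<^sub>M prob_algebra A). \<forall>q\<in>\<rat>. measure (fst p) (E q) = measure (snd p) (E q)}"
    by (auto simp: space_pair_measure)
  also have "\<dots> \<in> sets (prob_algebra A \<Otimes>\<^sub>M prob_algebra A)"
    by (rule countable_intersection_measurable) measurable
  finally show ?thesis .
qed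

lemma Meas_diagonal_measurable:
  assumes "standard_borel A"
  shows "{p \<in> space (Meas A \<Otimes>\<^sub>M Meas A). fst p = snd p} \<in> sets (Meas A \<Otimes>\<^sub>M Meas A)"
proof -
  let ?M = "Meas A \<Otimes>\<^sub>M Meas A" and ?B = "prob_algebra A"
  have m [measurable]: "fst \<in> Meas A \<rightarrow>\<^sub>M ?B" "snd \<in> Meas A \<rightarrow>\<^sub>M fibre"
    by (simp_all add: Meas_def)
  have "(\<lambda>p. (fst (fst p), fst (snd p))) \<in> ?M \<rightarrow>\<^sub>M ?B \<Otimes>\<^sub>M ?B" by measurable
  from measurable_sets[OF this prob_algebra_diagonal_measurable[OF assms]]
  have "(\<lambda>p. (fst (fst p), fst (snd p))) -` {p \<in> space (?B \<Otimes>\<^sub>M ?B). fst p = snd p} \<inter> space ?M \<in> sets ?M" .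
  also have "(\<lambda>p. (fst (fst p), fst (snd p))) -` {p \<in> space (?B \<Otimes>\<^sub>M ?B). fst p = snd p} \<inter> space ?M =
      {p \<in> space ?M. fst (fst p) = fst (snd p)}"
    by (auto simp: space_pair_measure Meas_def)
  finally have 1: "{p \<in> space ?M. fst (fst p) = fst (snd p)} \<in> sets ?M" .
  have [measurable]: "(\<lambda>p. snd (fst p)) \<in> borel_measurable ?M" "(\<lambda>p. snd (snd p)) \<in> borel_measurable ?M"
    using measurable_compose[OF measurable_compose[OF measurable_fst m(2)] id_fibre_borel, of "Meas A"]
      measurable_compose[OF measurable_compose[OF measurable_snd m(2)] id_fibre_borel, of "Meas A"] by simp_all
  have 2: "{p \<in> space ?M. snd (fst p) = snd (snd p)} \<in> sets ?M"
    by measurable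
  have "{p \<in> space ?M. fst p = snd p} =
      {p \<in> space ?M. fst (fst p) = fst (snd p)} \<inter> {p \<in> space ?M. snd (fst p) = snd (snd p)}"
    by (auto simp: prod_eq_iff)
  then show ?thesis using 1 2 by simp
qed

section \<open>Realising a Lebesgue space by a suitable measure\<close>

lemma suitable_realisation_real:
  fixes \<mu> :: "real measure"
  assumes A: "standard_borel A" and "prob_space \<mu>" and sets: "sets \<mu> = sets borel"
    and unit: "AE x in \<mu>. x \<in> {0..1}" and p: "p \<in> borel \<rightarrow>\<^sub>M prob_algebra A"
  shows "\<exists>\<kappa> T. suitable A \<kappa> \<and> invertible_mp \<mu> \<kappa> T \<and> (\<forall>x. fst (T x) = p x)"
proof -
  interpret prob_space \<mu> by fact
  note [measurable_cong] = sets
  note [measurable] = p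
  define B where "B = prob_algebra A"
  have pB [measurable]: "p \<in> borel \<rightarrow>\<^sub>M B" using p by (simp add: B_def)
  \<comment> \<open>The graph of \<open>p\<close> with the value of \<open>p\<close> as base point:
    its conditional measures are those of \<open>\<mu>\<close> given \<open>p\<close>, all living on
    the same line.\<close>
  define J where "J = distr \<mu> (B \<Otimes>\<^sub>M borel) (\<lambda>x. (p x, x))"
  have px [measurable]: "(\<lambda>x. (p x, x)) \<in> \<mu> \<rightarrow>\<^sub>M B \<Otimes>\<^sub>M borel" by measurable
  have J: "prob_space J" "sets J = sets (B \<Otimes>\<^sub>M borel)"
    unfolding J_def by (rule prob_space_distr[OF px]) simp
  have "AE x in J. snd x \<in> {0..1}"
    unfolding J_def using unit by (subst AE_distr_iff) auto
  then obtain Q where Q: "disintegration B borel J Q"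
    using disintegration_exists[OF J] by blast
  have QK [measurable]: "Q \<in> B \<rightarrow>\<^sub>M prob_algebra borel" using Q by (simp add: disintegration_def)
  define t where "t m x = fibre_coordinate (Q m) x" for m x
  have t [measurable]: "(\<lambda>(m, x). t m x) \<in> B \<Otimes>\<^sub>M borel \<rightarrow>\<^sub>M fibre"
    unfolding t_def by (rule measurable_fibre_coordinate[OF QK])
  have t' [measurable]: "(\<lambda>x. t (f x) (g x)) \<in> M \<rightarrow>\<^sub>M fibre"
    if "f \<in> M \<rightarrow>\<^sub>M B" "g \<in> borel_measurable M" for f g and M :: "'c measure"
    using measurable_compose[OF measurable_Pair[OF that] t] by simp
  obtain X0 where X0 [measurable]: "X0 \<in> sets (B \<Otimes>\<^sub>M borel)"
    and X0_AE: "\<And>m. m \<in> space B \<Longrightarrow> AE x in Q m. (m, x) \<in> X0"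
    and X0_inj: "\<And>m x x'. m \<in> space B \<Longrightarrow> (m, x) \<in> X0 \<Longrightarrow> (m, x') \<in> X0 \<Longrightarrow> t m x = t m x' \<Longrightarrow> x = x'"
    using fibre_coordinate_injectivity_set[OF QK] unfolding t_def by blast
  \<comment> \<open>The value \<open>p x\<close> together with the coordinate of \<open>x\<close> in
    the conditional measure over that value. The pair determines \<open>x\<close> on the conull set
    where \<open>(p x, x)\<close> lies in \<open>X0\<close>.\<close>
  define T where "T x = (p x, t (p x) x)" for x
  have T [measurable]: "T \<in> borel \<rightarrow>\<^sub>M B \<Otimes>\<^sub>M fibre" unfolding T_def by measurable
  have Meas: "Meas A = B \<Otimes>\<^sub>M fibre" by (simp add: Meas_def B_def)
  define \<kappa> where "\<kappa> = distr \<mu> (B \<Otimes>\<^sub>M fibre) T"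
  have T\<mu>: "T \<in> \<mu> \<rightarrow>\<^sub>M B \<Otimes>\<^sub>M fibre" by measurable
  have \<kappa>: "prob_space \<kappa>" "sets \<kappa> = sets (B \<Otimes>\<^sub>M fibre)"
    unfolding \<kappa>_def by (rule prob_space_distr[OF T\<mu>]) simp
  have "invertible_mp \<mu> \<kappa> T"
    unfolding \<kappa>_def
  proof (rule invertible_mp_inj_on[OF \<open>prob_space \<mu>\<close> sets unit T])
    show "{p \<in> space ((B \<Otimes>\<^sub>M fibre) \<Otimes>\<^sub>M B \<Otimes>\<^sub>M fibre). fst p = snd p} \<in> sets ((B \<Otimes>\<^sub>M fibre) \<Otimes>\<^sub>M B \<Otimes>\<^sub>M fibre)"
      using Meas_diagonal_measurable[OF A] by (simp add: Meas)
    show "{x \<in> space borel. (p x, x) \<in> X0} \<in> sets borel" by measurable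
    have "{p \<in> space (B \<Otimes>\<^sub>M borel). p \<in> X0} = X0"
      using sets.sets_into_space[OF X0] by auto
    moreover have "AE m in distr J B fst. AE x in Q m. (m, x) \<in> X0"
      by (rule AE_I2) (simp add: X0_AE)
    ultimately have "AE p in J. p \<in> X0"
      using disintegration_AE_iff[OF Q J(2), of "\<lambda>p. p \<in> X0"] by (simp add: X0)
    then have "AE x in \<mu>. (p x, x) \<in> X0"
      unfolding J_def by (rule AE_distrD[rotated]) simp
    then show "AE x in \<mu>. x \<in> {x \<in> space borel. (p x, x) \<in> X0}" by simp
    show "inj_on T {x \<in> space borel. (p x, x) \<in> X0}"
    proof (rule inj_onI)
      fix x x' assume "x \<in> {x \<in> space borel. (p x, x) \<in> X0}" "x' \<in> {x \<in> space borel. (p x, x) \<in> X0}" "T x = T x'"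
      then show "x = x'"
        using X0_inj[of "p x" x x'] measurable_space[OF pB, of x] by (auto simp: T_def)
    qed
  qed
  moreover have "suitable A \<kappa>"
    unfolding suitable_iff_disintegration Meas B_def[symmetric]
  proof (intro conjI \<kappa> exI)
    let ?K = "\<lambda>m. distr (Q m) fibre (t m)"
    have K: "?K \<in> B \<rightarrow>\<^sub>M prob_algebra fibre"
      by (rule measurable_distr_prob_space2[OF QK t])
    have fst\<kappa>: "distr \<kappa> B fst = distr J B fst"
      unfolding \<kappa>_def J_def by (simp add: distr_distr comp_def T_def)
    show "disintegration B fibre \<kappa> ?K"
      unfolding disintegration_def
    proof (intro conjI K ballI)
      fix E assume E [measurable]: "E \<in> sets (B \<Otimes>\<^sub>M fibre)"
      \<comment> \<open>The preimage of \<open>E\<close> under replacing the line point by its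
        coordinate; it reduces the disintegration of \<open>\<kappa>\<close> to that of
        \<open>J\<close>.\<close>
      define E' where "E' = {p \<in> space (B \<Otimes>\<^sub>M borel). (fst p, t (fst p) (snd p)) \<in> E}"
      have E' [measurable]: "E' \<in> sets (B \<Otimes>\<^sub>M borel)" unfolding E'_def by measurable
      have "emeasure \<kappa> E = emeasure \<mu> (T -` E \<inter> space \<mu>)"
        unfolding \<kappa>_def by (rule emeasure_distr) auto
      also have "T -` E \<inter> space \<mu> = (\<lambda>x. (p x, x)) -` E' \<inter> space \<mu>"
        using measurable_space[OF pB] sets_eq_imp_space_eq[OF sets] by (auto simp: E'_def T_def space_pair_measure)
      also have "emeasure \<mu> \<dots> = emeasure J E'"
        unfolding J_def by (rule emeasure_distr[symmetric]) auto
      also have "\<dots> = (\<integral>\<^sup>+ m. emeasure (Q m) (Pair m -` E') \<partial>distr J B fst)"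
        using Q E' by (simp add: disintegration_def)
      also have "\<dots> = (\<integral>\<^sup>+ m. emeasure (?K m) (Pair m -` E) \<partial>distr J B fst)"
      proof (rule nn_integral_cong)
        fix m assume "m \<in> space (distr J B fst)"
        then have m: "m \<in> space B" by simp
        have tm: "t m \<in> Q m \<rightarrow>\<^sub>M fibre"
          using m kernel_sets[OF QK m] measurable_compose_Pair1[OF m t] by (simp cong: measurable_cong_sets)
        have "emeasure (?K m) (Pair m -` E) = emeasure (Q m) (t m -` (Pair m -` E) \<inter> space (Q m))"
          by (rule emeasure_distr[OF tm sets_Pair1[OF E]])
        also have "t m -` (Pair m -` E) \<inter> space (Q m) = Pair m -` E'"
          using m kernel_space[OF QK m] by (auto simp: E'_def space_pair_measure)
        finally show "emeasure (Q m) (Pair m -` E') = emeasure (?K m) (Pair m -` E)" by simp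
      qed
      finally show "emeasure \<kappa> E = (\<integral>\<^sup>+ m. emeasure (?K m) (Pair m -` E) \<partial>distr \<kappa> B fst)"
        unfolding fst\<kappa> .
    qed
    show "AE m in distr \<kappa> B fst. suitable_fibre_measure (?K m)"
    proof (rule AE_I2)
      fix m assume "m \<in> space (distr \<kappa> B fst)"
      then show "suitable_fibre_measure (?K m)"
        using real_distribution.suitable_fibre_coordinate[OF kernel_real_distribution[OF QK, of m]]
        by (simp add: t_def[abs_def])
    qed
  qed
  ultimately show ?thesis by (intro exI[of _ \<kappa>] exI[of _ T]) (auto simp: T_def)
qed

text \<open>Reduction to the line: the code \<open>\<phi>\<close> is an isomorphism mod 0 onto its
  image measure, and \<open>p\<close> is read on the line as the composite of \<open>p\<close> with
  the decoder \<open>R\<close>.\<close>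

lemma suitable_realisation:
  assumes A: "standard_borel A" and \<mu>: "lebesgue_space \<mu>" and p [measurable]: "p \<in> \<mu> \<rightarrow>\<^sub>M prob_algebra A"
  shows "\<exists>\<kappa> T. suitable A \<kappa> \<and> invertible_mp \<mu> \<kappa> T \<and> (\<forall>x\<in>space \<mu>. fst (T x) = p x)"
proof -
  interpret prob_space \<mu> using \<mu> by (simp add: lebesgue_space_def)
  obtain \<phi> R where \<phi> [measurable]: "\<phi> \<in> \<mu> \<rightarrow>\<^sub>M (borel :: real measure)" and unit: "\<And>x. \<phi> x \<in> {0..1}"
    and R [measurable]: "R \<in> borel \<rightarrow>\<^sub>M \<mu>" and R\<phi>: "\<And>x. x \<in> space \<mu> \<Longrightarrow> R (\<phi> x) = x"
    using standard_borel_coding[of \<mu>] \<mu> not_empty unfolding lebesgue_space_def by metis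
  define \<mu>' where "\<mu>' = distr \<mu> borel \<phi>"
  have "invertible_mp \<mu> \<mu>' \<phi>"
    unfolding invertible_mp_def
  proof (intro conjI exI[of _ R])
    show "distr \<mu> \<mu>' \<phi> = \<mu>'" unfolding \<mu>'_def by (rule distr_cong) auto
    show "distr \<mu>' \<mu> R = \<mu>"
      unfolding \<mu>'_def using R\<phi> by (intro distr_left_inverse) auto
    show "AE x in \<mu>. R (\<phi> x) = x" using R\<phi> by simp
    show "AE y in \<mu>'. \<phi> (R y) = y"
      unfolding \<mu>'_def by (subst AE_distr_iff) (auto simp: R\<phi>)
  qed (auto simp: \<mu>'_def)
  moreover have "\<exists>\<kappa> T. suitable A \<kappa> \<and> invertible_mp \<mu>' \<kappa> T \<and> (\<forall>x. fst (T x) = p (R x))"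
  proof (rule suitable_realisation_real[OF A])
    show "prob_space \<mu>'" unfolding \<mu>'_def by (rule prob_space_distr) simp
    show "AE x in \<mu>'. x \<in> {0..1}" unfolding \<mu>'_def using unit by (subst AE_distr_iff) auto
  qed (auto simp: \<mu>'_def)
  then obtain \<kappa> T where "suitable A \<kappa>" "invertible_mp \<mu>' \<kappa> T" "\<And>x. fst (T x) = p (R x)" by blast
  ultimately show ?thesis
    using invertible_mp_trans[of \<mu> \<mu>' \<phi> \<kappa> T] R\<phi> by (intro exI[of _ \<kappa>] exI[of _ "\<lambda>x. T (\<phi> x)"]) simp
qed

section \<open>Transport along isomorphisms; uniqueness and existence of canonical images\<close>

lemma AE_pair_invertible_mp:
  assumes "prob_space M'" "prob_space N'" and T: "invertible_mp M M' T" and S: "invertible_mp N N' S"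
    and P: "AE p in M' \<Otimes>\<^sub>M N'. P (fst p) (snd p)"
  shows "AE p in M \<Otimes>\<^sub>M N. P (T (fst p)) (S (snd p))"
proof -
  have TS: "T \<in> M \<rightarrow>\<^sub>M M'" "S \<in> N \<rightarrow>\<^sub>M N'"
    using T S by (auto intro: invertible_mp_measurable)
  have "sigma_finite_measure (distr N N' S)"
    using assms(2) by (simp add: invertible_mp_distr[OF S] prob_space_imp_sigma_finite)
  from pair_measure_distr[OF TS this]
  have d: "M' \<Otimes>\<^sub>M N' = distr (M \<Otimes>\<^sub>M N) (M' \<Otimes>\<^sub>M N') (\<lambda>(x, y). (T x, S y))"
    by (simp add: invertible_mp_distr[OF T] invertible_mp_distr[OF S])
  have "(\<lambda>(x, y). (T x, S y)) \<in> M \<Otimes>\<^sub>M N \<rightarrow>\<^sub>M M' \<Otimes>\<^sub>M N'" using TS by measurable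
  from AE_distrD[OF this P[unfolded d[THEN arg_cong, of ae_filter]]]
  show ?thesis by (simp add: split_beta')
qed

lemma AE_pair_swap:
  assumes "prob_space M" "prob_space N" "AE p in M \<Otimes>\<^sub>M N. P (fst p) (snd p)"
  shows "AE p in N \<Otimes>\<^sub>M M. P (snd p) (fst p)"
proof -
  interpret pair_sigma_finite M N
    using assms(1,2) by (simp add: pair_sigma_finite_def prob_space_imp_sigma_finite)
  have "AE p in distr (N \<Otimes>\<^sub>M M) (M \<Otimes>\<^sub>M N) (\<lambda>(x, y). (y, x)). P (fst p) (snd p)"
    by (subst distr_pair_swap[symmetric]) (rule assms(3))
  from AE_distrD[OF measurable_pair_swap' this] show ?thesis by (simp add: split_beta')
qed

lemma AE_pair_fst_snd:
  assumes "prob_space M" "prob_space N" "AE x in M. P x" "AE y in N. Q y"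
  shows "AE p in M \<Otimes>\<^sub>M N. P (fst p) \<and> Q (snd p)"
proof -
  interpret M: prob_space M by fact
  interpret N: prob_space N by fact
  have "AE p in M \<Otimes>\<^sub>M N. P (fst p)"
    by (rule AE_distrD[OF measurable_fst]) (unfold N.distr_pair_fst, rule assms(3))
  moreover have "AE p in N \<Otimes>\<^sub>M M. Q (fst p)"
    by (rule AE_distrD[OF measurable_fst]) (unfold M.distr_pair_fst, rule assms(4))
  then have "AE p in M \<Otimes>\<^sub>M N. Q (snd p)"
    using AE_pair_swap[OF assms(2,1), of "\<lambda>y x. Q y"] by simp
  ultimately show ?thesis by eventually_elim simp
qed

text \<open>By tautology the base component of \<open>T x\<close> is the law of the section of
  \<open>F\<close> at \<open>T x\<close>. Pulled back along \<open>S\<close>, this is the law of the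
  section of \<open>f\<close> at \<open>x\<close>, so it depends neither on \<open>F\<close> nor on
  the choice of the isomorphisms.\<close>

lemma fst_of_tautological:
  assumes \<nu>: "prob_space \<nu>" and \<mu>: "prob_space \<mu>"
    and T: "invertible_mp \<mu> \<kappa> T" and S: "invertible_mp \<nu> \<kappa>' S"
    and F: "F \<in> \<kappa> \<Otimes>\<^sub>M \<kappa>' \<rightarrow>\<^sub>M A" and f: "f \<in> \<mu> \<Otimes>\<^sub>M \<nu> \<rightarrow>\<^sub>M A"
    and eq: "AE p in \<mu> \<Otimes>\<^sub>M \<nu>. F (T (fst p), S (snd p)) = f p"
    and taut: "AE x in \<kappa>. distr \<kappa>' A (\<lambda>y. F (x, y)) = fst x"
  shows "AE x in \<mu>. fst (T x) = distr \<nu> A (\<lambda>y. f (x, y))"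
proof -
  interpret pair_sigma_finite \<mu> \<nu>
    using \<mu> \<nu> by (simp add: pair_sigma_finite_def prob_space_imp_sigma_finite)
  have TS [measurable]: "T \<in> \<mu> \<rightarrow>\<^sub>M \<kappa>" "S \<in> \<nu> \<rightarrow>\<^sub>M \<kappa>'"
    using T S by (auto intro: invertible_mp_measurable)
  note [measurable] = F f
  have "AE x in \<mu>. AE y in \<nu>. F (T x, S y) = f (x, y)"
    using AE_pair[OF eq] by simp
  then show ?thesis
    using invertible_mp_AE[OF T taut] AE_space
  proof eventually_elim
    case (elim x)
    have x: "T x \<in> space \<kappa>" using elim(3) measurable_space[OF TS(1)] by blast
    have "fst (T x) = distr (distr \<nu> \<kappa>' S) A (\<lambda>y. F (T x, y))"
      using elim(2) invertible_mp_distr[OF S] by simp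
    also have "\<dots> = distr \<nu> A (\<lambda>y. F (T x, S y))"
      using x by (subst distr_distr) (auto simp: comp_def)
    also have "\<dots> = distr \<nu> A (\<lambda>y. f (x, y))"
      using elim(1,3) x by (intro distr_cong_AE) auto
    finally show ?case .
  qed
qed

lemma suitable_prob_space: "suitable A \<kappa> \<Longrightarrow> prob_space \<kappa>"
  by (simp add: suitable_def)

lemma canonical_image_coordinates:
  assumes \<mu>: "prob_space \<mu>" and \<nu>: "prob_space \<nu>" and f: "f \<in> \<mu> \<Otimes>\<^sub>M \<nu> \<rightarrow>\<^sub>M A"
    and C: "canonical_image A \<mu> \<nu> f \<kappa> \<kappa>' F"
  obtains T S where "invertible_mp \<mu> \<kappa> T" "invertible_mp \<nu> \<kappa>' S"
    "AE p in \<mu> \<Otimes>\<^sub>M \<nu>. F (T (fst p), S (snd p)) = f p"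
    "AE x in \<mu>. fst (T x) = distr \<nu> A (\<lambda>y. f (x, y))"
    "AE y in \<nu>. fst (S y) = distr \<mu> A (\<lambda>x. f (x, y))"
proof -
  obtain T S where TS: "invertible_mp \<mu> \<kappa> T" "invertible_mp \<nu> \<kappa>' S"
      and eq: "AE p in \<mu> \<Otimes>\<^sub>M \<nu>. F (T (fst p), S (snd p)) = f p"
    using C unfolding canonical_image_def equivalent_functions_def by blast
  have F: "F \<in> \<kappa> \<Otimes>\<^sub>M \<kappa>' \<rightarrow>\<^sub>M A" and taut: "AE x in \<kappa>. distr \<kappa>' A (\<lambda>y. F (x, y)) = fst x"
      "AE y in \<kappa>'. distr \<kappa> A (\<lambda>x. F (x, y)) = fst y"
    using C by (auto simp: canonical_image_def tautological_def)
  \<comment> \<open>The second coordinate is handled by exchanging the two factors and applying the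
    same lemma to the transposed functions.\<close>
  have swap: "AE p in \<nu> \<Otimes>\<^sub>M \<mu>. F (T (snd p), S (fst p)) = f (snd p, fst p)"
    using AE_pair_swap[OF \<mu> \<nu>, of "\<lambda>x y. F (T x, S y) = f (x, y)"] eq by simp
  have "AE y in \<nu>. fst (S y) = distr \<mu> A (\<lambda>x. (\<lambda>p. f (snd p, fst p)) (y, x))"
  proof (rule fst_of_tautological[OF \<mu> \<nu> TS(2,1), where F="\<lambda>p. F (snd p, fst p)"])
    show "(\<lambda>p. F (snd p, fst p)) \<in> \<kappa>' \<Otimes>\<^sub>M \<kappa> \<rightarrow>\<^sub>M A" "(\<lambda>p. f (snd p, fst p)) \<in> \<nu> \<Otimes>\<^sub>M \<mu> \<rightarrow>\<^sub>M A"
      using F f by measurable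
  qed (use swap taut in simp_all)
  then show ?thesis
    using that[OF TS eq fst_of_tautological[OF \<nu> \<mu> TS F f eq taut(1)]] by simp
qed

text \<open>Going from one canonical image back to \<open>f\<close> and on to the other yields
  isomorphisms of the two pairs of measures. They preserve base points, since on both sides these
  are the laws of the sections of \<open>f\<close>; hence the measures coincide and the isomorphisms
  become fibre automorphisms.\<close>

lemma canonical_image_unique:
  assumes \<mu>: "prob_space \<mu>" and \<nu>: "prob_space \<nu>" and f: "f \<in> \<mu> \<Otimes>\<^sub>M \<nu> \<rightarrow>\<^sub>M A"
    and C: "canonical_image A \<mu> \<nu> f \<kappa> \<kappa>' F" and C': "canonical_image A \<mu> \<nu> f \<eta> \<eta>' G"
  shows "\<eta> = \<kappa> \<and> \<eta>' = \<kappa>' \<and> equal_upto_fibres \<kappa> \<kappa>' F G"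
proof -
  obtain T S where TS: "invertible_mp \<mu> \<kappa> T" "invertible_mp \<nu> \<kappa>' S"
    and eqF: "AE p in \<mu> \<Otimes>\<^sub>M \<nu>. F (T (fst p), S (snd p)) = f p"
    and fstTS: "AE x in \<mu>. fst (T x) = distr \<nu> A (\<lambda>y. f (x, y))" "AE y in \<nu>. fst (S y) = distr \<mu> A (\<lambda>x. f (x, y))"
    using canonical_image_coordinates[OF \<mu> \<nu> f C] .
  obtain T' S' where TS': "invertible_mp \<mu> \<eta> T'" "invertible_mp \<nu> \<eta>' S'"
    and eqG: "AE p in \<mu> \<Otimes>\<^sub>M \<nu>. G (T' (fst p), S' (snd p)) = f p"
    and fstTS': "AE x in \<mu>. fst (T' x) = distr \<nu> A (\<lambda>y. f (x, y))" "AE y in \<nu>. fst (S' y) = distr \<mu> A (\<lambda>x. f (x, y))"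
    using canonical_image_coordinates[OF \<mu> \<nu> f C'] .
  obtain R where R: "invertible_mp \<kappa> \<mu> R" "AE x in \<kappa>. T (R x) = x"
    using invertible_mp_sym[OF TS(1)] by metis
  obtain Q where Q: "invertible_mp \<kappa>' \<nu> Q" "AE y in \<kappa>'. S (Q y) = y"
    using invertible_mp_sym[OF TS(2)] by metis
  have su: "suitable A \<kappa>" "suitable A \<kappa>'" "suitable A \<eta>" "suitable A \<eta>'"
    using C C' by (auto simp: canonical_image_def)
  have "AE x in \<mu>. fst (T' x) = fst (T x)"
    using fstTS(1) fstTS'(1) by eventually_elim simp
  from invertible_mp_AE[OF R(1) this] R(2)
  have fibU: "AE x in \<kappa>. fst (T' (R x)) = fst x" by eventually_elim simp
  have "AE y in \<nu>. fst (S' y) = fst (S y)"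
    using fstTS(2) fstTS'(2) by eventually_elim simp
  from invertible_mp_AE[OF Q(1) this] Q(2)
  have fibV: "AE y in \<kappa>'. fst (S' (Q y)) = fst y" by eventually_elim simp
  note U = invertible_mp_trans[OF R(1) TS'(1)] and V = invertible_mp_trans[OF Q(1) TS'(2)]
  have eq: "\<kappa> = \<eta>" "\<kappa>' = \<eta>'"
    using suitable_fibred_isomorphism_eq[OF su(1,3) U fibU] suitable_fibred_isomorphism_eq[OF su(2,4) V fibV] by auto
  have "AE p in \<mu> \<Otimes>\<^sub>M \<nu>. G (T' (fst p), S' (snd p)) = F (T (fst p), S (snd p))"
    using eqF eqG by eventually_elim simp
  from AE_pair_invertible_mp[OF \<mu> \<nu> R(1) Q(1) this]
    AE_pair_fst_snd[OF suitable_prob_space[OF su(1)] suitable_prob_space[OF su(2)] R(2) Q(2)]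
  have "AE p in \<kappa> \<Otimes>\<^sub>M \<kappa>'. G (T' (R (fst p)), S' (Q (snd p))) = F p"
    by eventually_elim simp
  then have "equal_upto_fibres \<kappa> \<kappa>' F G"
    unfolding equal_upto_fibres_def using U V fibU fibV eq by blast
  then show ?thesis using eq by simp
qed

text \<open>Equal sections at \<open>x\<close> and \<open>x'\<close> pull back along
  \<open>S\<close> to equal sections of \<open>f\<close> at \<open>R x\<close> and
  \<open>R x'\<close>. Besides the preimage of the old exceptional set, the points with
  \<open>T (R x) \<noteq> x\<close> must be discarded so that \<open>R\<close> is injective on the
  rest. \<open>f\<close> is curried so that the transposed function gives the other half of
  purity.\<close>

lemma pure_section_transport:
  assumes R: "invertible_mp \<kappa> \<mu> R" "AE x in \<kappa>. T (R x) = x"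
    and S: "invertible_mp \<nu> \<kappa>' S" "AE y in \<nu>. R' (S y) = y"
    and pure: "\<exists>N\<in>null_sets \<mu>. \<forall>x\<in>space \<mu> - N. \<forall>x'\<in>space \<mu> - N. (AE y in \<nu>. f x y = f x' y) \<longrightarrow> x = x'"
  shows "\<exists>N\<in>null_sets \<kappa>. \<forall>x\<in>space \<kappa> - N. \<forall>x'\<in>space \<kappa> - N.
    (AE y in \<kappa>'. f (R x) (R' y) = f (R x') (R' y)) \<longrightarrow> x = x'"
proof -
  obtain N where N: "N \<in> null_sets \<mu>"
    and inj: "\<And>x x'. x \<in> space \<mu> - N \<Longrightarrow> x' \<in> space \<mu> - N \<Longrightarrow> (AE y in \<nu>. f x y = f x' y) \<Longrightarrow> x = x'"
    using pure by blast
  have "AE x in \<mu>. x \<notin> N" using N by (rule AE_not_in)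
  from invertible_mp_AE[OF R(1) this] R(2)
  have "AE x in \<kappa>. R x \<notin> N \<and> T (R x) = x" by eventually_elim simp
  then obtain N' where N': "{x \<in> space \<kappa>. \<not> (R x \<notin> N \<and> T (R x) = x)} \<subseteq> N'" "emeasure \<kappa> N' = 0" "N' \<in> sets \<kappa>"
    by (rule AE_E)
  show ?thesis
  proof (intro bexI[of _ N'] ballI impI)
    show "N' \<in> null_sets \<kappa>" using N' by (intro null_setsI)
    fix x x' assume x: "x \<in> space \<kappa> - N'" "x' \<in> space \<kappa> - N'"
      and ae: "AE y in \<kappa>'. f (R x) (R' y) = f (R x') (R' y)"
    have R_sp: "R x \<in> space \<mu> - N" "R x' \<in> space \<mu> - N" and TR: "T (R x) = x" "T (R x') = x'"
      using x N'(1) measurable_space[OF invertible_mp_measurable[OF R(1)]] by blast+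
    have "AE y in \<nu>. f (R x) y = f (R x') y"
      using invertible_mp_AE[OF S(1) ae] S(2) by eventually_elim simp
    from inj[OF R_sp this] show "x = x'" using TR by metis
  qed
qed

lemma canonical_image_exists:
  assumes A: "standard_borel A" and \<mu>: "lebesgue_space \<mu>" and \<nu>: "lebesgue_space \<nu>"
    and f [measurable]: "f \<in> \<mu> \<Otimes>\<^sub>M \<nu> \<rightarrow>\<^sub>M A" and pure: "pure_function \<mu> \<nu> f"
  shows "\<exists>\<kappa> \<kappa>' F. canonical_image A \<mu> \<nu> f \<kappa> \<kappa>' F"
proof -
  have prob: "prob_space \<mu>" "prob_space \<nu>" using \<mu> \<nu> by (auto simp: lebesgue_space_def)
  have "(\<lambda>x. \<nu>) \<in> \<mu> \<rightarrow>\<^sub>M prob_algebra \<nu>" "(\<lambda>y. \<mu>) \<in> \<nu> \<rightarrow>\<^sub>M prob_algebra \<mu>"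
    using prob by (auto simp: space_prob_algebra intro!: measurable_const)
  then have meas: "(\<lambda>x. distr \<nu> A (\<lambda>y. f (x, y))) \<in> \<mu> \<rightarrow>\<^sub>M prob_algebra A"
      "(\<lambda>y. distr \<mu> A (\<lambda>x. f (x, y))) \<in> \<nu> \<rightarrow>\<^sub>M prob_algebra A"
    by (auto intro!: measurable_distr_prob_space2)
  obtain \<kappa> T where \<kappa>: "suitable A \<kappa>" "invertible_mp \<mu> \<kappa> T"
    and T: "\<And>x. x \<in> space \<mu> \<Longrightarrow> fst (T x) = distr \<nu> A (\<lambda>y. f (x, y))"
    using suitable_realisation[OF A \<mu> meas(1)] by blast
  obtain \<kappa>' S where \<kappa>': "suitable A \<kappa>'" "invertible_mp \<nu> \<kappa>' S"
    and S: "\<And>y. y \<in> space \<nu> \<Longrightarrow> fst (S y) = distr \<mu> A (\<lambda>x. f (x, y))"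
    using suitable_realisation[OF A \<nu> meas(2)] by blast
  obtain R where R: "invertible_mp \<kappa> \<mu> R" "AE x in \<mu>. R (T x) = x" "AE x in \<kappa>. T (R x) = x"
    using \<kappa>(2) by (rule invertible_mp_sym)
  obtain Q where Q: "invertible_mp \<kappa>' \<nu> Q" "AE y in \<nu>. Q (S y) = y" "AE y in \<kappa>'. S (Q y) = y"
    using \<kappa>'(2) by (rule invertible_mp_sym)
  have RQ [measurable]: "R \<in> \<kappa> \<rightarrow>\<^sub>M \<mu>" "Q \<in> \<kappa>' \<rightarrow>\<^sub>M \<nu>"
    using R Q by (auto intro: invertible_mp_measurable)
  \<comment> \<open>\<open>f\<close> read through the inverses, which are measurable on the whole of
    the two canonical spaces. Since \<open>R\<close> and \<open>Q\<close> undo \<open>T\<close> and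
    \<open>S\<close> almost everywhere, this is equivalent to \<open>f\<close>.\<close>
  define F where "F p = f (R (fst p), Q (snd p))" for p
  have "tautological A \<kappa> \<kappa>' F"
    unfolding tautological_def
  proof
    show "AE x in \<kappa>. distr \<kappa>' A (\<lambda>y. F (x, y)) = fst x"
      using R(3) AE_space
    proof eventually_elim
      case (elim x)
      have x: "R x \<in> space \<mu>" using elim(2) measurable_space[OF RQ(1)] by blast
      have "distr \<kappa>' A (\<lambda>y. F (x, y)) = distr (distr \<kappa>' \<nu> Q) A (\<lambda>y. f (R x, y))"
        using x by (subst distr_distr) (auto simp: F_def comp_def)
      then show ?case using T[OF x] elim(1) invertible_mp_distr[OF Q(1)] by simp
    qed
    show "AE y in \<kappa>'. distr \<kappa> A (\<lambda>x. F (x, y)) = fst y"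
      using Q(3) AE_space
    proof eventually_elim
      case (elim y)
      have y: "Q y \<in> space \<nu>" using elim(2) measurable_space[OF RQ(2)] by blast
      have "distr \<kappa> A (\<lambda>x. F (x, y)) = distr (distr \<kappa> \<mu> R) A (\<lambda>x. f (x, Q y))"
        using y by (subst distr_distr) (auto simp: F_def comp_def)
      then show ?case using S[OF y] elim(1) invertible_mp_distr[OF R(1)] by simp
    qed
  qed
  moreover have "pure_function \<kappa> \<kappa>' F"
    using pure pure_section_transport[OF R(1,3) \<kappa>'(2) Q(2), of "\<lambda>x y. f (x, y)"]
      pure_section_transport[OF Q(1,3) \<kappa>(2) R(2), of "\<lambda>y x. f (x, y)"]
    unfolding pure_function_def by (simp add: F_def)
  moreover have "equivalent_functions \<mu> \<nu> f \<kappa> \<kappa>' F"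
    unfolding equivalent_functions_def
  proof (intro exI conjI)
    show "AE p in \<mu> \<Otimes>\<^sub>M \<nu>. F (T (fst p), S (snd p)) = f p"
      using AE_pair_fst_snd[OF prob R(2) Q(2)] by eventually_elim (simp add: F_def)
  qed (fact \<kappa>(2) \<kappa>'(2))+
  moreover have "F \<in> \<kappa> \<Otimes>\<^sub>M \<kappa>' \<rightarrow>\<^sub>M A" unfolding F_def by measurable
  ultimately show ?thesis
    unfolding canonical_image_def using \<kappa>(1) \<kappa>'(1) by blast
qed

text \<open>Only the equivalence clause of \<open>canonical_image\<close> mentions the original
  function, and equivalences compose. Invariance under equivalence thus becomes an instance of
  uniqueness for \<open>f\<close> itself.\<close>

lemma canonical_image_equivalent:
  assumes "prob_space \<mu>\<^sub>1" "prob_space \<nu>\<^sub>1" and "equivalent_functions \<mu> \<nu> f \<mu>\<^sub>1 \<nu>\<^sub>1 f\<^sub>1"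
    and C: "canonical_image A \<mu>\<^sub>1 \<nu>\<^sub>1 f\<^sub>1 \<kappa> \<kappa>' F"
  shows "canonical_image A \<mu> \<nu> f \<kappa> \<kappa>' F"
proof -
  obtain T S where TS: "invertible_mp \<mu> \<mu>\<^sub>1 T" "invertible_mp \<nu> \<nu>\<^sub>1 S"
      and eq: "AE p in \<mu> \<Otimes>\<^sub>M \<nu>. f\<^sub>1 (T (fst p), S (snd p)) = f p"
    using assms(3) unfolding equivalent_functions_def by blast
  obtain T' S' where TS': "invertible_mp \<mu>\<^sub>1 \<kappa> T'" "invertible_mp \<nu>\<^sub>1 \<kappa>' S'"
      and eq': "AE p in \<mu>\<^sub>1 \<Otimes>\<^sub>M \<nu>\<^sub>1. F (T' (fst p), S' (snd p)) = f\<^sub>1 p"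
    using C unfolding canonical_image_def equivalent_functions_def by blast
  have "AE p in \<mu> \<Otimes>\<^sub>M \<nu>. F (T' (T (fst p)), S' (S (snd p))) = f\<^sub>1 (T (fst p), S (snd p))"
    using AE_pair_invertible_mp[OF assms(1,2) TS, of "\<lambda>x y. F (T' x, S' y) = f\<^sub>1 (x, y)"] eq' by simp
  then have "AE p in \<mu> \<Otimes>\<^sub>M \<nu>. F (T' (T (fst p)), S' (S (snd p))) = f p"
    using eq by eventually_elim simp
  then have "equivalent_functions \<mu> \<nu> f \<kappa> \<kappa>' F"
    unfolding equivalent_functions_def
    using invertible_mp_trans[OF TS(1) TS'(1)] invertible_mp_trans[OF TS(2) TS'(2)] by blast
  then show ?thesis using C by (simp add: canonical_image_def)
qed

theorem theorem3:
  fixes A :: "'a measure"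
    and \<mu> :: "'x measure" and \<nu> :: "'y measure"
    and f :: "'x \<times> 'y \<Rightarrow> 'a"
  assumes "standard_borel A"
    and "lebesgue_space \<mu>" and "continuous_measure \<mu>"
    and "lebesgue_space \<nu>" and "continuous_measure \<nu>"
    and "f \<in> \<mu> \<Otimes>\<^sub>M \<nu> \<rightarrow>\<^sub>M A"
    and "pure_function \<mu> \<nu> f"
  shows "\<exists>\<mu>\<^sub>f \<nu>\<^sub>f Can.
    canonical_image A \<mu> \<nu> f \<mu>\<^sub>f \<nu>\<^sub>f Can \<and>
    (\<forall>\<kappa> \<kappa>' F. canonical_image A \<mu> \<nu> f \<kappa> \<kappa>' F \<longrightarrow>
       \<kappa> = \<mu>\<^sub>f \<and> \<kappa>' = \<nu>\<^sub>f \<and> equal_upto_fibres \<mu>\<^sub>f \<nu>\<^sub>f Can F) \<and>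
    (\<forall>(\<mu>\<^sub>1 :: 'u measure) (\<nu>\<^sub>1 :: 'v measure) f\<^sub>1.
       lebesgue_space \<mu>\<^sub>1 \<and> continuous_measure \<mu>\<^sub>1 \<and>
       lebesgue_space \<nu>\<^sub>1 \<and> continuous_measure \<nu>\<^sub>1 \<and>
       f\<^sub>1 \<in> \<mu>\<^sub>1 \<Otimes>\<^sub>M \<nu>\<^sub>1 \<rightarrow>\<^sub>M A \<and> pure_function \<mu>\<^sub>1 \<nu>\<^sub>1 f\<^sub>1 \<and>
       equivalent_functions \<mu> \<nu> f \<mu>\<^sub>1 \<nu>\<^sub>1 f\<^sub>1 \<longrightarrow>
       (\<forall>\<kappa> \<kappa>' F. canonical_image A \<mu>\<^sub>1 \<nu>\<^sub>1 f\<^sub>1 \<kappa> \<kappa>' F \<longrightarrow> \<kappa> = \<mu>\<^sub>f \<and> \<kappa>' = \<nu>\<^sub>f))"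
proof -
  have \<mu>: "prob_space \<mu>" and \<nu>: "prob_space \<nu>" using assms(2,4) by (auto simp: lebesgue_space_def)
  obtain \<kappa> \<kappa>' F where C: "canonical_image A \<mu> \<nu> f \<kappa> \<kappa>' F"
    using canonical_image_exists[OF assms(1,2,4,6,7)] by blast
  note unique = canonical_image_unique[OF \<mu> \<nu> assms(6) C]
  show ?thesis
  proof (intro exI conjI allI impI)
    show "canonical_image A \<mu> \<nu> f \<kappa> \<kappa>' F" by (rule C)
  next
    fix \<eta> \<eta>' G assume "canonical_image A \<mu> \<nu> f \<eta> \<eta>' G"
    from unique[OF this] show "\<eta> = \<kappa>" "\<eta>' = \<kappa>'" "equal_upto_fibres \<kappa> \<kappa>' F G" by auto
  next
    fix \<mu>\<^sub>1 :: "'u measure" and \<nu>\<^sub>1 :: "'v measure" and f\<^sub>1 \<eta> \<eta>' G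
    assume 1: "lebesgue_space \<mu>\<^sub>1 \<and> continuous_measure \<mu>\<^sub>1 \<and> lebesgue_space \<nu>\<^sub>1 \<and> continuous_measure \<nu>\<^sub>1 \<and>
       f\<^sub>1 \<in> \<mu>\<^sub>1 \<Otimes>\<^sub>M \<nu>\<^sub>1 \<rightarrow>\<^sub>M A \<and> pure_function \<mu>\<^sub>1 \<nu>\<^sub>1 f\<^sub>1 \<and> equivalent_functions \<mu> \<nu> f \<mu>\<^sub>1 \<nu>\<^sub>1 f\<^sub>1"
      and G: "canonical_image A \<mu>\<^sub>1 \<nu>\<^sub>1 f\<^sub>1 \<eta> \<eta>' G"
    have "canonical_image A \<mu> \<nu> f \<eta> \<eta>' G"
      by (rule canonical_image_equivalent[OF _ _ _ G]) (use 1 in \<open>auto simp: lebesgue_space_def\<close>)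
    from unique[OF this] show "\<eta> = \<kappa>" "\<eta>' = \<kappa>'" by auto
  qed
qed

end
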